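(* Let $Z_1,Z_2,\ldots\in\mathbb{R}^d$ be i.i.d. with distribution $F$, $Z\sim F$. For each $\lambda\in\mathbb{R}^q$ let $\hat\theta(\lambda)\in\mathbb{R}^p$ be the unique solution to $n^{-1}\sum_{i=1}^n\varphi(Z_i,\theta,\lambda)=0$, and let $\hat\lambda$ be the unique solution to $\mathrm{TE}'(\lambda)=o_p(1/\sqrt n)$, where $\mathrm{TE}(\lambda)=n^{-1}\sum_{i=1}^n\psi\{Z_i,\hat\theta(\lambda)\}$. With $\eta$ and $\Psi(\alpha)=\mathrm{E}\,\eta(Z,\alpha)$ as in the context, assume that $\Psi(\alpha)=0$ has a unique solution $\alpha_0$, that $\Psi$ is continuously differentiable in a neighbourhood of $\alpha_0$, that $\Psi'(\alpha_0)$ is non-singular, and that in a neighbourhood of $\alpha_0$ the norm of $\eta(z,\alpha)$ and all first order partial derivatives of $\eta$ with respect to $\alpha$ are bounded by functions $m_0(z)$ and $m_1(z)$, respectively, with $\mathrm{E}\,m_0(Z)^2,\mathrm{E}\,m_1(Z)^2<\infty$. For each $\lambda$ let $\theta(\lambda)$ be the solution to $\mathrm{E}\,\varphi(Z,\theta,\lambda)=0$. Then $\hat\theta(\hat\lambda)$ is consistent for $\theta_0=\theta(\lambda_0)$, where $\lambda_0$ is the solution to $\nabla_\lambda\mathrm{E}\,\psi\{Z,\theta(\lambda)\}=0$. Moreover, let $D=\theta'(\lambda_0)\in\mathbb{R}^{p\times q}$ with columns $D_1,\dots,D_q$, $\mathcal{Z}_1=H_{\lambda=\lambda_0}\mathrm{E}\,\psi\{Z,\theta(\lambda)\}\in\mathbb{R}^{q\times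 q}$, $\mathcal{Z}_2=H_{\theta=\theta_0}\mathrm{E}\,\psi(Z,\theta)\in\mathbb{R}^{p\times p}$, $J=-\partial_{\theta=\theta_0}\mathrm{E}\,\varphi(Z,\theta,\lambda_0)$ and $b=\nabla_{\theta=\theta_0}\mathrm{E}\,\psi(Z,\theta)$. Then $$\hat\theta(\hat\lambda)=\theta_0+A_1\frac1n\sum_{i=1}^n\varphi(Z_i,\theta_0,\lambda_0)+A_2\frac1n\sum_{i=1}^n\nabla_{\theta=\theta_0}\psi(Z_i,\theta)+A_3\frac1n\sum_{i=1}^n\{\partial_{\theta=\theta_0}\varphi(Z_i,\theta,\lambda_0)D+\partial_{\lambda=\lambda_0}\varphi(Z_i,\theta_0,\lambda)\}+o_p(1/\sqrt n),$$ where $$A_1=J^{-1}-D\mathcal{Z}_1^{-1}\{D^T\mathcal{Z}_2+W\}J^{-1},\qquad A_2=-D\mathcal{Z}_1^{-1}D^T,\qquad A_3=-D\mathcal{Z}_1^{-1}M.$$ Here $M$ is the $q\times pq$ block diagonal matrix whose diagonal blocks are all equal to $b^TJ^{-1}$, and $W$ is the $q\times p$ matrix whose $j$-th row is $b^TJ^{-1}W^j$, $j=1,\dots,q$, with $$W^j=\begin{pmatrix}D_j^TH_{\theta=\theta_0}\mathrm{E}\,\varphi^1(Z,\theta,\lambda_0)\\ \vdots\\ D_j^TH_{\theta=\theta_0}\mathrm{E}\,\varphi^p(Z,\theta,\lambda_0)\end{pmatrix}+\partial_{\lambda^j}\partial_\theta\mathrm{E}\,\varphi(Z,\theta,\lambda)\Big|_{\theta=\theta_0,\lambda=\lambda_0}\in\mathbb{R}^{p\times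 p}.$$ In particular, $\sqrt n\{\hat\theta(\hat\lambda)-\theta_0\}$ converges in law to $\mathrm{N}\{0,A^*K^*(A^* )^T\}$, where $A^*=(A_1,\,-D\mathcal{Z}_1^{-1},\,A_3)$ and $K^*=\mathrm{Var}\,\eta(Z,\theta_0,\lambda_0,D)$.
   Context: $\varphi=(\varphi^1,\ldots,\varphi^p)^T\colon\mathbb{R}^{d+p+q}\to\mathbb{R}^p$ is the estimating function and $\psi\colon\mathbb{R}^{d+p}\to\mathbb{R}$ the loss function; both are smooth enough in $(\theta,\lambda)$ that all derivatives appearing exist. $\nabla$, $H$ and $\partial$ denote gradient, Hessian matrix and Jacobian matrix; a prime denotes the Jacobian with respect to the argument; $\lambda^j$ is the $j$-th coordinate of $\lambda$. $\hat\theta'(\lambda)\in\mathbb{R}^{p\times q}$ is the Jacobian of $\lambda\mapsto\hat\theta(\lambda)$. Matrices in $\mathbb{R}^{p\times q}$ are identified with vectors in $\mathbb{R}^{pq}$ by stacking columns (in particular the last sum, multiplied by $A_3$, is viewed as a vector in $\mathbb{R}^{pq}$). With $\alpha=(\theta^T,\lambda^T,D^T)^T\in\mathbb{R}^{p+q+pq}$, the function $\eta(z,\alpha)=(\eta_1^T,\eta_2^T,\eta_3^T)^T\in\mathbb{R}^{p+q+pq}$ is defined by $\eta_1=\varphi(z,\theta,\lambda)$, $\eta_2=D^T\nabla_\theta\psi(z,\theta)$, $\eta_3=\partial_\theta\varphi(z,\theta,\lambda)D+\partial_\lambda\varphi(z,\theta,\lambda)$. *)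

theory Defs
  imports "HOL-Probability.Probability"
begin

definition grad :: "(real ^ 'n \<Rightarrow> real) \<Rightarrow> real ^ 'n \<Rightarrow> real ^ 'n" where
  "grad f x = (THE D. GDERIV f x :> D)"

definition hessian :: "(real ^ 'n \<Rightarrow> real) \<Rightarrow> real ^ 'n \<Rightarrow> real ^ 'n ^ 'n" where
  "hessian f x = jacobian (grad f) (at x)"

text \<open>A \<open>p \<times> q\<close> matrix has type \<open>real ^ 'q ^ 'p\<close>.  The index type \<open>'q \<times> 'p\<close> lists
  its entries column by column: \<open>(j, i)\<close> is the \<open>i\<close>-th entry of the \<open>j\<close>-th column.  Stacked
  vectors in \<open>p + q + pq\<close> dimensions are indexed by \<open>'p + 'q + 'q \<times> 'p\<close>.\<close>

definition vec_cols :: "real ^ 'q ^ 'p \<Rightarrow> real ^ ('q \<times> 'p)" where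
  "vec_cols A = (\<chi> k. A $ snd k $ fst k)"

definition stack3 :: "real ^ 'a \<Rightarrow> real ^ 'b \<Rightarrow> real ^ 'c \<Rightarrow> real ^ ('a + 'b + 'c)" where
  "stack3 u v w = (\<chi> k. case k of Inl i \<Rightarrow> u $ i | Inr (Inl j) \<Rightarrow> v $ j | Inr (Inr l) \<Rightarrow> w $ l)"

definition hcat3 ::
  "real ^ 'a ^ 'm \<Rightarrow> real ^ 'b ^ 'm \<Rightarrow> real ^ 'c ^ 'm \<Rightarrow> real ^ ('a + 'b + 'c) ^ 'm" where
  "hcat3 A B C = (\<chi> i. stack3 (A $ i) (B $ i) (C $ i))"

definition theta_part ::
  "real ^ ('p::finite + 'q::finite + 'q \<times> 'p) \<Rightarrow> real ^ 'p" where
  "theta_part \<alpha> = (\<chi> i. \<alpha> $ Inl i)"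

definition lambda_part ::
  "real ^ ('p::finite + 'q::finite + 'q \<times> 'p) \<Rightarrow> real ^ 'q" where
  "lambda_part \<alpha> = (\<chi> j. \<alpha> $ Inr (Inl j))"

definition D_part :: "real ^ ('p + 'q + 'q \<times> 'p) \<Rightarrow> real ^ 'q ^ 'p" where
  "D_part \<alpha> = (\<chi> i j. \<alpha> $ Inr (Inr (j, i)))"

text \<open>The block diagonal \<open>q \<times> pq\<close> matrix all of whose diagonal blocks are the row vector \<open>r\<close>.\<close>

definition block_diag_row :: "real ^ 'p \<Rightarrow> real ^ ('q \<times> 'p) ^ 'q" where
  "block_diag_row r = (\<chi> j k. if fst k = j then r $ snd k else 0)"

definition eta ::
  "('z \<Rightarrow> real ^ 'p \<Rightarrow> real ^ 'q \<Rightarrow> real ^ 'p) \<Rightarrow> ('z \<Rightarrow> real ^ 'p \<Rightarrow> real) \<Rightarrow>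
    'z \<Rightarrow> real ^ ('p + 'q + 'q \<times> 'p) \<Rightarrow> real ^ ('p + 'q + 'q \<times> 'p)" where
  "eta \<phi> \<psi> z \<alpha> =
     (let t = theta_part \<alpha>; l = lambda_part \<alpha>; D = D_part \<alpha> in
      stack3 (\<phi> z t l)
             (transpose D *v grad (\<psi> z) t)
             (vec_cols (jacobian (\<lambda>t. \<phi> z t l) (at t) ** D + jacobian (\<lambda>l. \<phi> z t l) (at l))))"

definition sample_mean :: "(nat \<Rightarrow> 'w \<Rightarrow> 'z) \<Rightarrow> nat \<Rightarrow> 'w \<Rightarrow> ('z \<Rightarrow> 'b::real_vector) \<Rightarrow> 'b" where
  "sample_mean Z n \<omega> g = (1 / real n) *\<^sub>R (\<Sum>i = 1..n. g (Z i \<omega>))"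

text \<open>\<open>small_op M X a\<close> is \<open>X n = o\<^sub>p(a n)\<close>.  Here and in \<open>converges_in_law\<close>
  measurability is included, since \<open>measure\<close> and the Bochner integral
  are \<open>0\<close> by convention on non-measurable arguments.\<close>

definition small_op ::
  "'w measure \<Rightarrow> (nat \<Rightarrow> 'w \<Rightarrow> 'b::real_normed_vector) \<Rightarrow> (nat \<Rightarrow> real) \<Rightarrow> bool" where
  "small_op M X a \<longleftrightarrow>
     (\<forall>n. X n \<in> borel_measurable M) \<and>
     (\<forall>\<epsilon>>0. (\<lambda>n. measure M {\<omega> \<in> space M. norm (X n \<omega>) > \<epsilon> * a n}) \<longlonglongrightarrow> 0)"

definition consistent_for ::
  "'w measure \<Rightarrow> (nat \<Rightarrow> 'w \<Rightarrow> 'b::real_normed_vector) \<Rightarrow> 'b \<Rightarrow> bool" where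
  "consistent_for M X c \<longleftrightarrow> small_op M (\<lambda>n \<omega>. X n \<omega> - c) (\<lambda>_. 1)"

definition converges_in_law ::
  "'w measure \<Rightarrow> (nat \<Rightarrow> 'w \<Rightarrow> 'b::topological_space) \<Rightarrow> 'b measure \<Rightarrow> bool" where
  "converges_in_law M X N \<longleftrightarrow>
     (\<forall>n. X n \<in> borel_measurable M) \<and>
     (\<forall>f :: 'b \<Rightarrow> real. continuous_on UNIV f \<and> bounded (range f) \<longrightarrow>
        (\<lambda>n. \<integral>\<omega>. f (X n \<omega>) \<partial>M) \<longlonglongrightarrow> (\<integral>x. f x \<partial>N))"

text \<open>\<open>normal_density\<close> takes the standard deviation; variance \<open>0\<close> gives a point mass.\<close>

definition normal_law :: "real \<Rightarrow> real \<Rightarrow> real measure" where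
  "normal_law m v =
     (if v = 0 then return borel m else density lborel (\<lambda>x. ennreal (normal_density m (sqrt v) x)))"

text \<open>\<open>N\<close> is the (possibly degenerate) distribution \<open>N(\<mu>, \<Sigma>)\<close>: every linear
  functional \<open>u\<^sup>T x\<close> is normal with mean \<open>u\<^sup>T \<mu>\<close> and variance \<open>u\<^sup>T \<Sigma> u\<close>.  By the
  Cramer-Wold theorem this determines \<open>N\<close>.\<close>

definition is_multivariate_normal ::
  "(real ^ 'n) measure \<Rightarrow> real ^ 'n \<Rightarrow> real ^ 'n ^ 'n \<Rightarrow> bool" where
  "is_multivariate_normal N \<mu> \<Sigma> \<longleftrightarrow>
     prob_space N \<and> sets N = sets borel \<and>
     transpose \<Sigma> = \<Sigma> \<and> (\<forall>u. 0 \<le> u \<bullet> (\<Sigma> *v u)) \<and>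
     (\<forall>u. distr N borel (\<lambda>x. u \<bullet> x) = normal_law (u \<bullet> \<mu>) (u \<bullet> (\<Sigma> *v u)))"

definition variance_matrix :: "'z measure \<Rightarrow> ('z \<Rightarrow> real ^ 'n) \<Rightarrow> real ^ 'n ^ 'n" where
  "variance_matrix F g =
     (\<chi> k l. \<integral>z. (g z $ k - (\<integral>y. g y $ k \<partial>F)) * (g z $ l - (\<integral>y. g y $ l \<partial>F)) \<partial>F)"

end

theory Submission
  imports Defs
begin

text \<open>Write \<open>P\<^sub>n\<close> for the empirical mean.  Both \<open>\<Psi>\<close> and \<open>P\<^sub>n \<eta>\<close> have the shape
  \<open>(f, D\<^sup>T G, P D + Q)\<close>, so a zero of \<open>P\<^sub>n \<eta> - (0, R n, 0)\<close> at which the empirical \<open>P\<close> is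
  invertible has, by the implicit function theorem and the chain rule, \<open>\<theta>\<close>-part
  \<open>theta_hat (lambda_hat)\<close>, by the uniqueness hypotheses.  Since \<open>\<eta>\<close> is differentiable at \<open>\<alpha>\<^sub>0\<close>
  with dominated derivative, with probability tending to one \<open>P\<^sub>n \<eta>\<close> differs from
  \<open>P\<^sub>n \<eta>(\<alpha>\<^sub>0) + V (\<alpha> - \<alpha>\<^sub>0)\<close>, \<open>V = \<Psi>'(\<alpha>\<^sub>0)\<close>, by at most \<open>c |\<alpha> - \<alpha>\<^sub>0|\<close> on a small ball, \<open>c\<close> being
  arbitrarily small; Brouwer's theorem then produces such a zero, and it equals
  \<open>\<alpha>\<^sub>0 - V\<^sup>-\<^sup>1 P\<^sub>n \<eta>(\<alpha>\<^sub>0) + o\<^sub>p(1 / sqrt n)\<close>.  That the \<open>\<theta>\<close>-rows of \<open>- V\<^sup>-\<^sup>1\<close> are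
  \<open>(A\<^sub>1, - D Z1\<^sup>-\<^sup>1, A\<^sub>3)\<close> is block elimination, where \<open>Z1\<close> is identified by differentiating
  \<open>\<Psi>(\<theta>(\<lambda>), \<lambda>, \<theta>'(\<lambda>)) = (0, \<nabla>E \<psi>(\<theta>(\<lambda>)), 0)\<close> at \<open>lambda0\<close>.\<close>

section \<open>Roots of perturbed linear maps and second derivatives\<close>

text \<open>\<eta> is differentiable in \<alpha> with a dominated derivative, but no continuity of
  that derivative is at hand, so the empirical derivative at the random root is out of control. Two
  steps are shaped by this. The linearisation comes from the supremum of the remainder ratios at the
  fixed point \<open>\<alpha>\<^sub>0\<close>: it is dominated and tends to 0 pointwise, so its mean
  is small on a small ball, and a law of large numbers for this one function gives uniformity.
  Invertibility of the empirical \<open>P\<close> at the root is extracted from the linearisation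
  itself: a null vector of \<open>P\<close> would let \<open>D\<close> move without changing the
  third block, whereas \<open>V\<close> must move it. The hypotheses speak of \<eta>, in which
  \<open>P\<close> and \<open>G\<close> occur multiplied by \<open>D\<close>. Since they hold for
  varying \<open>D\<close>, comparing two values of \<open>D\<close> isolates the factors and yields
  their integrability, differentiability and bounds. In \<open>Wj\<close> the derivative in \<theta>
  is taken before the one in \<lambda>, in \<open>V\<close> after it, whence the lemma on mixed
  partials.\<close>

lemma brouwer_root_near_linear:
  fixes h :: "'a::euclidean_space \<Rightarrow> 'a"
  assumes cont: "continuous_on (cball a \<delta>) h" and "\<delta> > 0"
    and L': "linear L'" "\<And>x. L' (L x) = x" "\<And>x. norm (L' x) \<le> \<kappa> * norm x"
    and near: "\<And>x. x \<in> cball a \<delta> \<Longrightarrow> norm (h x - h a - L (x - a)) \<le> c * norm (x - a)"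
    and small: "\<kappa> * c \<le> 1 / 2" "\<kappa> * norm (h a) \<le> \<delta> / 2" and "0 \<le> \<kappa>" "0 \<le> c"
  shows "\<exists>x\<in>cball a \<delta>. h x = 0 \<and> norm (x - a) \<le> 2 * \<kappa> * norm (h a) \<and>
    norm (x - a + L' (h a)) \<le> 2 * \<kappa>\<^sup>2 * c * norm (h a)"
proof -
  interpret L': linear L' by fact
  have inj: "L' y = 0 \<Longrightarrow> y = 0" for y
  proof -
    have "inj L" by (metis L'(2) injI)
    have "surj L'" by (metis L'(2) surjI)
    then have "inj L'" using linear_surjective_imp_injective[OF L'(1)] by simp
    then show "L' y = 0 \<Longrightarrow> y = 0" using linear_injective_0[OF L'(1)] by blast
  qed
  define T where "T x = x - L' (h x)" for x
  have rem: "norm (T x - a + L' (h a)) \<le> \<kappa> * c * norm (x - a)" if "x \<in> cball a \<delta>" for x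
  proof -
    have "T x - a + L' (h a) = - L' (h x - h a - L (x - a))"
      by (simp add: T_def L'.diff L'(2))
    then have "norm (T x - a + L' (h a)) \<le> \<kappa> * norm (h x - h a - L (x - a))"
      using L'(3) by simp
    also have "\<dots> \<le> \<kappa> * (c * norm (x - a))" using near[OF that] \<open>0 \<le> \<kappa>\<close> by (rule mult_left_mono)
    finally show ?thesis by simp
  qed
  have "continuous_on (cball a \<delta>) T"
    unfolding T_def
    by (intro continuous_intros linear_continuous_on_compose[OF cont L'(1)])
  moreover have "T ` cball a \<delta> \<subseteq> cball a \<delta>"
  proof clarify
    fix x assume x: "x \<in> cball a \<delta>"
    have "norm (T x - a) \<le> norm (T x - a + L' (h a)) + norm (L' (h a))"
      by (metis add_diff_cancel_right' norm_triangle_ineq4)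
    also have "\<dots> \<le> \<kappa> * c * norm (x - a) + \<kappa> * norm (h a)" using rem[OF x] L'(3) by (intro add_mono)
    also have "\<dots> \<le> 1 / 2 * \<delta> + \<delta> / 2"
      using x small \<open>0 \<le> \<kappa>\<close> \<open>0 \<le> c\<close> by (intro add_mono mult_mono) (auto simp: dist_norm norm_minus_commute)
    finally show "T x \<in> cball a \<delta>" by (simp add: dist_norm norm_minus_commute)
  qed
  ultimately obtain x where x: "x \<in> cball a \<delta>" "T x = x"
    using brouwer_ball[OF \<open>\<delta> > 0\<close>, of a T] by (auto simp: image_subset_iff_funcset)
  then have "h x = 0" using inj by (simp add: T_def)
  have r: "norm (x - a + L' (h a)) \<le> \<kappa> * c * norm (x - a)" using rem[OF x(1)] x(2) by simp
  have "norm (x - a) \<le> norm (x - a + L' (h a)) + norm (L' (h a))"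
    by (metis add_diff_cancel_right' norm_triangle_ineq4)
  also have "\<dots> \<le> \<kappa> * c * norm (x - a) + \<kappa> * norm (h a)" using r L'(3) by (intro add_mono)
  \<comment> \<open>The term with factor 1/2 is absorbed on the left, which is where the 2 in the
    bound \<open>2 * \<kappa> * norm (h a)\<close> comes from.\<close>
  also have "\<dots> \<le> 1 / 2 * norm (x - a) + \<kappa> * norm (h a)"
    using small by (intro add_mono mult_right_mono) auto
  finally have n: "norm (x - a) \<le> 2 * \<kappa> * norm (h a)" by simp
  have "norm (x - a + L' (h a)) \<le> \<kappa> * c * (2 * \<kappa> * norm (h a))"
    using r mult_left_mono[OF n, of "\<kappa> * c"] \<open>0 \<le> \<kappa>\<close> \<open>0 \<le> c\<close> by simp
  then show ?thesis using x(1) \<open>h x = 0\<close> n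
    by (intro bexI[of _ x]) (simp_all add: power2_eq_square algebra_simps)
qed

text \<open>Differentiability at the single point \<open>(t0, l0)\<close> suffices: Brouwer's theorem replaces the
  contraction argument of the usual proof, and the uniqueness of the root is an assumption.\<close>

lemma has_derivative_implicit_root:
  fixes f :: "'a::euclidean_space \<times> 'b::euclidean_space \<Rightarrow> 'a"
  assumes der: "(f has_derivative f') (at (t0, l0))" and zero: "f (t0, l0) = 0"
    and U: "open U" "(t0, l0) \<in> U" "continuous_on U f"
    and P': "linear P'" "\<And>x. P' (f' (x, 0)) = x"
    and uniq: "\<forall>\<^sub>F l in nhds l0. \<forall>t. f (t, l) = 0 \<longrightarrow> t = \<tau> l"
  shows "(\<tau> has_derivative (\<lambda>x. - P' (f' (0, x)))) (at l0)"
proof -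
  interpret P': linear P' by fact
  interpret f': bounded_linear f' using der by (rule has_derivative_bounded_linear)
  have inj: "P' y = 0 \<Longrightarrow> y = 0" for y
  proof -
    have "surj P'" using surjI[of P' "\<lambda>x. f' (x, 0)"] P'(2) by simp
    then have "inj P'" using linear_surjective_imp_injective[OF P'(1)] by simp
    then show "P' y = 0 \<Longrightarrow> y = 0" using linear_injective_0[OF P'(1)] by blast
  qed
  obtain \<kappa> where \<kappa>: "\<kappa> > 0" "\<And>x. norm (P' x) \<le> \<kappa> * norm x"
    using linear_bounded_pos[OF P'(1)] by blast
  obtain B where B: "B > 0" "\<And>x. norm (f' x) \<le> norm x * B" using f'.pos_bounded by blast
  \<comment> \<open>For \<open>r = norm (l - l0)\<close> the ball of radius \<open>K * r\<close>
    must be mapped into itself: the first-order displacement \<open>P' (f' (0, l - l0))\<close> has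
    norm at most \<open>\<kappa> * B * r\<close>, and the summand 1 leaves room \<open>r\<close> for
    the remainder.\<close>
  define K where "K = \<kappa> * B + 1"
  have "K > 0" using \<kappa> B by (simp add: K_def pos_add_strict)
  obtain u where u: "u > 0" "ball (t0, l0) u \<subseteq> U" using U openE by blast
  obtain e0 where e0: "e0 > 0" "\<And>l t. norm (l - l0) < e0 \<Longrightarrow> f (t, l) = 0 \<Longrightarrow> t = \<tau> l"
    using uniq unfolding eventually_nhds_metric dist_norm by blast
  have \<tau>0: "\<tau> l0 = t0" using e0(2)[of l0 t0] e0(1) zero by simp
  have split: "f' (x, y) = f' (x, 0) + f' (0, y)" for x y
    using f'.add[of "(x, 0)" "(0, y)"] by simp
  have main: "\<exists>d>0. \<forall>y. norm (y - l0) < d \<longrightarrow> norm (\<tau> y - \<tau> l0 - - P' (f' (0, y - l0))) \<le> e * norm (y - l0)"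
    if "e > 0" for e
  proof -
    \<comment> \<open>On that ball the remainder is at most
      \<open>\<kappa> * c * (K + 1) * r\<close>. The minimum serves two ends: the bound
      \<open>r\<close> for the self-map property and the bound \<open>e * r\<close> for the
      derivative estimate.\<close>
    define c where "c = min e 1 / (\<kappa> * (K + 1))"
    have c: "c > 0" "\<kappa> * c * (K + 1) \<le> e" "\<kappa> * c * (K + 1) \<le> 1"
      using \<kappa> \<open>K > 0\<close> \<open>e > 0\<close> by (auto simp: c_def)
    obtain d where d: "d > 0"
      "\<And>x. norm (x - (t0, l0)) < d \<Longrightarrow> norm (f x - f (t0, l0) - f' (x - (t0, l0))) \<le> c * norm (x - (t0, l0))"
      using der c(1) unfolding has_derivative_at_alt by blast
    define d' where "d' = min e0 (min d u / (K + 1))"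
    have "d' > 0" using d e0 u \<open>K > 0\<close> by (simp add: d'_def)
    moreover have "norm (\<tau> l - \<tau> l0 - - P' (f' (0, l - l0))) \<le> e * norm (l - l0)" if l: "norm (l - l0) < d'" for l
    proof (cases "l = l0")
      case True then show ?thesis using f'.zero P'.zero by (simp add: zero_prod_def[symmetric])
    next
      case False
      define r where "r = norm (l - l0)"
      have r: "r > 0" using False by (simp add: r_def)
      have ne: "norm ((t, l) - (t0, l0)) \<le> (K + 1) * r" "(K + 1) * r < min d u" if "t \<in> cball t0 (K * r)" for t
      proof -
        have "norm ((t, l) - (t0, l0)) \<le> norm (t - t0) + norm (l - l0)" using norm_Pair_le[of "t - t0" "l - l0"] by simp
        also have "\<dots> \<le> (K + 1) * r" using that by (simp add: r_def algebra_simps dist_norm norm_minus_commute)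
        finally show "norm ((t, l) - (t0, l0)) \<le> (K + 1) * r" .
        show "(K + 1) * r < min d u" using l \<open>K > 0\<close> unfolding d'_def r_def[symmetric]
          by (simp add: pos_less_divide_eq mult.commute)
      qed
      define T where "T t = t - P' (f (t, l))" for t
      have rem: "norm (T t - t0 - - P' (f' (0, l - l0))) \<le> \<kappa> * c * (K + 1) * r" if t: "t \<in> cball t0 (K * r)" for t
      proof -
        have "T t - t0 - - P' (f' (0, l - l0)) = - P' (f (t, l) - f (t0, l0) - f' ((t, l) - (t0, l0)))"
          using split[of "t - t0" "l - l0"] by (simp add: T_def zero P'.diff P'.add P'(2))
        then have "norm (T t - t0 - - P' (f' (0, l - l0))) \<le> \<kappa> * norm (f (t, l) - f (t0, l0) - f' ((t, l) - (t0, l0)))"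
          using \<kappa>(2) by simp
        also have "\<dots> \<le> \<kappa> * (c * norm ((t, l) - (t0, l0)))"
          using ne[OF t] \<kappa> by (intro mult_left_mono d(2)) auto
        also have "\<dots> \<le> \<kappa> * (c * ((K + 1) * r))" using ne[OF t] \<kappa> c by (intro mult_left_mono) auto
        finally show ?thesis by simp
      qed
      have "(t, l) \<in> U" if "t \<in> cball t0 (K * r)" for t
      proof -
        have "norm ((t, l) - (t0, l0)) < u" using ne[OF that] by linarith
        then have "(t, l) \<in> ball (t0, l0) u" by (simp only: mem_ball dist_norm norm_minus_commute)
        then show ?thesis using u(2) by blast
      qed
      then have "continuous_on (cball t0 (K * r)) (\<lambda>t. f (t, l))"
        by (intro continuous_on_compose2[OF U(3)] continuous_intros) auto
      then have "continuous_on (cball t0 (K * r)) T"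
        unfolding T_def by (intro continuous_intros linear_continuous_on_compose[OF _ P'(1)])
      moreover have "T ` cball t0 (K * r) \<subseteq> cball t0 (K * r)"
      proof clarify
        fix t assume t: "t \<in> cball t0 (K * r)"
        have "norm (T t - t0) \<le> norm (T t - t0 - - P' (f' (0, l - l0))) + norm (P' (f' (0, l - l0)))"
          by (metis norm_minus_cancel norm_triangle_sub add.commute)
        also have "\<dots> \<le> 1 * r + \<kappa> * (r * B)"
        proof (rule add_mono)
          show "norm (T t - t0 - - P' (f' (0, l - l0))) \<le> 1 * r"
            using rem[OF t] mult_right_mono[OF c(3), of r] r by linarith
          have "norm (P' (f' (0, l - l0))) \<le> \<kappa> * norm (f' (0, l - l0))" by (rule \<kappa>(2))
          also have "\<dots> \<le> \<kappa> * (r * B)" using B(2)[of "(0, l - l0)"] \<kappa>(1)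
            by (intro mult_left_mono) (auto simp: r_def)
          finally show "norm (P' (f' (0, l - l0))) \<le> \<kappa> * (r * B)" .
        qed
        finally show "T t \<in> cball t0 (K * r)" by (simp add: K_def algebra_simps dist_norm norm_minus_commute)
      qed
      ultimately obtain t where t: "t \<in> cball t0 (K * r)" "T t = t"
        using brouwer_ball[of "K * r" t0 T] r \<open>K > 0\<close> by (auto simp: image_subset_iff_funcset)
      then have "f (t, l) = 0" using inj by (simp add: T_def)
      then have "\<tau> l = t" using e0(2) l by (simp add: d'_def)
      have "norm (t - t0 - - P' (f' (0, l - l0))) \<le> e * r"
        using rem[OF t(1)] mult_right_mono[OF c(2) less_imp_le[OF r]] unfolding t(2) by (rule order_trans)
      then show ?thesis using \<open>\<tau> l = t\<close> \<tau>0 by (simp add: r_def)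
    qed
    ultimately show ?thesis by blast
  qed
  have "bounded_linear (\<lambda>x. f' (0, x))"
    by (rule bounded_linear_compose[OF f'.bounded_linear_axioms])
      (intro bounded_linear_Pair bounded_linear_zero bounded_linear_ident)
  from bounded_linear_compose[OF P'(1)[unfolded linear_conv_bounded_linear] this]
  have "bounded_linear (\<lambda>x. - P' (f' (0, x)))" by (rule bounded_linear_minus)
  then show ?thesis unfolding has_derivative_at_alt using main by blast
qed

text \<open>Freeze the increment in direction \<open>w\<close> and apply the mean value theorem in
  direction \<open>u\<close>: the second difference becomes \<open>s\<close> times a difference of
  two values of \<open>f' _ u\<close>, to which the first-order expansion at \<open>x0\<close>
  applies. Second derivatives away from \<open>x0\<close> never enter.\<close>

lemma second_difference_expansion:
  fixes f :: "'a::real_normed_vector \<Rightarrow> real"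
  assumes der: "\<forall>\<^sub>F x in nhds x0. (f has_derivative f' x) (at x)"
    and A: "((\<lambda>x. f' x u) has_derivative A) (at x0)" and "e > 0"
  shows "\<exists>d>0. \<forall>s. 0 < s \<and> s < d \<longrightarrow>
    \<bar>f (x0 + s *\<^sub>R u + s *\<^sub>R w) - f (x0 + s *\<^sub>R u) - f (x0 + s *\<^sub>R w) + f x0 - s\<^sup>2 * A w\<bar> \<le> e * s\<^sup>2"
proof -
  interpret A: bounded_linear A using A by (rule has_derivative_bounded_linear)
  \<comment> \<open>All points of the second difference, and the intermediate point of the mean
    value theorem, lie within \<open>s * C\<close> of \<open>x0\<close>.\<close>
  define C where "C = norm u + norm w + 1"
  have C: "C > 0" by (simp add: C_def add_nonneg_pos)
  obtain d1 where d1: "d1 > 0" "\<And>x. norm (x - x0) < d1 \<Longrightarrow> (f has_derivative f' x) (at x)"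
    using der unfolding eventually_nhds_metric dist_norm by blast
  obtain d2 where d2: "d2 > 0" "\<And>x. norm (x - x0) < d2 \<Longrightarrow>
      norm (f' x u - f' x0 u - A (x - x0)) \<le> (e / (2 * C)) * norm (x - x0)"
    using A \<open>e > 0\<close> C unfolding has_derivative_at_alt by (metis divide_pos_pos zero_less_mult_iff zero_less_numeral)
  define d where "d = min d1 d2 / C"
  have "d > 0" using d1 d2 C by (simp add: d_def)
  moreover have "\<bar>f (x0 + s *\<^sub>R u + s *\<^sub>R w) - f (x0 + s *\<^sub>R u) - f (x0 + s *\<^sub>R w) + f x0 - s\<^sup>2 * A w\<bar> \<le> e * s\<^sup>2"
    if s: "0 < s" "s < d" for s
  proof -
    have sC: "s * C < d1" "s * C < d2" using s C by (auto simp: d_def pos_less_divide_eq)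
    have nb: "norm ((r * s) *\<^sub>R u + q *\<^sub>R w) \<le> s * C" if "0 \<le> r" "r \<le> 1" "0 \<le> q" "q \<le> s" for r q
    proof -
      have "norm ((r * s) *\<^sub>R u + q *\<^sub>R w) \<le> r * s * norm u + q * norm w"
        using that s by (intro norm_triangle_le) simp
      also have "\<dots> \<le> 1 * s * norm u + s * norm w" using that s by (intro add_mono mult_right_mono) auto
      also have "\<dots> \<le> s * C" using s by (simp add: C_def algebra_simps)
      finally show ?thesis .
    qed
    \<comment> \<open>The term \<open>0 *\<^sub>R w\<close> is written out so that both summands are
      instances, with \<open>q = s\<close> and \<open>q = 0\<close>, of the facts \<open>g\<close>
      and \<open>est\<close>.\<close>
    define \<phi> where "\<phi> r = f (x0 + ((r * s) *\<^sub>R u + s *\<^sub>R w)) - f (x0 + ((r * s) *\<^sub>R u + 0 *\<^sub>R w))" for r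
    define \<phi>' where "\<phi>' r = s * f' (x0 + ((r * s) *\<^sub>R u + s *\<^sub>R w)) u - s * f' (x0 + ((r * s) *\<^sub>R u + 0 *\<^sub>R w)) u" for r
    have g: "((\<lambda>r. f (x0 + ((r * s) *\<^sub>R u + q *\<^sub>R w))) has_real_derivative s * f' (x0 + ((r * s) *\<^sub>R u + q *\<^sub>R w)) u) (at r)"
      if "0 \<le> r" "r \<le> 1" "0 \<le> q" "q \<le> s" for r q
    proof -
      have D: "(f has_derivative f' (x0 + ((r * s) *\<^sub>R u + q *\<^sub>R w))) (at (x0 + ((r * s) *\<^sub>R u + q *\<^sub>R w)))"
        using nb[OF that] sC by (intro d1(2)) simp
      have "((\<lambda>r. x0 + ((r * s) *\<^sub>R u + q *\<^sub>R w)) has_derivative (\<lambda>h. (h * s) *\<^sub>R u)) (at r)"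
        by (auto intro!: derivative_eq_intros)
      from diff_chain_at[OF this D] have "((\<lambda>r. f (x0 + ((r * s) *\<^sub>R u + q *\<^sub>R w))) has_derivative
        (\<lambda>h. f' (x0 + ((r * s) *\<^sub>R u + q *\<^sub>R w)) ((h * s) *\<^sub>R u))) (at r)" by (simp add: o_def)
      moreover have "f' (x0 + ((r * s) *\<^sub>R u + q *\<^sub>R w)) ((h * s) *\<^sub>R u) = (s * f' (x0 + ((r * s) *\<^sub>R u + q *\<^sub>R w)) u) * h" for h
        using linear_scale[OF has_derivative_linear[OF D]] by simp
      ultimately show ?thesis unfolding has_field_derivative_def by simp
    qed
    have "(\<phi> has_real_derivative \<phi>' r) (at r)" if "0 \<le> r" "r \<le> 1" for r
      unfolding \<phi>_def[abs_def] \<phi>'_def using that s by (intro DERIV_diff g) auto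
    then obtain r where r: "0 < r" "r < 1" "\<phi> 1 - \<phi> 0 = (1 - 0) * \<phi>' r"
      using MVT2[of 0 1 \<phi> \<phi>'] by auto
    have est: "\<bar>f' (x0 + ((r * s) *\<^sub>R u + q *\<^sub>R w)) u - f' x0 u - A ((r * s) *\<^sub>R u + q *\<^sub>R w)\<bar> \<le> e / 2 * s"
      if q: "0 \<le> q" "q \<le> s" for q
    proof -
      have "norm (f' (x0 + ((r * s) *\<^sub>R u + q *\<^sub>R w)) u - f' x0 u - A ((r * s) *\<^sub>R u + q *\<^sub>R w))
          \<le> (e / (2 * C)) * norm ((r * s) *\<^sub>R u + q *\<^sub>R w)"
        using d2(2)[of "x0 + ((r * s) *\<^sub>R u + q *\<^sub>R w)"] nb[OF _ _ q, of r] r sC by simp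
      also have "\<dots> \<le> (e / (2 * C)) * (s * C)" using nb[OF _ _ q, of r] r \<open>e > 0\<close> C by (intro mult_left_mono) auto
      finally show ?thesis using C by simp
    qed
    have "A ((r * s) *\<^sub>R u + s *\<^sub>R w) - A ((r * s) *\<^sub>R u + 0 *\<^sub>R w) = s * A w" by (simp add: A.add A.scaleR)
    then have "\<bar>f' (x0 + ((r * s) *\<^sub>R u + s *\<^sub>R w)) u - f' (x0 + ((r * s) *\<^sub>R u + 0 *\<^sub>R w)) u - s * A w\<bar> \<le> e * s"
      using est[of s] est[of 0] s by linarith
    then have "s * \<bar>f' (x0 + ((r * s) *\<^sub>R u + s *\<^sub>R w)) u - f' (x0 + ((r * s) *\<^sub>R u + 0 *\<^sub>R w)) u - s * A w\<bar> \<le> s * (e * s)"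
      using s by (intro mult_left_mono) auto
    moreover have "s * \<bar>y1 - y2 - s * z\<bar> = \<bar>s * y1 - s * y2 - s\<^sup>2 * z\<bar>" for y1 y2 z
    proof -
      have "s * y1 - s * y2 - s\<^sup>2 * z = s * (y1 - y2 - s * z)" by (simp add: power2_eq_square algebra_simps)
      then show ?thesis using s by (simp add: abs_mult)
    qed
    ultimately have "\<bar>\<phi>' r - s\<^sup>2 * A w\<bar> \<le> e * s\<^sup>2"
      unfolding \<phi>'_def by (simp only: power2_eq_square ac_simps)
    then show ?thesis using r(3) by (simp add: \<phi>_def algebra_simps)
  qed
  ultimately show ?thesis by blast
qed

text \<open>The second difference is symmetric in \<open>u\<close> and \<open>w\<close>, so its two
  expansions share one value. With \<open>e\<close> a third of the supposed gap, the two errors add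
  up to \<open>2 * e\<close>, less than the gap.\<close>

lemma mixed_partials_symmetric:
  fixes f :: "'a::real_normed_vector \<Rightarrow> real"
  assumes der: "\<forall>\<^sub>F x in nhds x0. (f has_derivative f' x) (at x)"
    and A: "((\<lambda>x. f' x u) has_derivative A) (at x0)" and B: "((\<lambda>x. f' x w) has_derivative B) (at x0)"
  shows "A w = B u"
proof (rule ccontr)
  assume "A w \<noteq> B u"
  define e where "e = \<bar>A w - B u\<bar> / 3"
  have "e > 0" using \<open>A w \<noteq> B u\<close> by (simp add: e_def)
  obtain d1 where d1: "d1 > 0" "\<And>s. 0 < s \<and> s < d1 \<Longrightarrow>
    \<bar>f (x0 + s *\<^sub>R u + s *\<^sub>R w) - f (x0 + s *\<^sub>R u) - f (x0 + s *\<^sub>R w) + f x0 - s\<^sup>2 * A w\<bar> \<le> e * s\<^sup>2"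
    using second_difference_expansion[OF der A \<open>e > 0\<close>, of w] by blast
  obtain d2 where d2: "d2 > 0" "\<And>s. 0 < s \<and> s < d2 \<Longrightarrow>
    \<bar>f (x0 + s *\<^sub>R w + s *\<^sub>R u) - f (x0 + s *\<^sub>R w) - f (x0 + s *\<^sub>R u) + f x0 - s\<^sup>2 * B u\<bar> \<le> e * s\<^sup>2"
    using second_difference_expansion[OF der B \<open>e > 0\<close>, of u] by blast
  define s where "s = min d1 d2 / 2"
  have s: "0 < s" "s < d1" "s < d2" using d1(1) d2(1) by (auto simp: s_def)
  have comm: "x0 + s *\<^sub>R w + s *\<^sub>R u = x0 + s *\<^sub>R u + s *\<^sub>R w" by simp
  have "\<bar>s\<^sup>2 * A w - s\<^sup>2 * B u\<bar> \<le> 2 * (e * s\<^sup>2)"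
    using d1(2)[of s] d2(2)[of s] s unfolding comm by linarith
  moreover have "\<bar>s\<^sup>2 * A w - s\<^sup>2 * B u\<bar> = s\<^sup>2 * \<bar>A w - B u\<bar>"
    unfolding right_diff_distrib[symmetric] abs_mult by simp
  ultimately have "s\<^sup>2 * \<bar>A w - B u\<bar> \<le> s\<^sup>2 * (2 * e)" by (simp only: ac_simps)
  then have "\<bar>A w - B u\<bar> \<le> 2 * e" using s by simp
  then show False using \<open>e > 0\<close> by (simp add: e_def)
qed

section \<open>Differentiation under the integral sign\<close>

text \<open>What has to be shown is measurability in \<open>z\<close>: \<open>g' z v\<close> is the
  pointwise limit of measurable difference quotients along a sequence of steps \<open>t n\<close>.
  The bound by \<open>h\<close> does the rest.\<close>

lemma integrable_derivative_dominated:
  fixes g :: "'z \<Rightarrow> 'a::euclidean_space \<Rightarrow> 'b::euclidean_space" and F :: "'z measure"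
  assumes U: "open U" "a \<in> U"
    and int: "\<And>x. x \<in> U \<Longrightarrow> integrable F (\<lambda>z. g z x)"
    and der: "\<And>z. (g z has_derivative g' z) (at a)"
    and bd: "\<And>z v. norm (g' z v) \<le> h z * norm v"
    and h: "integrable F h"
  shows "integrable F (\<lambda>z. g' z v)"
proof -
  obtain d where d: "d > 0" "ball a d \<subseteq> U" using U openE by blast
  define c where "c = d / (norm v + 1)"
  have nv: "norm v + 1 > 0" by (simp add: add_nonneg_pos)
  have c: "c > 0" "c * norm v < d"
    using d nv by (auto simp: c_def divide_less_eq)
  define t where "t n = c * (1 / real (Suc n))" for n
  have t0: "t n > 0" for n using c by (simp add: t_def)
  have tb: "t n * norm v < d" for n
  proof -
    have "t n \<le> c" using c by (simp add: t_def divide_le_eq mult_le_cancel_left1)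
    then have "t n * norm v \<le> c * norm v" by (rule mult_right_mono) simp
    then show ?thesis using c by simp
  qed
  have inU: "a + t n *\<^sub>R v \<in> U" for n
  proof -
    have "a + t n *\<^sub>R v \<in> ball a d" using tb[of n] t0[of n] by (simp add: dist_norm)
    then show ?thesis using d by blast
  qed
  have tlim: "t \<longlonglongrightarrow> 0"
    unfolding t_def by (rule tendsto_mult_right_zero[OF lim_1_over_n[THEN LIMSEQ_Suc]])
  have lim: "(\<lambda>n. (1 / t n) *\<^sub>R (g z (a + t n *\<^sub>R v) - g z a)) \<longlonglongrightarrow> g' z v" for z
  proof (cases "v = 0")
    case True
    then show ?thesis using linear_0[OF has_derivative_linear[OF der]] by simp
  next
    case False
    interpret g': bounded_linear "g' z" using der by (rule has_derivative_bounded_linear)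
    have "((\<lambda>h. norm (g z (a + h) - g z a - g' z h) / norm h) \<longlongrightarrow> 0) (at 0)"
      using der[of z] unfolding has_derivative_at by blast
    moreover have "filterlim (\<lambda>n. t n *\<^sub>R v) (at 0) sequentially"
      using tendsto_scaleR[OF tlim tendsto_const[of v]] False t0
      by (auto simp: filterlim_at intro!: always_eventually) (metis less_irrefl)
    ultimately have "(\<lambda>n. norm (g z (a + t n *\<^sub>R v) - g z a - g' z (t n *\<^sub>R v)) / norm (t n *\<^sub>R v)) \<longlonglongrightarrow> 0"
      by (rule filterlim_compose)
    then have "(\<lambda>n. norm v * (norm (g z (a + t n *\<^sub>R v) - g z a - g' z (t n *\<^sub>R v)) / norm (t n *\<^sub>R v))) \<longlonglongrightarrow> 0"
      by (rule tendsto_mult_right_zero)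
    moreover have "norm v * (norm (g z (a + t n *\<^sub>R v) - g z a - g' z (t n *\<^sub>R v)) / norm (t n *\<^sub>R v))
        = norm ((1 / t n) *\<^sub>R (g z (a + t n *\<^sub>R v) - g z a) - g' z v)" for n
    proof -
      have "(1 / t n) *\<^sub>R (g z (a + t n *\<^sub>R v) - g z a) - g' z v =
          (1 / t n) *\<^sub>R (g z (a + t n *\<^sub>R v) - g z a - g' z (t n *\<^sub>R v))"
        using t0[of n] by (simp add: g'.scaleR scaleR_diff_right)
      then have "norm ((1 / t n) *\<^sub>R (g z (a + t n *\<^sub>R v) - g z a) - g' z v)
        = norm (g z (a + t n *\<^sub>R v) - g z a - g' z (t n *\<^sub>R v)) / t n"
        using t0[of n] by (simp del: scaleR_diff_right)
      then show ?thesis using t0[of n] False by simp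
    qed
    ultimately show ?thesis by (simp add: tendsto_norm_zero_iff LIM_zero_iff)
  qed
  have "(\<lambda>z. (1 / t n) *\<^sub>R (g z (a + t n *\<^sub>R v) - g z a)) \<in> borel_measurable F" for n
    using int[OF inU[of n]] int[OF U(2)] by measurable
  then have m: "(\<lambda>z. g' z v) \<in> borel_measurable F"
    using lim by (rule borel_measurable_LIMSEQ_metric)
  show ?thesis
  proof (rule Bochner_Integration.integrable_bound[OF _ m])
    show "integrable F (\<lambda>z. h z * norm v)" using h by simp
    show "AE z in F. norm (g' z v) \<le> norm (h z * norm v)" using bd by (auto intro!: AE_I2 order_trans[OF bd])
  qed
qed

text \<open>\<open>r\<close> is the supremum of the remainder ratio over a small ball. It is at most
  \<open>2 * h\<close> by the mean value inequality and tends to 0 pointwise as the ball shrinks, so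
  dominated convergence makes its integral small. For measurability the supremum runs over a
  countable dense set; continuity of \<open>g z\<close> carries the bound to all points.\<close>

lemma dominated_remainder:
  fixes g :: "'z \<Rightarrow> 'a::euclidean_space \<Rightarrow> 'b::euclidean_space" and F :: "'z measure"
  assumes U: "open U" "a \<in> U"
    and int: "\<And>x. x \<in> U \<Longrightarrow> integrable F (\<lambda>z. g z x)"
    and der: "\<And>x z. x \<in> U \<Longrightarrow> (g z has_derivative g' z x) (at x)"
    and bd: "\<And>x z v. x \<in> U \<Longrightarrow> norm (g' z x v) \<le> h z * norm v"
    and h: "integrable F h" and "\<epsilon> > 0"
  obtains \<delta> r where "\<delta> > 0" "cball a \<delta> \<subseteq> U" "r \<in> borel_measurable F"
    "\<And>z. 0 \<le> r z" "\<And>z. r z \<le> 2 * h z" "(\<integral>z. r z \<partial>F) \<le> \<epsilon>"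
    "\<And>z x. x \<in> cball a \<delta> \<Longrightarrow> norm (g z x - g z a - g' z a (x - a)) \<le> r z * norm (x - a)"
proof -
  obtain d where d: "d > 0" "ball a d \<subseteq> U" using U openE by blast
  have h0: "0 \<le> h z" for z
  proof -
    obtain v :: 'a where "v \<in> Basis" using nonempty_Basis by blast
    then show ?thesis using order_trans[OF norm_ge_zero bd[OF U(2), of z v]] by simp
  qed
  obtain S :: "'a set" where S: "countable S" "\<And>X. open X \<Longrightarrow> X \<noteq> {} \<Longrightarrow> \<exists>s\<in>S. s \<in> X"
    using countable_dense_exists[where 'a='a] by blast
  \<comment> \<open>At \<open>x = a\<close> this is 0 by the convention on division by zero; putting
    \<open>a\<close> into \<open>I k\<close> therefore makes the index set nonempty and the supremum
    nonnegative.\<close>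
  define \<rho> where "\<rho> z x = norm (g z x - g z a - g' z a (x - a)) / norm (x - a)" for z x
  define I where "I k = insert a (S \<inter> ball a (d / real (k + 1)))" for k
  define r where "r k z = (SUP x\<in>I k. \<rho> z x)" for k z
  have dk: "d / real (k + 1) \<le> d" for k using d by (simp add: divide_le_eq mult_le_cancel_left1)
  have Isub: "I k \<subseteq> ball a d" for k using d dk[of k] by (auto simp: I_def)
  have \<rho>b: "\<rho> z x \<le> 2 * h z" if x: "x \<in> ball a d" for z x
  proof (cases "x = a")
    case True then show ?thesis using h0 by (simp add: \<rho>_def)
  next
    case False
    have "norm (g z x - g z a) \<le> h z * norm (x - a)"
    proof (rule differentiable_bound[where S="ball a d"])
      show "(g z has_derivative g' z y) (at y within ball a d)" if "y \<in> ball a d" for y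
        using der d(2) that has_derivative_at_withinI by blast
      show "onorm (g' z y) \<le> h z" if "y \<in> ball a d" for y
        using bd[of y z] d(2) that h0 by (intro onorm_bound) auto
    qed (use x d in auto)
    moreover have "norm (g' z a (x - a)) \<le> h z * norm (x - a)" using bd U by blast
    ultimately have "norm (g z x - g z a - g' z a (x - a)) \<le> 2 * h z * norm (x - a)"
      using norm_triangle_ineq4[of "g z x - g z a" "g' z a (x - a)"] by linarith
    then show ?thesis using False by (simp add: \<rho>_def divide_le_eq)
  qed
  have bdd: "bdd_above (\<rho> z ` I k)" for z k using \<rho>b Isub by (intro bdd_aboveI2[of _ _ "2 * h z"]) blast
  have rle: "r k z \<le> 2 * h z" for k z unfolding r_def
  proof (rule cSUP_least)
    show "I k \<noteq> {}" by (simp add: I_def)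
    show "\<rho> z x \<le> 2 * h z" if "x \<in> I k" for x using \<rho>b that Isub[of k] by blast
  qed
  have r0: "0 \<le> r k z" for k z
    unfolding r_def by (rule cSUP_upper2[OF bdd, of a]) (auto simp: I_def \<rho>_def)
  have "integrable F (\<lambda>z. g' z a v)" for v
    using integrable_derivative_dominated[OF U int der[OF U(2)] bd[OF U(2)] h] .
  then have \<rho>m: "(\<lambda>z. \<rho> z x) \<in> borel_measurable F" if "x \<in> ball a d" for x
    unfolding \<rho>_def using int[of x] int[OF U(2)] that d(2)
    by (intro borel_measurable_divide borel_measurable_norm borel_measurable_diff) auto
  have rm: "r k \<in> borel_measurable F" for k
    unfolding r_def[abs_def]
  proof (rule borel_measurable_cSUP)
    show "countable (I k)" using S(1) by (simp add: I_def)
    show "(\<lambda>z. \<rho> z x) \<in> borel_measurable F" if "x \<in> I k" for x using \<rho>m that Isub[of k] by blast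
    show "bdd_above ((\<lambda>x. \<rho> z x) ` I k)" for z by (rule bdd)
  qed
  have rlim: "(\<lambda>k. r k z) \<longlonglongrightarrow> 0" for z
  proof (rule LIMSEQ_I)
    fix e :: real assume "e > 0"
    obtain d' where d': "d' > 0" "\<And>x. norm (x - a) < d' \<Longrightarrow> norm (g z x - g z a - g' z a (x - a)) \<le> (e / 2) * norm (x - a)"
      using der[OF U(2), of z] \<open>e > 0\<close> unfolding has_derivative_at_alt by (meson half_gt_zero)
    obtain N where N: "d / real (N + 1) < d'"
    proof -
      obtain N where "d < real N * d'" using d' reals_Archimedean3 by blast
      also have "\<dots> \<le> d' * real (N + 1)" using d' by (simp add: algebra_simps)
      finally have "d / real (N + 1) < d'" by (simp add: divide_less_eq)
      then show thesis by (rule that)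
    qed
    have "norm (r k z - 0) < e" if "k \<ge> N" for k
    proof -
      have "d / real (k + 1) \<le> d / real (N + 1)" using that d by (intro divide_left_mono) auto
      then have lt: "d / real (k + 1) < d'" using N by linarith
      have "\<rho> z x \<le> e / 2" if "x \<in> I k" for x
      proof (cases "x = a")
        case False
        then have "norm (x - a) < d'" using that lt by (simp add: I_def dist_norm norm_minus_commute)
        then show ?thesis using d'(2)[of x] False unfolding \<rho>_def by (simp add: divide_le_eq)
      qed (use \<open>e > 0\<close> in \<open>simp add: \<rho>_def\<close>)
      then have "r k z \<le> e / 2" unfolding r_def by (intro cSUP_least) (auto simp: I_def)
      then show ?thesis using r0[of k z] \<open>e > 0\<close> by simp
    qed
    then show "\<exists>no. \<forall>n\<ge>no. norm (r n z - 0) < e" by blast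
  qed
  have "(\<lambda>k. \<integral>z. r k z \<partial>F) \<longlonglongrightarrow> (\<integral>z. 0 \<partial>F)"
    by (rule integral_dominated_convergence[where w="\<lambda>z. 2 * h z"])
      (use rm h rlim r0 rle in auto)
  then have "eventually (\<lambda>k. (\<integral>z. r k z \<partial>F) < \<epsilon>) sequentially" using \<open>\<epsilon> > 0\<close> by (simp add: order_tendstoD)
  then obtain k where k: "(\<integral>z. r k z \<partial>F) < \<epsilon>" by (meson eventually_sequentially order_refl)
  define R where "R = d / real (k + 1)"
  have R: "R > 0" "R \<le> d" using d dk[of k] by (auto simp: R_def)
  \<comment> \<open>Halving puts the closed ball inside the open ball over which the supremum was
    taken; the density argument needs an open neighbourhood of each point.\<close>
  define \<delta> where "\<delta> = R / 2"
  have \<delta>: "\<delta> > 0" "cball a \<delta> \<subseteq> ball a R" using R by (auto simp: \<delta>_def)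
  have "norm (g z x - g z a - g' z a (x - a)) \<le> r k z * norm (x - a)" if x: "x \<in> cball a \<delta>" for z x
  proof (rule ccontr)
    \<comment> \<open>A violation at \<open>x\<close> persists on a neighbourhood by continuity,
      hence occurs at a point of the dense set, where the supremum excludes it.\<close>
    assume neg: "\<not> ?thesis"
    define f where "f y = norm (g z y - g z a - g' z a (y - a)) - r k z * norm (y - a)" for y
    have xb: "x \<in> ball a R" using x \<delta> by blast
    then have "x \<in> U" using d R by auto
    have gc: "isCont (g z) x" using der[OF \<open>x \<in> U\<close>] by (rule has_derivative_continuous)
    have "isCont (\<lambda>y. g' z a (y - a)) x"
      by (rule bounded_linear.isCont[OF has_derivative_bounded_linear[OF der[OF U(2)]]]) (intro continuous_intros)
    then have "isCont f x" unfolding f_def using gc by (intro continuous_intros)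
    moreover have "f x > 0" using neg by (simp add: f_def)
    ultimately have "eventually (\<lambda>y. f y > 0) (nhds x)"
      by (simp add: isCont_def tendsto_at_iff_tendsto_nhds order_tendstoD)
    then obtain V where V: "open V" "x \<in> V" "\<And>y. y \<in> V \<Longrightarrow> f y > 0" unfolding eventually_nhds by blast
    have "open (V \<inter> ball a R)" "V \<inter> ball a R \<noteq> {}" using V xb by auto
    from S(2)[OF this] obtain y where y: "y \<in> S" "y \<in> V" "y \<in> ball a R" by blast
    have "\<rho> z y \<le> r k z" unfolding r_def by (rule cSUP_upper[OF _ bdd]) (use y in \<open>auto simp: I_def R_def\<close>)
    moreover have "y \<noteq> a" using V(3)[OF y(2)] linear_0[OF has_derivative_linear[OF der[OF U(2)]], of z] by (auto simp: f_def)
    ultimately have "f y \<le> 0" by (simp add: \<rho>_def f_def divide_le_eq)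
    then show False using V(3)[OF y(2)] by simp
  qed
  moreover have "cball a \<delta> \<subseteq> U" using \<delta>(2) d(2) R subset_ball[OF R(2), of a] by blast
  ultimately show thesis using that[OF \<delta>(1) _ rm[of k] r0 rle] k by (simp add: less_imp_le)
qed

text \<open>Integrate the pointwise estimate of \<open>dominated_remainder\<close>, taken with
  \<epsilon> equal to the required accuracy; the candidate derivative is bounded because it is
  linear on a finite-dimensional space.\<close>

lemma has_derivative_integral_dominated:
  fixes g :: "'z \<Rightarrow> 'a::euclidean_space \<Rightarrow> 'b::euclidean_space" and F :: "'z measure"
  assumes U: "open U" "a \<in> U"
    and int: "\<And>x. x \<in> U \<Longrightarrow> integrable F (\<lambda>z. g z x)"
    and der: "\<And>x z. x \<in> U \<Longrightarrow> (g z has_derivative g' z x) (at x)"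
    and bd: "\<And>x z v. x \<in> U \<Longrightarrow> norm (g' z x v) \<le> h z * norm v"
    and h: "integrable F h"
  shows "((\<lambda>x. \<integral>z. g z x \<partial>F) has_derivative (\<lambda>v. \<integral>z. g' z a v \<partial>F)) (at a)"
proof -
  have i': "integrable F (\<lambda>z. g' z a v)" for v
    using integrable_derivative_dominated[OF U int der[OF U(2)] bd[OF U(2)] h] .
  have lin: "linear (g' z a)" for z using der[OF U(2)] by (rule has_derivative_linear)
  have "linear (\<lambda>v. \<integral>z. g' z a v \<partial>F)"
    using i' by (intro linearI) (simp_all add: linear_add[OF lin] linear_scale[OF lin])
  then have bl: "bounded_linear (\<lambda>v. \<integral>z. g' z a v \<partial>F)" by (simp add: linear_conv_bounded_linear)
  have "\<exists>d>0. \<forall>x. norm (x - a) < d \<longrightarrow>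
      norm ((\<integral>z. g z x \<partial>F) - (\<integral>z. g z a \<partial>F) - (\<integral>z. g' z a (x - a) \<partial>F)) \<le> e * norm (x - a)" if "e > 0" for e
  proof -
    obtain \<delta> r where r: "\<delta> > 0" "cball a \<delta> \<subseteq> U" "r \<in> borel_measurable F"
      "\<And>z. 0 \<le> r z" "\<And>z. r z \<le> 2 * h z" "(\<integral>z. r z \<partial>F) \<le> e"
      "\<And>z x. x \<in> cball a \<delta> \<Longrightarrow> norm (g z x - g z a - g' z a (x - a)) \<le> r z * norm (x - a)"
      using dominated_remainder[OF U int der bd h \<open>e > 0\<close>] by metis
    have ri: "integrable F r"
      by (rule Bochner_Integration.integrable_bound[of _ "\<lambda>z. 2 * h z"])
        (use r h in \<open>auto intro!: AE_I2 order_trans[OF _ abs_ge_self]\<close>)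
    have "norm ((\<integral>z. g z x \<partial>F) - (\<integral>z. g z a \<partial>F) - (\<integral>z. g' z a (x - a) \<partial>F)) \<le> e * norm (x - a)"
      if "norm (x - a) < \<delta>" for x
    proof -
      have x: "x \<in> cball a \<delta>" using that by (simp add: dist_norm norm_minus_commute)
      have ix: "integrable F (\<lambda>z. g z x)" using int x r(2) by blast
      have ia: "integrable F (\<lambda>z. g z a)" using int U by blast
      have "norm ((\<integral>z. g z x \<partial>F) - (\<integral>z. g z a \<partial>F) - (\<integral>z. g' z a (x - a) \<partial>F))
        = norm (\<integral>z. g z x - g z a - g' z a (x - a) \<partial>F)" using ix ia i' by simp
      also have "\<dots> \<le> (\<integral>z. r z * norm (x - a) \<partial>F)"
        by (rule order_trans[OF integral_norm_bound integral_mono])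
          (use ix ia i' ri r(7)[OF x] in auto)
      also have "\<dots> = (\<integral>z. r z \<partial>F) * norm (x - a)" by simp
      also have "\<dots> \<le> e * norm (x - a)" using r(6) by (intro mult_right_mono) auto
      finally show ?thesis .
    qed
    then show ?thesis using r(1) by blast
  qed
  then show ?thesis unfolding has_derivative_at_alt using bl by blast
qed

section \<open>Events of high probability and laws of large numbers\<close>

text \<open>The events \<open>{\<omega>. A n \<omega>}\<close> need not be measurable: a measurable subset of large probability
  is enough, which avoids measurable selections of roots.\<close>

definition likely :: "'w measure \<Rightarrow> real \<Rightarrow> (nat \<Rightarrow> 'w \<Rightarrow> bool) \<Rightarrow> bool" where
  "likely M \<epsilon> A \<longleftrightarrow>
     (\<forall>\<^sub>F n in sequentially. \<exists>G\<in>sets M. measure M G > 1 - \<epsilon> \<and> (\<forall>\<omega>\<in>G. A n \<omega>))"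

lemma likely_mono:
  assumes "likely M \<epsilon> A" "\<forall>\<^sub>F n in sequentially. \<forall>\<omega>\<in>space M. A n \<omega> \<longrightarrow> B n \<omega>" "\<epsilon> \<le> \<epsilon>'"
  shows "likely M \<epsilon>' B"
  using assms(1,2) unfolding likely_def
proof eventually_elim
  case (elim n)
  then obtain G where G: "G \<in> sets M" "measure M G > 1 - \<epsilon>" "\<forall>\<omega>\<in>G. A n \<omega>" by blast
  then have "\<forall>\<omega>\<in>G. B n \<omega>" using elim(2) sets.sets_into_space[OF G(1)] by blast
  then show ?case using G assms(3) by (intro bexI[of _ G]) auto
qed

context prob_space
begin

lemma likely_conj:
  assumes "likely M \<epsilon> A" "likely M \<epsilon>' B"
  shows "likely M (\<epsilon> + \<epsilon>') (\<lambda>n \<omega>. A n \<omega> \<and> B n \<omega>)"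
  using assms unfolding likely_def
proof eventually_elim
  case (elim n)
  then obtain G G' where G: "G \<in> events" "prob G > 1 - \<epsilon>" "\<forall>\<omega>\<in>G. A n \<omega>"
    and G': "G' \<in> events" "prob G' > 1 - \<epsilon>'" "\<forall>\<omega>\<in>G'. B n \<omega>" by blast
  have "prob (G \<inter> G') = prob G + prob G' - prob (G \<union> G')"
    using G(1) G'(1) by (simp add: finite_measure_Union' finite_measure_Diff' Int_commute)
  moreover have "prob (G \<union> G') \<le> 1" by (rule prob_le_1)
  ultimately have "prob (G \<inter> G') > 1 - (\<epsilon> + \<epsilon>')" using G(2) G'(2) by linarith
  then show ?case using G G' by (intro bexI[of _ "G \<inter> G'"]) auto
qed

text \<open>Removing a measurable null set that covers the failures costs no probability, so almost
  sure properties can be added without spending any of \<epsilon>.\<close>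

lemma likely_AE:
  assumes "likely M \<epsilon> A" "\<forall>\<^sub>F n in sequentially. AE \<omega> in M. B n \<omega>"
  shows "likely M \<epsilon> (\<lambda>n \<omega>. A n \<omega> \<and> B n \<omega>)"
  using assms unfolding likely_def
proof eventually_elim
  case (elim n)
  then obtain G where G: "G \<in> events" "prob G > 1 - \<epsilon>" "\<forall>\<omega>\<in>G. A n \<omega>" by blast
  obtain N where N: "{\<omega> \<in> space M. \<not> B n \<omega>} \<subseteq> N" "emeasure M N = 0" "N \<in> events"
    using elim(2) by (rule AE_E)
  have "prob (G - N) = prob G" using N G by (simp add: measure_Diff_null_set null_setsI)
  then show ?case using G N sets.sets_into_space[OF G(1)] by (intro bexI[of _ "G - N"]) auto
qed

text \<open>For measurable \<open>X n\<close> the favourable event is itself measurable and contains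
  every \<open>G\<close> witnessing \<open>likely\<close>, so inner approximation and convergence of
  probabilities agree. This translates the hypothesis on \<open>R\<close> into \<open>likely\<close>
  and the conclusions back.\<close>

lemma small_op_iff_likely:
  fixes X :: "nat \<Rightarrow> 'a \<Rightarrow> 'b::euclidean_space"
  assumes [measurable]: "\<And>n. X n \<in> borel_measurable M"
  shows "small_op M X a \<longleftrightarrow> (\<forall>e>0. \<forall>\<epsilon>>0. likely M \<epsilon> (\<lambda>n \<omega>. norm (X n \<omega>) \<le> e * a n))"
proof -
  have compl: "prob {\<omega> \<in> space M. norm (X n \<omega>) > e * a n} = 1 - prob {\<omega> \<in> space M. norm (X n \<omega>) \<le> e * a n}" for e n
    by (subst prob_compl[symmetric]) (auto intro!: arg_cong[of _ _ prob])
  have "(\<lambda>n. prob {\<omega> \<in> space M. norm (X n \<omega>) > e * a n}) \<longlonglongrightarrow> 0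
      \<longleftrightarrow> (\<forall>\<epsilon>>0. likely M \<epsilon> (\<lambda>n \<omega>. norm (X n \<omega>) \<le> e * a n))" (is "?L \<longleftrightarrow> ?R") for e
  proof
    assume ?L
    show ?R
    proof safe
      fix \<epsilon> :: real assume "\<epsilon> > 0"
      then have "\<forall>\<^sub>F n in sequentially. prob {\<omega> \<in> space M. norm (X n \<omega>) > e * a n} < \<epsilon>"
        using \<open>?L\<close> by (simp add: order_tendstoD)
      then show "likely M \<epsilon> (\<lambda>n \<omega>. norm (X n \<omega>) \<le> e * a n)"
        unfolding likely_def
      proof eventually_elim
        case (elim n)
        then show ?case unfolding compl
          by (intro bexI[of _ "{\<omega> \<in> space M. norm (X n \<omega>) \<le> e * a n}"]) auto
      qed
    qed
  next
    assume R: ?R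
    show ?L
    proof (rule tendstoI)
      fix \<epsilon> :: real assume "\<epsilon> > 0"
      with R have "likely M \<epsilon> (\<lambda>n \<omega>. norm (X n \<omega>) \<le> e * a n)" by blast
      then show "\<forall>\<^sub>F n in sequentially. dist (prob {\<omega> \<in> space M. norm (X n \<omega>) > e * a n}) 0 < \<epsilon>"
        unfolding likely_def
      proof eventually_elim
        case (elim n)
        then obtain G where G: "G \<in> events" "prob G > 1 - \<epsilon>" "\<forall>\<omega>\<in>G. norm (X n \<omega>) \<le> e * a n" by blast
        have "prob G \<le> prob {\<omega> \<in> space M. norm (X n \<omega>) \<le> e * a n}"
          using G sets.sets_into_space[OF G(1)] by (intro finite_measure_mono) auto
        then show ?case using G(2) unfolding compl by (simp add: dist_real_def)
      qed
    qed
  qed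
  then show ?thesis unfolding small_op_def using assms by simp
qed

end

section \<open>Moments of sample means; the sample is indexed from 1\<close>

locale iid_sample = prob_space M for M :: "'w measure" +
  fixes Z :: "nat \<Rightarrow> 'w \<Rightarrow> 'z::topological_space" and F :: "'z measure"
  assumes Z_indep: "indep_vars (\<lambda>_. borel) Z {1..}"
    and Z_distr: "\<And>i. i \<ge> 1 \<Longrightarrow> distr M borel (Z i) = F"
begin

lemma Z_measurable: "i \<ge> 1 \<Longrightarrow> Z i \<in> borel_measurable M"
  using Z_indep by (simp add: indep_vars_def)

lemma sets_F [measurable_cong]: "sets F = sets borel"
  using Z_distr[of 1] by auto

lemma prob_space_F: "prob_space F"
  using Z_distr[of 1] prob_space_distr[OF Z_measurable[of 1]] by simp

lemma borel_measurable_Z: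
  "g \<in> borel_measurable F \<Longrightarrow> i \<ge> 1 \<Longrightarrow> (\<lambda>\<omega>. g (Z i \<omega>)) \<in> borel_measurable M"
  using measurable_compose[OF Z_measurable, of i g borel] sets_F by (simp cong: measurable_cong_sets)

lemma sample_mean_measurable:
  fixes g :: "'z \<Rightarrow> 'b::euclidean_space"
  assumes "g \<in> borel_measurable F"
  shows "(\<lambda>\<omega>. sample_mean Z n \<omega> g) \<in> borel_measurable M"
  unfolding sample_mean_def
  by (intro borel_measurable_scaleR borel_measurable_const borel_measurable_sum borel_measurable_Z assms) auto

lemma
  fixes g :: "'z \<Rightarrow> 'b::euclidean_space"
  assumes "g \<in> borel_measurable F" "i \<ge> 1"
  shows integrable_Z_iff: "integrable M (\<lambda>\<omega>. g (Z i \<omega>)) \<longleftrightarrow> integrable F g"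
    and integral_Z: "(\<integral>\<omega>. g (Z i \<omega>) \<partial>M) = (\<integral>z. g z \<partial>F)"
proof -
  have g: "g \<in> borel_measurable borel" using assms(1) sets_F by (simp cong: measurable_cong_sets)
  show "integrable M (\<lambda>\<omega>. g (Z i \<omega>)) \<longleftrightarrow> integrable F g"
    using integrable_distr_eq[OF Z_measurable g, of i] Z_distr[of i] assms(2) by simp
  show "(\<integral>\<omega>. g (Z i \<omega>) \<partial>M) = (\<integral>z. g z \<partial>F)"
    using integral_distr[OF Z_measurable g, of i] Z_distr[of i] assms(2) by simp
qed

lemma indep_vars_Z:
  assumes "g \<in> borel_measurable F"
  shows "indep_vars (\<lambda>_. borel) (\<lambda>i \<omega>. g (Z i \<omega>)) {1..}"
  using assms sets_F by (intro indep_vars_compose2[OF Z_indep]) (simp cong: measurable_cong_sets)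

text \<open>Induction on the index set: by independence the cross term factors into expectations,
  one of which is the zero mean.\<close>

lemma
  fixes g :: "'z \<Rightarrow> real"
  assumes g: "g \<in> borel_measurable F" and sq: "integrable F (\<lambda>z. (g z)\<^sup>2)" and mean: "(\<integral>z. g z \<partial>F) = 0"
    and "finite I" "I \<subseteq> {1..}"
  shows integrable_sum_square: "integrable M (\<lambda>\<omega>. (\<Sum>i\<in>I. g (Z i \<omega>))\<^sup>2)"
    and integral_sum_square: "(\<integral>\<omega>. (\<Sum>i\<in>I. g (Z i \<omega>))\<^sup>2 \<partial>M) = real (card I) * (\<integral>z. (g z)\<^sup>2 \<partial>F)"
proof -
  interpret F: prob_space F by (rule prob_space_F)
  have gi: "integrable F g" using F.square_integrable_imp_integrable[OF g] sq by simp
  have "integrable M (\<lambda>\<omega>. (\<Sum>i\<in>I. g (Z i \<omega>))\<^sup>2) \<and>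
    (\<integral>\<omega>. (\<Sum>i\<in>I. g (Z i \<omega>))\<^sup>2 \<partial>M) = real (card I) * (\<integral>z. (g z)\<^sup>2 \<partial>F)"
    using \<open>finite I\<close> \<open>I \<subseteq> {1..}\<close>
  proof (induction I)
    case empty then show ?case by simp
  next
    case (insert i I)
    then have i: "i \<ge> 1" and I: "\<And>j. j \<in> I \<Longrightarrow> j \<ge> 1" by auto
    let ?S = "\<lambda>\<omega>. \<Sum>i\<in>I. g (Z i \<omega>)"
    have ind: "indep_var borel (\<lambda>\<omega>. g (Z i \<omega>)) borel ?S"
      using insert by (intro indep_vars_sum indep_vars_subset[OF indep_vars_Z[OF g]]) auto
    have iX: "integrable M (\<lambda>\<omega>. g (Z i \<omega>))" if "i \<ge> 1" for i using integrable_Z_iff[OF g that] gi by simp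
    have iS: "integrable M ?S" using iX I by auto
    have iSX: "integrable M (\<lambda>\<omega>. g (Z i \<omega>) * ?S \<omega>)"
      by (rule indep_var_integrable[OF ind iX[OF i] iS])
    have "(\<integral>\<omega>. g (Z i \<omega>) * ?S \<omega> \<partial>M) = (\<integral>\<omega>. g (Z i \<omega>) \<partial>M) * (\<integral>\<omega>. ?S \<omega> \<partial>M)"
      by (rule indep_var_lebesgue_integral[OF ind iX[OF i] iS])
    then have eSX: "(\<integral>\<omega>. g (Z i \<omega>) * ?S \<omega> \<partial>M) = 0" using integral_Z[OF g i] mean by simp
    have g2: "(\<lambda>z. (g z)\<^sup>2) \<in> borel_measurable F" using g by simp
    have iX2: "integrable M (\<lambda>\<omega>. (g (Z i \<omega>))\<^sup>2)" using integrable_Z_iff[OF g2 i] sq by simp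
    have sqe: "(\<Sum>i\<in>insert i I. g (Z i \<omega>))\<^sup>2 = (g (Z i \<omega>))\<^sup>2 + (2 * (g (Z i \<omega>) * ?S \<omega>) + (?S \<omega>)\<^sup>2)" for \<omega>
      using insert by (simp add: power2_sum)
    have IH: "integrable M (\<lambda>\<omega>. (?S \<omega>)\<^sup>2)" "(\<integral>\<omega>. (?S \<omega>)\<^sup>2 \<partial>M) = real (card I) * (\<integral>z. (g z)\<^sup>2 \<partial>F)"
      using insert by auto
    show ?case unfolding sqe
      using iX2 iSX IH eSX integral_Z[OF g2 i] insert(1,2) by (simp add: algebra_simps)
  qed
  then show "integrable M (\<lambda>\<omega>. (\<Sum>i\<in>I. g (Z i \<omega>))\<^sup>2)"
    "(\<integral>\<omega>. (\<Sum>i\<in>I. g (Z i \<omega>))\<^sup>2 \<partial>M) = real (card I) * (\<integral>z. (g z)\<^sup>2 \<partial>F)" by auto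
qed

lemma sample_mean_Chebyshev:
  fixes g :: "'z \<Rightarrow> 'b::euclidean_space"
  assumes g: "g \<in> borel_measurable F" and sq: "integrable F (\<lambda>z. (norm (g z))\<^sup>2)"
  obtains v where "v \<ge> 0" "\<And>n K. n \<ge> 1 \<Longrightarrow> K > 0 \<Longrightarrow>
    prob {\<omega>\<in>space M. norm (sample_mean Z n \<omega> g - (\<integral>z. g z \<partial>F)) \<ge> K} \<le> v / (real n * K\<^sup>2)"
proof -
  interpret F: prob_space F by (rule prob_space_F)
  define m where "m = (\<integral>z. g z \<partial>F)"
  have gi: "integrable F g"
  proof -
    have "integrable F (\<lambda>z. norm (g z))" using F.square_integrable_imp_integrable[of "\<lambda>z. norm (g z)"] g sq by simp
    then show ?thesis using g by (simp add: integrable_norm_iff)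
  qed
  define f where "f b z = (g z - m) \<bullet> b" for b z
  have fm: "f b \<in> borel_measurable F" for b unfolding f_def using g by measurable
  have fmean: "(\<integral>z. f b z \<partial>F) = 0" for b
    using gi F.prob_space by (simp add: f_def m_def)
  have fsq: "integrable F (\<lambda>z. (f b z)\<^sup>2)" if "b \<in> Basis" for b
  proof (rule Bochner_Integration.integrable_bound[where f="\<lambda>z. 2 * (norm (g z))\<^sup>2 + 2 * (norm m)\<^sup>2"])
    show "integrable F (\<lambda>z. 2 * (norm (g z))\<^sup>2 + 2 * (norm m)\<^sup>2)" using sq by simp
    show "(\<lambda>z. (f b z)\<^sup>2) \<in> borel_measurable F" using fm[of b] by simp
    have "(f b z)\<^sup>2 \<le> 2 * (norm (g z))\<^sup>2 + 2 * (norm m)\<^sup>2" for z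
    proof -
      have "\<bar>f b z\<bar> \<le> norm (g z - m)" using Basis_le_norm[OF that] by (simp add: f_def)
      also have "\<dots> \<le> norm (g z) + norm m" by (rule norm_triangle_ineq4)
      finally have "(f b z)\<^sup>2 \<le> (norm (g z) + norm m)\<^sup>2"
        by (metis abs_ge_zero power2_abs power_mono)
      also have "\<dots> \<le> 2 * (norm (g z))\<^sup>2 + 2 * (norm m)\<^sup>2"
        using sum_squares_ge_zero[of "norm (g z) - norm m" 0] by (simp add: power2_eq_square algebra_simps)
      finally show ?thesis .
    qed
    then show "AE z in F. norm ((f b z)\<^sup>2) \<le> norm (2 * (norm (g z))\<^sup>2 + 2 * (norm m)\<^sup>2)" by simp
  qed
  \<comment> \<open>The trace of the covariance matrix of \<open>g\<close>. The squared norm is a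
    sum of squared coordinates, so the scalar identity for sums gives the expectation
    \<open>v / real n\<close>, to which Markov's inequality applies.\<close>
  define v where "v = (\<Sum>b\<in>Basis. \<integral>z. (f b z)\<^sup>2 \<partial>F)"
  have "v \<ge> 0" unfolding v_def by (intro sum_nonneg integral_nonneg) auto
  moreover have "prob {\<omega>\<in>space M. norm (sample_mean Z n \<omega> g - m) \<ge> K} \<le> v / (real n * K\<^sup>2)"
    if n: "n \<ge> 1" and K: "K > 0" for n K
  proof -
    define Y where "Y \<omega> = sample_mean Z n \<omega> g - m" for \<omega>
    have Ym[measurable]: "Y \<in> borel_measurable M"
      unfolding Y_def using sample_mean_measurable[OF g] by measurable
    have Yb: "Y \<omega> \<bullet> b = (1 / real n) * (\<Sum>i\<in>{1..n}. f b (Z i \<omega>))" for \<omega> b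
      using n by (simp add: Y_def sample_mean_def f_def inner_diff_left inner_sum_left sum_subtractf algebra_simps)
    have Yn: "(norm (Y \<omega>))\<^sup>2 = (\<Sum>b\<in>Basis. (1 / real n)\<^sup>2 * (\<Sum>i\<in>{1..n}. f b (Z i \<omega>))\<^sup>2)" for \<omega>
      unfolding norm_eq_sqrt_inner
      by (subst euclidean_inner) (simp add: Yb power_divide sum_nonneg flip: power2_eq_square)
    have sub: "{1..n} \<subseteq> {1..}" by auto
    have ib: "integrable M (\<lambda>\<omega>. (1 / real n)\<^sup>2 * (\<Sum>i\<in>{1..n}. f b (Z i \<omega>))\<^sup>2)" if "b \<in> Basis" for b
      using integrable_sum_square[OF fm fsq[OF that] fmean _ sub] by (intro integrable_mult_right) simp
    have eb: "(\<integral>\<omega>. (1 / real n)\<^sup>2 * (\<Sum>i\<in>{1..n}. f b (Z i \<omega>))\<^sup>2 \<partial>M) = (1 / real n)\<^sup>2 * (real n * (\<integral>z. (f b z)\<^sup>2 \<partial>F))"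
      if "b \<in> Basis" for b
      using integral_sum_square[OF fm fsq[OF that] fmean _ sub] by simp
    have "integrable M (\<lambda>\<omega>. (norm (Y \<omega>))\<^sup>2)" unfolding Yn using ib by (rule Bochner_Integration.integrable_sum)
    moreover have "(\<integral>\<omega>. (norm (Y \<omega>))\<^sup>2 \<partial>M) = (\<Sum>b\<in>Basis. (1 / real n)\<^sup>2 * (real n * (\<integral>z. (f b z)\<^sup>2 \<partial>F)))"
      unfolding Yn using ib eb by (simp only: Bochner_Integration.integral_sum cong: sum.cong)
    moreover have "(\<Sum>b\<in>Basis. (1 / real n)\<^sup>2 * (real n * (\<integral>z. (f b z)\<^sup>2 \<partial>F))) = v / real n"
      using n by (simp add: v_def sum_divide_distrib power2_eq_square)
    moreover have "prob {\<omega>\<in>space M. norm (Y \<omega>) \<ge> K} = prob {\<omega>\<in>space M. (norm (Y \<omega>))\<^sup>2 \<ge> K\<^sup>2}"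
      using K by (intro arg_cong[of _ _ prob]) (auto simp: abs_le_square_iff[symmetric])
    moreover have "prob {\<omega>\<in>space M. (norm (Y \<omega>))\<^sup>2 \<ge> K\<^sup>2} \<le> (\<integral>\<omega>. (norm (Y \<omega>))\<^sup>2 \<partial>M) / K\<^sup>2"
      using calculation K by (intro integral_Markov_inequality_measure[where A="{}"]) auto
    ultimately show ?thesis by (simp add: Y_def)
  qed
  ultimately show thesis using that unfolding m_def by blast
qed

lemma sample_mean_root_n_bounded:
  fixes g :: "'z \<Rightarrow> 'b::euclidean_space"
  assumes "g \<in> borel_measurable F" "integrable F (\<lambda>z. (norm (g z))\<^sup>2)" "\<epsilon> > 0"
  obtains K where "K > 0"
    "likely M \<epsilon> (\<lambda>n \<omega>. norm (sample_mean Z n \<omega> g - (\<integral>z. g z \<partial>F)) \<le> K / sqrt (real n))"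
proof -
  obtain v where v: "v \<ge> 0" "\<And>n K. n \<ge> 1 \<Longrightarrow> K > 0 \<Longrightarrow>
    prob {\<omega>\<in>space M. norm (sample_mean Z n \<omega> g - (\<integral>z. g z \<partial>F)) \<ge> K} \<le> v / (real n * K\<^sup>2)"
    using sample_mean_Chebyshev[OF assms(1,2)] by blast
  \<comment> \<open>Then \<open>v / K\<^sup>2 = \<epsilon> * v / (v + 1) < \<epsilon>\<close>; the
    summand 1 makes this strict and keeps \<open>K\<close> positive when
    \<open>v = 0\<close>.\<close>
  define K where "K = sqrt ((v + 1) / \<epsilon>)"
  have K: "K > 0" "v / K\<^sup>2 < \<epsilon>" using v(1) \<open>\<epsilon> > 0\<close> by (auto simp: K_def divide_simps)
  have [measurable]: "(\<lambda>\<omega>. sample_mean Z n \<omega> g) \<in> borel_measurable M" for n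
    by (rule sample_mean_measurable[OF assms(1)])
  have "likely M \<epsilon> (\<lambda>n \<omega>. norm (sample_mean Z n \<omega> g - (\<integral>z. g z \<partial>F)) \<le> K / sqrt (real n))"
    unfolding likely_def using eventually_ge_at_top[of 1]
  proof eventually_elim
    case (elim n)
    let ?B = "{\<omega>\<in>space M. norm (sample_mean Z n \<omega> g - (\<integral>z. g z \<partial>F)) \<ge> K / sqrt (real n)}"
    have "prob ?B \<le> v / (real n * (K / sqrt (real n))\<^sup>2)" using v(2)[OF elim, of "K / sqrt (real n)"] K elim by simp
    also have "\<dots> = v / K\<^sup>2" using elim by (simp add: power_divide)
    finally have "prob ?B < \<epsilon>" using K by simp
    moreover have "prob (space M - ?B) = 1 - prob ?B" by (rule prob_compl) measurable
    ultimately show ?case by (intro bexI[of _ "space M - ?B"]) auto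
  qed
  then show thesis using that K by blast
qed

lemma sample_mean_likely_near:
  fixes g :: "'z \<Rightarrow> 'b::euclidean_space"
  assumes "g \<in> borel_measurable F" "integrable F (\<lambda>z. (norm (g z))\<^sup>2)" "\<epsilon> > 0" "e > 0"
  shows "likely M \<epsilon> (\<lambda>n \<omega>. norm (sample_mean Z n \<omega> g - (\<integral>z. g z \<partial>F)) \<le> e)"
proof -
  obtain K where K: "K > 0"
    "likely M \<epsilon> (\<lambda>n \<omega>. norm (sample_mean Z n \<omega> g - (\<integral>z. g z \<partial>F)) \<le> K / sqrt (real n))"
    using sample_mean_root_n_bounded[OF assms(1-3)] by blast
  have "(\<lambda>n. K / sqrt (real n)) \<longlonglongrightarrow> 0"
    by (intro real_tendsto_divide_at_top[OF tendsto_const] filterlim_compose[OF sqrt_at_top filterlim_real_sequentially])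
  then have "\<forall>\<^sub>F n in sequentially. K / sqrt (real n) < e" using \<open>e > 0\<close> by (simp add: order_tendstoD)
  then show ?thesis by (intro likely_mono[OF K(2)]) (auto elim!: eventually_mono)
qed

end

section \<open>Multivariate normal laws\<close>

lemma normal_law_zero_eq_distr:
  assumes "v > 0"
  shows "normal_law 0 v = distr std_normal_distribution borel (\<lambda>x. sqrt v * x)"
proof -
  interpret real_distribution std_normal_distribution by (rule real_dist_normal_dist)
  have "distributed std_normal_distribution lborel (\<lambda>x. x) std_normal_density"
    unfolding distributed_def by (auto simp: distr_id2 cong: distr_cong)
  from normal_density_affine[OF this, of "sqrt v" 0] assms
  have "distributed std_normal_distribution lborel (\<lambda>x. sqrt v * x) (normal_density 0 (sqrt v))" by simp
  then show ?thesis using assms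
    by (simp add: normal_law_def distributed_distr_eq_density[symmetric] cong: distr_cong)
qed

lemma
  assumes "v \<ge> 0"
  shows real_distribution_normal_law: "real_distribution (normal_law 0 v)"
    and char_normal_law: "char (normal_law 0 v) t = exp (- complex_of_real (v * t\<^sup>2 / 2))"
proof -
  interpret std: real_distribution std_normal_distribution by (rule real_dist_normal_dist)
  have "real_distribution (normal_law 0 v) \<and> char (normal_law 0 v) t = exp (- complex_of_real (v * t\<^sup>2 / 2))"
  proof (cases "v = 0")
    case True
    then have "normal_law 0 v = return borel 0" by (simp add: normal_law_def)
    then show ?thesis using True prob_space_return[of 0 borel]
      by (simp add: real_distribution_def real_distribution_axioms_def char_def integral_return)
  next
    case False
    then have v: "v > 0" using assms by simp
    have "char (normal_law 0 v) t = char std_normal_distribution (t * sqrt v)"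
      unfolding normal_law_zero_eq_distr[OF v] char_def by (subst integral_distr) (auto simp: ac_simps)
    also have "\<dots> = exp (- complex_of_real (v * t\<^sup>2 / 2))"
      using v by (simp add: char_std_normal_distribution power_mult_distrib ac_simps flip: exp_of_real of_real_power)
    finally show ?thesis
      unfolding normal_law_zero_eq_distr[OF v]
      using std.real_distribution_distr[of "\<lambda>x. sqrt v * x"] by simp
  qed
  then show "real_distribution (normal_law 0 v)"
    and "char (normal_law 0 v) t = exp (- complex_of_real (v * t\<^sup>2 / 2))" by auto
qed

text \<open>Adding an independent standard normal multiple of \<open>w\<close> multiplies the
  characteristic functions of all linear functionals. This is the step by which a normal law of
  given covariance is built up.\<close>

lemma char_distr_inner_pair:
  fixes N' :: "'a::euclidean_space measure"
  assumes N': "prob_space N'" "sets N' = sets borel"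
  shows "char (distr (distr (N' \<Otimes>\<^sub>M std_normal_distribution) borel (\<lambda>(x, g). x + g *\<^sub>R w)) borel (\<lambda>x. u \<bullet> x)) t
    = char (distr N' borel (\<lambda>x. u \<bullet> x)) t * char std_normal_distribution (t * (u \<bullet> w))"
proof -
  interpret std: real_distribution std_normal_distribution by (rule real_dist_normal_dist)
  interpret N': prob_space N' by fact
  interpret P: pair_prob_space N' std_normal_distribution ..
  note [measurable_cong] = N'(2)
  have m: "(\<lambda>(x, g). x + g *\<^sub>R w) \<in> borel_measurable (N' \<Otimes>\<^sub>M std_normal_distribution)" by measurable
  have "char (distr (distr (N' \<Otimes>\<^sub>M std_normal_distribution) borel (\<lambda>(x, g). x + g *\<^sub>R w)) borel (\<lambda>x. u \<bullet> x)) t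
    = (\<integral>p. iexp (t * (u \<bullet> (fst p + snd p *\<^sub>R w))) \<partial>(N' \<Otimes>\<^sub>M std_normal_distribution))"
    unfolding char_def
    by (subst integral_distr, simp, simp, subst integral_distr[OF m], simp, simp add: case_prod_unfold)
  also have "\<dots> = (\<integral>p. (case p of (x, g) \<Rightarrow> iexp (t * (u \<bullet> x)) * iexp ((t * (u \<bullet> w)) * g)) \<partial>(N' \<Otimes>\<^sub>M std_normal_distribution))"
    by (intro Bochner_Integration.integral_cong)
      (auto simp: inner_add_right exp_add[symmetric] algebra_simps)
  also have "\<dots> = (\<integral>x. \<integral>g. iexp (t * (u \<bullet> x)) * iexp ((t * (u \<bullet> w)) * g) \<partial>std_normal_distribution \<partial>N')"
  proof (rule P.integral_fst[symmetric])
    show "integrable (N' \<Otimes>\<^sub>M std_normal_distribution) (\<lambda>(x, g). iexp (t * (u \<bullet> x)) * iexp ((t * (u \<bullet> w)) * g))"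
      by (intro P.P.integrable_const_bound[of _ 1]) (auto simp: norm_mult)
  qed
  also have "\<dots> = (\<integral>x. iexp (t * (u \<bullet> x)) \<partial>N') * char std_normal_distribution (t * (u \<bullet> w))"
    by (simp add: char_def)
  also have "(\<integral>x. iexp (t * (u \<bullet> x)) \<partial>N') = char (distr N' borel (\<lambda>x. u \<bullet> x)) t"
    unfolding char_def by (subst integral_distr) simp_all
  finally show ?thesis .
qed

lemma axis_inner_matrix: "axis i 1 \<bullet> (S *v axis j 1) = (S $ i $ j :: real)"
  by (simp add: inner_axis' matrix_vector_mult_basis column_def)

text \<open>A Cholesky step as induction: subtract from \<open>S\<close> the rank-one matrix of a
  vector \<open>w\<close> that annihilates a nonzero diagonal entry, take a normal vector for the
  remaining matrix, and add an independent standard normal multiple of \<open>w\<close>. The number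
  of nonzero diagonal entries decreases.\<close>

lemma multivariate_normal_exists:
  fixes S :: "real ^ 'n ^ 'n"
  assumes "transpose S = S" "\<And>u. 0 \<le> u \<bullet> (S *v u)"
  shows "\<exists>N. is_multivariate_normal N 0 S"
  using assms
proof (induction "card {i. S $ i $ i \<noteq> 0}" arbitrary: S rule: less_induct)
  case less
  have sym: "x \<bullet> (S *v y) = y \<bullet> (S *v x)" for x y
    using less.prems(1) by (metis dot_lmul_matrix inner_commute vector_transpose_matrix)
  show ?case
  proof (cases "\<forall>i. S $ i $ i = 0")
    case True
    \<comment> \<open>With zero diagonal the form takes the values \<open>2 * S $ i $ j\<close> and
      \<open>- 2 * S $ i $ j\<close> at the sum and the difference of two unit vectors; both are
      nonnegative.\<close>
    have "S $ i $ j = 0" for i j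
    proof -
      have q: "(axis i 1 + c *\<^sub>R axis j 1) \<bullet> (S *v (axis i 1 + c *\<^sub>R axis j 1)) = 2 * c * S $ i $ j" for c
        using True sym[of "axis j 1" "axis i 1"]
        by (simp add: matrix_vector_right_distrib inner_add_left inner_add_right matrix_vector_mult_scaleR axis_inner_matrix)
      show ?thesis using less.prems(2)[of "axis i 1 + 1 *\<^sub>R axis j 1"] less.prems(2)[of "axis i 1 + (-1) *\<^sub>R axis j 1"]
        unfolding q by simp
    qed
    then have S0: "S = 0" by (simp add: vec_eq_iff)
    have "distr (return borel 0) borel (\<lambda>x. u \<bullet> x) = return borel 0" for u :: "real ^ 'n"
      by (subst distr_return) auto
    then have "is_multivariate_normal (return borel 0) 0 S"
      unfolding is_multivariate_normal_def S0 by (simp add: prob_space_return normal_law_def transpose_def vec_eq_iff)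
    then show ?thesis by blast
  next
    case False
    then obtain i where i: "S $ i $ i \<noteq> 0" by blast
    define e where "e = (axis i 1 :: real ^ 'n)"
    define s where "s = S $ i $ i"
    have ee: "e \<bullet> (S *v e) = s" by (simp add: e_def s_def axis_inner_matrix)
    have s: "s > 0" using less.prems(2)[of e] i unfolding ee by (simp add: s_def)
    \<comment> \<open>The i-th column of \<open>S\<close>, scaled so that its i-th entry is
      \<open>sqrt s\<close>; \<open>S'\<close> is then the Schur complement of the entry
      \<open>s\<close>, with zero i-th row and column.\<close>
    define w where "w = (1 / sqrt s) *\<^sub>R (S *v e)"
    define S' where "S' = S - (\<chi> k l. w $ k * w $ l)"
    have S'v: "S' *v x = S *v x - (w \<bullet> x) *\<^sub>R w" for x
      by (simp add: S'_def matrix_vector_mult_diff_rdistrib vec_eq_iff matrix_vector_mult_def inner_vec_def sum_distrib_left sum_subtractf algebra_simps)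
    have S'q: "x \<bullet> (S' *v x) = x \<bullet> (S *v x) - (x \<bullet> w)\<^sup>2" for x
      by (simp add: S'v inner_diff_right power2_eq_square inner_commute)
    have tr: "transpose S' = S'" using less.prems(1) by (simp add: S'_def transpose_def vec_eq_iff)
    have pos: "0 \<le> x \<bullet> (S' *v x)" for x
    proof -
      \<comment> \<open>The minimiser of the form of \<open>S\<close> along the line
        \<open>x - c *\<^sub>R e\<close>; the minimum value is the form of \<open>S'\<close> at
        \<open>x\<close>.\<close>
      define c where "c = (x \<bullet> (S *v e)) / s"
      have "0 \<le> (x - c *\<^sub>R e) \<bullet> (S *v (x - c *\<^sub>R e))" by (rule less.prems(2))
      also have "\<dots> = x \<bullet> (S *v x) - 2 * c * (x \<bullet> (S *v e)) + c\<^sup>2 * s"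
        using sym[of e x] ee
        by (simp add: matrix_vector_mult_diff_distrib inner_diff_left inner_diff_right matrix_vector_mult_scaleR power2_eq_square algebra_simps)
      also have "\<dots> = x \<bullet> (S' *v x)"
        using s by (simp add: S'q w_def c_def power2_eq_square field_simps)
      finally show ?thesis .
    qed
    have d: "S' $ k $ k = S $ k $ k - (w $ k)\<^sup>2" for k by (simp add: S'_def power2_eq_square)
    have wi: "w $ i = sqrt s"
      using s by (simp add: w_def e_def matrix_vector_mult_basis column_def s_def real_div_sqrt)
    have "S' $ i $ i = 0" using s by (simp add: d wi s_def)
    \<comment> \<open>Zero diagonal entries stay zero: \<open>S' $ k $ k\<close> is now minus a
      square, and it is nonnegative.\<close>
    moreover have "S' $ k $ k = 0" if "S $ k $ k = 0" for k
      using pos[of "axis k 1"] that by (simp add: axis_inner_matrix d)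
    ultimately have "{k. S' $ k $ k \<noteq> 0} \<subset> {k. S $ k $ k \<noteq> 0}" using i by blast
    then have "card {k. S' $ k $ k \<noteq> 0} < card {k. S $ k $ k \<noteq> 0}" by (intro psubset_card_mono) auto
    from less.hyps[OF this tr pos] obtain N' where N': "is_multivariate_normal N' 0 S'" by blast
    have N'p: "prob_space N'" "sets N' = sets borel" and
      N'd: "\<And>u. distr N' borel (\<lambda>x. u \<bullet> x) = normal_law 0 (u \<bullet> (S' *v u))"
      using N' by (auto simp: is_multivariate_normal_def)
    interpret std: real_distribution std_normal_distribution by (rule real_dist_normal_dist)
    interpret N': prob_space N' by (rule N'p)
    interpret P: pair_prob_space N' std_normal_distribution ..
    note [measurable_cong] = N'p(2)
    define N where "N = distr (N' \<Otimes>\<^sub>M std_normal_distribution) borel (\<lambda>(x, g). x + g *\<^sub>R w)"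
    have Np: "prob_space N" unfolding N_def by (rule P.P.prob_space_distr) measurable
    have sN: "sets N = sets borel" by (simp add: N_def)
    have "distr N borel (\<lambda>x. u \<bullet> x) = normal_law 0 (u \<bullet> (S *v u))" for u
    proof (rule Levy_uniqueness)
      show "real_distribution (normal_law 0 (u \<bullet> (S *v u)))" by (rule real_distribution_normal_law[OF less.prems(2)])
      have um: "(\<lambda>x. u \<bullet> x) \<in> borel_measurable N" using sN by (simp cong: measurable_cong_sets)
      show "real_distribution (distr N borel (\<lambda>x. u \<bullet> x))"
        using prob_space.prob_space_distr[OF Np um] by (simp add: real_distribution_def real_distribution_axioms_def)
      show "char (distr N borel (\<lambda>x. u \<bullet> x)) = char (normal_law 0 (u \<bullet> (S *v u)))"
      proof
        fix t
        have "char (distr N borel (\<lambda>x. u \<bullet> x)) t = exp (- complex_of_real ((u \<bullet> (S' *v u)) * t\<^sup>2 / 2)) * exp (- complex_of_real (1 * (t * (u \<bullet> w))\<^sup>2 / 2))"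
          unfolding N_def char_distr_inner_pair[OF N'p] N'd char_normal_law[OF pos]
          by (simp add: char_std_normal_distribution exp_of_real[symmetric])
        also have "\<dots> = exp (- complex_of_real ((u \<bullet> (S *v u)) * t\<^sup>2 / 2))"
          unfolding exp_add[symmetric] S'q by (rule arg_cong[of _ _ exp]) (simp add: field_simps power_mult_distrib)
        also have "\<dots> = char (normal_law 0 (u \<bullet> (S *v u))) t" by (simp only: char_normal_law[OF less.prems(2)])
        finally show "char (distr N borel (\<lambda>x. u \<bullet> x)) t = char (normal_law 0 (u \<bullet> (S *v u))) t" .
      qed
    qed
    then have "is_multivariate_normal N 0 S"
      using Np sN less.prems by (simp add: is_multivariate_normal_def)
    then show ?thesis by blast
  qed
qed

section \<open>The multivariate central limit theorem\<close>

text \<open>Applied with \<open>Suc\<close>, this shifts a sample indexed from 1 to the sequences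
  indexed from 0 for which the central limit theorem is stated.\<close>

lemma (in prob_space) indep_vars_reindex_inj:
  assumes "inj_on f J" "indep_vars M' X (f ` J)"
  shows "indep_vars (M' \<circ> f) (X \<circ> f) J"
  unfolding indep_vars_def2
proof
  show "\<forall>i\<in>J. random_variable ((M' \<circ> f) i) ((X \<circ> f) i)" using assms(2) by (auto simp: indep_vars_def2)
  have I: "indep_sets (\<lambda>i. {X i -` A \<inter> space M |A. A \<in> sets (M' i)}) (f ` J)"
    using assms(2) by (simp add: indep_vars_def2)
  show "indep_sets (\<lambda>i. {(X \<circ> f) i -` A \<inter> space M |A. A \<in> sets ((M' \<circ> f) i)}) J"
  proof (rule indep_setsI)
    show "{(X \<circ> f) i -` A \<inter> space M |A. A \<in> sets ((M' \<circ> f) i)} \<subseteq> events" if "i \<in> J" for i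
      using I that by (auto simp: indep_sets_def)
  next
    fix A K assume K: "K \<noteq> {}" "K \<subseteq> J" "finite K"
      and A: "\<forall>j\<in>K. A j \<in> {(X \<circ> f) j -` A \<inter> space M |A. A \<in> sets ((M' \<circ> f) j)}"
    have inj: "inj_on f K" using assms(1) K(2) by (rule inj_on_subset)
    define B where "B j = A (the_inv_into K f j)" for j
    have B: "B (f j) = A j" if "j \<in> K" for j using inj that by (simp add: B_def the_inv_into_f_f)
    have "prob (\<Inter>j\<in>f ` K. B j) = (\<Prod>j\<in>f ` K. prob (B j))"
      using K A B by (intro indep_setsD[OF I]) auto
    moreover have "(\<Inter>j\<in>f ` K. B j) = (\<Inter>j\<in>K. A j)" using B by auto
    ultimately show "prob (\<Inter>j\<in>K. A j) = (\<Prod>j\<in>K. prob (A j))"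
      using B by (simp add: prod.reindex[OF inj])
  qed
qed

lemma (in iid_sample) char_sample_mean_limit:
  fixes g :: "'z \<Rightarrow> real"
  assumes g: "g \<in> borel_measurable F" and sq: "integrable F (\<lambda>z. (g z)\<^sup>2)" and mean: "(\<integral>z. g z \<partial>F) = 0"
  shows "(\<lambda>n. \<integral>\<omega>. iexp (sqrt (real n) * sample_mean Z n \<omega> g) \<partial>M)
    \<longlonglongrightarrow> exp (- complex_of_real ((\<integral>z. (g z)\<^sup>2 \<partial>F) / 2))"
proof -
  define v where "v = (\<integral>z. (g z)\<^sup>2 \<partial>F)"
  have v0: "v \<ge> 0" by (simp add: v_def)
  have "inj Suc" by simp
  have rg: "range Suc = {1..}" by (auto simp: image_iff) (metis Suc_le_D)
  define X where "X i \<omega> = g (Z (Suc i) \<omega>)" for i \<omega>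
  have Xm: "X i \<in> borel_measurable M" for i unfolding X_def[abs_def] by (rule borel_measurable_Z[OF g]) simp
  have "indep_vars ((\<lambda>_. borel) \<circ> Suc) ((\<lambda>i \<omega>. g (Z i \<omega>)) \<circ> Suc) UNIV"
    using indep_vars_Z[OF g] by (intro indep_vars_reindex_inj) (simp_all add: rg)
  then have Xi: "indep_vars (\<lambda>_. borel) X UNIV" by (simp add: o_def X_def[abs_def])
  have S: "(\<Sum>i<n. X i \<omega>) = (\<Sum>i=1..n. g (Z i \<omega>))" for n \<omega>
    unfolding X_def by (rule sum.reindex_bij_witness[of _ "\<lambda>i. i - 1" Suc]) auto
  have sm: "sqrt (real n) * sample_mean Z n \<omega> g = (\<Sum>i<n. X i \<omega>) / sqrt (real n)" for n \<omega>
    unfolding S sample_mean_def by (cases "n = 0") (simp_all add: real_sqrt_divide field_simps flip: real_sqrt_mult)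
  have Xe: "expectation (X i) = 0" for i
    unfolding X_def using integral_Z[OF g, of "Suc i"] mean by simp
  have g2: "(\<lambda>z. (g z)\<^sup>2) \<in> borel_measurable F" using g by simp
  have Xsq: "integrable M (\<lambda>\<omega>. (X i \<omega>)\<^sup>2)" "expectation (\<lambda>\<omega>. (X i \<omega>)\<^sup>2) = v" for i
    unfolding X_def v_def using integrable_Z_iff[OF g2, of "Suc i"] integral_Z[OF g2, of "Suc i"] sq by auto
  show ?thesis
  proof (cases "v = 0")
    \<comment> \<open>The central limit theorem requires positive variance. With zero variance all
      summands vanish almost surely, and both sides are 1.\<close>
    case True
    have "AE \<omega> in M. (X i \<omega>)\<^sup>2 = 0" for i
      using integral_nonneg_eq_0_iff_AE[OF Xsq(1)] Xsq(2) True by simp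
    then have "AE \<omega> in M. \<forall>i. X i \<omega> = 0" by (simp add: AE_all_countable)
    then have "(\<integral>\<omega>. iexp (sqrt (real n) * sample_mean Z n \<omega> g) \<partial>M) = (\<integral>\<omega>. 1 \<partial>M)" for n
      unfolding sm using Xm by (intro integral_cong_AE) auto
    then show ?thesis using True by (simp add: v_def[symmetric] prob_space)
  next
    case False
    then have v: "v > 0" using v0 by simp
    \<comment> \<open>Standardised sums. Evaluating their characteristic functions at
      \<open>sqrt v\<close> instead of 1 undoes the division by the standard deviation.\<close>
    define Y where "Y n \<omega> = (\<Sum>i<n. X i \<omega>) / sqrt (real n * (sqrt v)\<^sup>2)" for n \<omega>
    have Ym[measurable]: "Y n \<in> borel_measurable M" for n unfolding Y_def[abs_def] using Xm by measurable
    have Xd: "distr M borel (X i) = distr F borel g" for i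
    proof -
      have "g \<in> borel_measurable borel" using g sets_F by (simp cong: measurable_cong_sets)
      then have "distr F borel g = distr M borel (g \<circ> Z (Suc i))"
        using distr_distr[of g borel borel "Z (Suc i)" M] Z_measurable[of "Suc i"] Z_distr[of "Suc i"] by simp
      then show ?thesis by (simp add: X_def[abs_def] o_def)
    qed
    have "weak_conv_m (\<lambda>n. distr M borel (\<lambda>x. (\<Sum>i<n. X i x) / sqrt (real n * (sqrt v)\<^sup>2))) std_normal_distribution"
      using v Xe Xsq by (intro central_limit_theorem_zero_mean[OF Xi]) (auto simp: Xd)
    then have "weak_conv_m (\<lambda>n. distr M borel (Y n)) std_normal_distribution" by (simp only: Y_def[abs_def])
    then have "(\<lambda>n. char (distr M borel (Y n)) (sqrt v)) \<longlonglongrightarrow> char std_normal_distribution (sqrt v)"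
      by (intro levy_continuity1 real_dist_normal_dist) (simp_all add: real_distribution_distr)
    moreover have "char (distr M borel (Y n)) (sqrt v) = (\<integral>\<omega>. iexp (sqrt (real n) * sample_mean Z n \<omega> g) \<partial>M)" for n
      unfolding char_def sm using v by (subst integral_distr) (simp_all add: Y_def real_sqrt_mult)
    ultimately show ?thesis
      using v by (simp add: char_std_normal_distribution v_def[symmetric] flip: exp_of_real of_real_power)
  qed
qed

text \<open>Trigonometric polynomials, generated by linear operations alone: induction over these
  rules transfers convergence of characteristic functions to expectations. That they form an algebra
  is left to the product-to-sum formulas.\<close>

inductive_set trig_functions :: "('a::real_inner \<Rightarrow> real) set" where
  cos: "(\<lambda>x. cos (a \<bullet> x)) \<in> trig_functions"
| sin: "(\<lambda>x. sin (a \<bullet> x)) \<in> trig_functions"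
| add: "f \<in> trig_functions \<Longrightarrow> g \<in> trig_functions \<Longrightarrow> (\<lambda>x. f x + g x) \<in> trig_functions"
| scale: "f \<in> trig_functions \<Longrightarrow> (\<lambda>x. c * f x) \<in> trig_functions"

lemma trig_const: "(\<lambda>x. c) \<in> trig_functions"
  using trig_functions.scale[OF trig_functions.cos[of 0], of c] by simp

lemma trig_sum: "finite I \<Longrightarrow> (\<And>i. i \<in> I \<Longrightarrow> f i \<in> trig_functions) \<Longrightarrow> (\<lambda>x. \<Sum>i\<in>I. f i x) \<in> trig_functions"
  by (induction I rule: finite_induct) (simp_all add: trig_const trig_functions.add)

lemma trig_mult:
  assumes "f \<in> trig_functions" "g \<in> trig_functions"
  shows "(\<lambda>x. f x * g x) \<in> trig_functions"
proof -
  have half: "(\<lambda>x. (u x + c * v x) / 2) \<in> trig_functions"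
    if "u \<in> trig_functions" "v \<in> trig_functions" for u v :: "'a \<Rightarrow> real" and c
    using trig_functions.scale[OF trig_functions.add[OF that(1) trig_functions.scale[OF that(2), of c]], of "1 / 2"] by simp
  have cc: "(\<lambda>x. cos (a \<bullet> x) * cos (b \<bullet> x)) \<in> trig_functions" for a b :: 'a
    using half[OF trig_functions.cos[of "a - b"] trig_functions.cos[of "a + b"], of 1]
    by (simp add: cos_times_cos inner_diff_left inner_add_left)
  have ss: "(\<lambda>x. sin (a \<bullet> x) * sin (b \<bullet> x)) \<in> trig_functions" for a b :: 'a
    using half[OF trig_functions.cos[of "a - b"] trig_functions.cos[of "a + b"], of "-1"]
    by (simp add: sin_times_sin inner_diff_left inner_add_left)
  have sc: "(\<lambda>x. sin (a \<bullet> x) * cos (b \<bullet> x)) \<in> trig_functions" for a b :: 'a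
    using half[OF trig_functions.sin[of "a + b"] trig_functions.sin[of "a - b"], of 1]
    by (simp add: sin_times_cos inner_diff_left inner_add_left)
  have cs: "(\<lambda>x. cos (a \<bullet> x) * sin (b \<bullet> x)) \<in> trig_functions" for a b :: 'a
    using sc[of b a] by (simp add: mult.commute)
  have 1: "(\<lambda>x. cos (a \<bullet> x) * g x) \<in> trig_functions" for a
    using assms(2)
  proof induction
    case (add f g) then show ?case using trig_functions.add[OF add(3,4)] by (simp add: distrib_left)
  next
    case (scale f c) then show ?case using trig_functions.scale[OF scale(2), of c] by (simp add: ac_simps)
  qed (simp_all add: cc cs)
  have 2: "(\<lambda>x. sin (a \<bullet> x) * g x) \<in> trig_functions" for a
    using assms(2)
  proof induction
    case (add f g) then show ?case using trig_functions.add[OF add(3,4)] by (simp add: distrib_left)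
  next
    case (scale f c) then show ?case using trig_functions.scale[OF scale(2), of c] by (simp add: ac_simps)
  qed (simp_all add: ss sc)
  show ?thesis using assms(1)
  proof induction
    case (add f h) then show ?case using trig_functions.add[OF add(3,4)] by (simp add: distrib_right)
  next
    case (scale f c) then show ?case using trig_functions.scale[OF scale(2), of c] by (simp add: ac_simps)
  qed (simp_all add: 1 2)
qed

text \<open>The argument of \<open>p\<close> always lies in the unit cube, so a polynomial that
  approximates on this compact set becomes a test function that approximates on the whole
  space.\<close>

lemma trig_polynomial_of_sines:
  fixes p :: "'a::euclidean_space \<Rightarrow> real"
  assumes "real_polynomial_function p"
  shows "(\<lambda>x. p (\<Sum>b\<in>Basis. sin ((c *\<^sub>R b) \<bullet> x) *\<^sub>R b)) \<in> trig_functions"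
  using assms
proof induction
  case (linear f)
  have "f (\<Sum>b\<in>Basis. sin ((c *\<^sub>R b) \<bullet> x) *\<^sub>R b) = (\<Sum>b\<in>Basis. f b * sin ((c *\<^sub>R b) \<bullet> x))" for x
    using linear by (simp add: linear_sum[OF bounded_linear.linear] linear_scale[OF bounded_linear.linear] mult.commute)
  then show ?case by (simp only:) (intro trig_sum trig_functions.scale trig_functions.sin, auto)
qed (simp_all add: trig_const trig_functions.add trig_mult)

lemma trig_functions_expectation_limit:
  fixes X :: "nat \<Rightarrow> 'w \<Rightarrow> 'a::euclidean_space"
  assumes M: "prob_space M" and X: "\<And>n. X n \<in> borel_measurable M"
    and N: "prob_space N" "sets N = sets borel"
    and lim: "\<And>a. (\<lambda>n. \<integral>\<omega>. iexp (a \<bullet> X n \<omega>) \<partial>M) \<longlonglongrightarrow> (\<integral>x. iexp (a \<bullet> x) \<partial>N)"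
    and "f \<in> trig_functions"
  shows "continuous_on UNIV f \<and> (\<forall>n. integrable M (\<lambda>\<omega>. f (X n \<omega>))) \<and> integrable N f \<and>
    (\<lambda>n. \<integral>\<omega>. f (X n \<omega>) \<partial>M) \<longlonglongrightarrow> (\<integral>x. f x \<partial>N)"
  using \<open>f \<in> trig_functions\<close>
proof induction
  interpret M: prob_space M by fact
  interpret N: prob_space N by fact
  note [measurable] = X note [measurable_cong] = N(2)
  have iM: "integrable M (\<lambda>\<omega>. iexp (a \<bullet> X n \<omega>))" for a n by (intro M.integrable_const_bound[of _ 1]) auto
  have iN: "integrable N (\<lambda>x. iexp (a \<bullet> x))" for a by (intro N.integrable_const_bound[of _ 1]) auto
  have Re: "Re (iexp t) = cos t" "Im (iexp t) = sin t" for t by (simp_all add: Re_exp Im_exp)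
  {
    case (cos a)
    have "(\<lambda>n. Re (\<integral>\<omega>. iexp (a \<bullet> X n \<omega>) \<partial>M)) \<longlonglongrightarrow> Re (\<integral>x. iexp (a \<bullet> x) \<partial>N)" using lim by (rule tendsto_Re)
    then have "(\<lambda>n. \<integral>\<omega>. cos (a \<bullet> X n \<omega>) \<partial>M) \<longlonglongrightarrow> (\<integral>x. cos (a \<bullet> x) \<partial>N)"
      using integral_Re[OF iM] integral_Re[OF iN] unfolding Re by simp
    moreover have "integrable M (\<lambda>\<omega>. cos (a \<bullet> X n \<omega>))" for n by (intro M.integrable_const_bound[of _ 1]) auto
    moreover have "integrable N (\<lambda>x. cos (a \<bullet> x))" by (intro N.integrable_const_bound[of _ 1]) auto
    ultimately show ?case by (auto intro!: continuous_intros)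
  next
    case (sin a)
    have "(\<lambda>n. Im (\<integral>\<omega>. iexp (a \<bullet> X n \<omega>) \<partial>M)) \<longlonglongrightarrow> Im (\<integral>x. iexp (a \<bullet> x) \<partial>N)" using lim by (rule tendsto_Im)
    then have "(\<lambda>n. \<integral>\<omega>. sin (a \<bullet> X n \<omega>) \<partial>M) \<longlonglongrightarrow> (\<integral>x. sin (a \<bullet> x) \<partial>N)"
      using integral_Im[OF iM] integral_Im[OF iN] unfolding Re by simp
    moreover have "integrable M (\<lambda>\<omega>. sin (a \<bullet> X n \<omega>))" for n by (intro M.integrable_const_bound[of _ 1]) auto
    moreover have "integrable N (\<lambda>x. sin (a \<bullet> x))" by (intro N.integrable_const_bound[of _ 1]) auto
    ultimately show ?case by (auto intro!: continuous_intros)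
  next
    case (add f g)
    then show ?case by (auto intro!: continuous_intros tendsto_add)
  next
    case (scale f c)
    then show ?case by (auto intro!: continuous_intros tendsto_mult_left)
  }
qed

text \<open>On a large ball \<open>f\<close> agrees with a continuous function of the vector of the
  \<open>sin (x \<bullet> b / L)\<close>, which the Stone-Weierstrass theorem approximates uniformly on the whole
  space by a trigonometric polynomial; this makes pointwise convergence of the characteristic
  functions together with tightness sufficient.\<close>

lemma converges_in_law_of_char:
  fixes X :: "nat \<Rightarrow> 'w \<Rightarrow> 'a::euclidean_space"
  assumes M: "prob_space M" and X: "\<And>n. X n \<in> borel_measurable M"
    and N: "prob_space N" "sets N = sets borel"
    and lim: "\<And>a. (\<lambda>n. \<integral>\<omega>. iexp (a \<bullet> X n \<omega>) \<partial>M) \<longlonglongrightarrow> (\<integral>x. iexp (a \<bullet> x) \<partial>N)"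
    and tight: "\<And>\<epsilon>. \<epsilon> > 0 \<Longrightarrow> \<exists>K. likely M \<epsilon> (\<lambda>n \<omega>. norm (X n \<omega>) \<le> K)"
  shows "converges_in_law M X N"
  unfolding converges_in_law_def
proof (intro conjI allI impI)
  interpret M: prob_space M by fact
  interpret N: prob_space N by fact
  note [measurable] = X note [measurable_cong] = N(2)
  show "X n \<in> borel_measurable M" for n by (rule X)
  fix f :: "'a \<Rightarrow> real" assume f: "continuous_on UNIV f \<and> bounded (range f)"
  then obtain B where B: "B > 0" "\<And>x. \<bar>f x\<bar> \<le> B" unfolding bounded_pos by auto
  have fc: "continuous_on UNIV f" using f by simp
  have [measurable]: "f \<in> borel_measurable borel" using fc by (rule borel_measurable_continuous_onI)
  show "(\<lambda>n. \<integral>\<omega>. f (X n \<omega>) \<partial>M) \<longlonglongrightarrow> (\<integral>x. f x \<partial>N)"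
  proof (rule tendstoI)
    fix e :: real assume "e > 0"
    \<comment> \<open>The error \<open>e\<close> is split into thirds: replacing \<open>f\<close> by
      \<open>q\<close> under the law of \<open>X n\<close>, the same under \<open>N\<close>, and the
      convergence for \<open>q\<close>. Each replacement costs \<open>e / 6\<close> for the
      approximation and \<open>2 * B * \<epsilon> = e / 6\<close> for the event outside the
      ball.\<close>
    define \<epsilon> where "\<epsilon> = e / (12 * B)"
    have \<epsilon>: "\<epsilon> > 0" "2 * B * \<epsilon> = e / 6" using \<open>e > 0\<close> B by (auto simp: \<epsilon>_def)
    obtain K1 where K1: "likely M \<epsilon> (\<lambda>n \<omega>. norm (X n \<omega>) \<le> K1)" using tight[OF \<epsilon>(1)] by blast
    have "(\<lambda>k. N.prob {x \<in> space N. norm x \<le> real k}) \<longlonglongrightarrow> N.prob (\<Union>k. {x \<in> space N. norm x \<le> real k})"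
      by (rule N.finite_Lim_measure_incseq) (auto simp: incseq_def)
    also have "(\<Union>k. {x \<in> space N. norm x \<le> real k}) = space N" by (auto intro: real_arch_simple)
    finally have "\<forall>\<^sub>F k in sequentially. N.prob {x \<in> space N. norm x \<le> real k} > 1 - \<epsilon>"
      using \<epsilon>(1) by (intro order_tendstoD) (auto simp: N.prob_space)
    then obtain k where k: "N.prob {x \<in> space N. norm x \<le> real k} > 1 - \<epsilon>"
      by (meson eventually_sequentially order_refl)
    define L where "L = max K1 (real k) + 1"
    have L: "L > 0" by (simp add: L_def)
    have inL: "norm x \<le> L" if "norm x \<le> K1 \<or> norm x \<le> real k" for x :: 'a using that by (auto simp: L_def)
    define s where "s x = (\<Sum>b\<in>Basis. sin (((1 / L) *\<^sub>R b) \<bullet> x) *\<^sub>R b)" for x :: 'a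
    \<comment> \<open>On the ball of radius \<open>L\<close> the map \<open>s\<close> is inverted
      coordinatewise by arcsine: there \<open>x \<bullet> b / L\<close> lies in the interval from -1
      to 1, inside that from \<open>- pi / 2\<close> to \<open>pi / 2\<close>. Hence
      \<open>h (s x) = f x\<close>.\<close>
    define h where "h y = f (\<Sum>b\<in>Basis. (L * arcsin (y \<bullet> b)) *\<^sub>R b)" for y
    have "continuous_on (cbox (- One) One) h"
      unfolding h_def
      by (intro continuous_on_compose2[OF fc] continuous_on_sum continuous_on_scaleR continuous_on_mult
          continuous_on_const continuous_on_arcsin continuous_on_inner continuous_on_id) (auto simp: mem_box)
    then obtain p where p: "real_polynomial_function p"
      "\<And>y. y \<in> cbox (- One) One \<Longrightarrow> \<bar>h y - p y\<bar> < e / 6"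
      using Stone_Weierstrass_real_polynomial_function[OF compact_cbox, of "- One" One h "e / 6"] \<open>e > 0\<close> by auto
    define q where "q x = p (s x)" for x
    have q: "q \<in> trig_functions" unfolding q_def s_def by (rule trig_polynomial_of_sines[OF p(1)])
    note tq = trig_functions_expectation_limit[OF M X N lim q]
    have sb: "s x \<bullet> b = sin ((1 / L) * (x \<bullet> b))" if "b \<in> Basis" for x b
      using inner_sum_left_Basis[OF that, of "\<lambda>b. sin (((1 / L) *\<^sub>R b) \<bullet> x)"] by (simp add: s_def inner_commute)
    have scb: "s x \<in> cbox (- One) One" for x by (auto simp: mem_box sb)
    have hq: "\<bar>h (s x) - q x\<bar> \<le> e / 6" for x using p(2)[OF scb] by (simp add: q_def less_imp_le)
    have hs: "h (s x) = f x" if "norm x \<le> L" for x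
    proof -
      have "arcsin (s x \<bullet> b) = (1 / L) * (x \<bullet> b)" if b: "b \<in> Basis" for b
      proof -
        have "\<bar>x \<bullet> b\<bar> \<le> L" using Basis_le_norm[OF b, of x] \<open>norm x \<le> L\<close> by simp
        then have "\<bar>(1 / L) * (x \<bullet> b)\<bar> \<le> 1" using L by (simp add: abs_mult divide_le_eq)
        then show ?thesis unfolding sb[OF b]
          by (intro arcsin_sin) (use pi_ge_two in linarith)+
      qed
      then have "(\<Sum>b\<in>Basis. (L * arcsin (s x \<bullet> b)) *\<^sub>R b) = (\<Sum>b\<in>Basis. (x \<bullet> b) *\<^sub>R b)"
        using L by (intro sum.cong) auto
      then show ?thesis by (simp add: h_def euclidean_representation)
    qed
    have hB: "\<bar>h y\<bar> \<le> B" for y unfolding h_def by (rule B)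
    have diff: "\<bar>f x - q x\<bar> \<le> e / 6 + 2 * B" for x
      using hq[of x] hB[of "s x"] B(2)[of x] by linarith
    have diff': "\<bar>f x - q x\<bar> \<le> e / 6" if "norm x \<le> L" for x
      using hq[of x] hs[OF that] by simp
    \<comment> \<open>Stated for an arbitrary probability space so that it covers both
      \<open>X n\<close> under \<open>M\<close> and the identity under \<open>N\<close>. Off
      \<open>G\<close> the bound \<open>diff\<close> holds because \<open>h\<close>, hence up to
      \<open>e / 6\<close> also \<open>q\<close>, is bounded by \<open>B\<close> everywhere.\<close>
    have gap: "\<bar>(\<integral>\<omega>. f (Y \<omega>) \<partial>P) - (\<integral>\<omega>. q (Y \<omega>) \<partial>P)\<bar> \<le> e / 3"
      if "prob_space P" and [measurable]: "Y \<in> borel_measurable P" and "integrable P (\<lambda>\<omega>. q (Y \<omega>))"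
        and G: "G \<in> sets P" "measure P G > 1 - \<epsilon>" "\<forall>\<omega>\<in>G. norm (Y \<omega>) \<le> L" for P :: "'c measure" and Y G
    proof -
      interpret P: prob_space P by fact
      have if': "integrable P (\<lambda>\<omega>. f (Y \<omega>))" using B(2) by (intro P.integrable_const_bound[of _ B]) auto
      have ind: "integrable P (\<lambda>\<omega>. 2 * B * indicator (space P - G) \<omega>)"
        using G(1) by (intro integrable_mult_right integrable_real_indicator) (auto simp: P.emeasure_eq_measure)
      have "\<bar>(\<integral>\<omega>. f (Y \<omega>) \<partial>P) - (\<integral>\<omega>. q (Y \<omega>) \<partial>P)\<bar> = \<bar>\<integral>\<omega>. f (Y \<omega>) - q (Y \<omega>) \<partial>P\<bar>"
        using if' that(3) by simp
      also have "\<dots> \<le> (\<integral>\<omega>. \<bar>f (Y \<omega>) - q (Y \<omega>)\<bar> \<partial>P)" by (rule integral_abs_bound)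
      also have "\<dots> \<le> (\<integral>\<omega>. e / 6 + 2 * B * indicator (space P - G) \<omega> \<partial>P)"
      proof (rule integral_mono)
        show "integrable P (\<lambda>\<omega>. e / 6 + 2 * B * indicator (space P - G) \<omega>)"
          by (rule Bochner_Integration.integrable_add[OF _ ind]) simp
        show "\<bar>f (Y \<omega>) - q (Y \<omega>)\<bar> \<le> e / 6 + 2 * B * indicator (space P - G) \<omega>" if "\<omega> \<in> space P" for \<omega>
          using G(3) diff[of "Y \<omega>"] diff'[of "Y \<omega>"] that by (cases "\<omega> \<in> G") auto
      qed (use if' that(3) in simp)
      also have "\<dots> = e / 6 + 2 * B * P.prob (space P - G)"
        by (subst Bochner_Integration.integral_add[OF _ ind]) (simp_all add: P.prob_space Int_absorb2)
      also have "\<dots> \<le> e / 6 + 2 * B * \<epsilon>"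
        using G B(1) by (intro add_left_mono mult_left_mono) (simp_all add: P.prob_compl)
      finally show ?thesis using \<epsilon>(2) by simp
    qed
    have gN: "\<bar>(\<integral>x. f x \<partial>N) - (\<integral>x. q x \<partial>N)\<bar> \<le> e / 3"
    proof (rule gap[of N "\<lambda>x. x", OF N(1) _ _ _ k])
      show "(\<lambda>x. x) \<in> borel_measurable N" by (rule measurable_ident_sets[OF N(2)])
      show "integrable N q" using tq by blast
      show "{x \<in> space N. norm x \<le> real k} \<in> sets N" by measurable
      show "\<forall>x\<in>{x \<in> space N. norm x \<le> real k}. norm x \<le> L" using inL by blast
    qed
    have "\<forall>\<^sub>F n in sequentially. \<bar>(\<integral>\<omega>. q (X n \<omega>) \<partial>M) - (\<integral>x. q x \<partial>N)\<bar> < e / 3"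
    proof -
      have "(\<lambda>n. \<integral>\<omega>. q (X n \<omega>) \<partial>M) \<longlonglongrightarrow> (\<integral>x. q x \<partial>N)" using tq by blast
      from tendstoD[OF this, of "e / 3"] show ?thesis using \<open>e > 0\<close> by (simp add: dist_real_def)
    qed
    moreover have "\<forall>\<^sub>F n in sequentially. \<bar>(\<integral>\<omega>. f (X n \<omega>) \<partial>M) - (\<integral>\<omega>. q (X n \<omega>) \<partial>M)\<bar> \<le> e / 3"
      using K1 unfolding likely_def
    proof eventually_elim
      case (elim n)
      then obtain G where "G \<in> sets M" "measure M G > 1 - \<epsilon>" "\<forall>\<omega>\<in>G. norm (X n \<omega>) \<le> K1" by blast
      moreover have "integrable M (\<lambda>\<omega>. q (X n \<omega>))" using tq by blast
      ultimately show ?case using inL by (intro gap[OF M X, of n G]) blast+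
    qed
    ultimately show "\<forall>\<^sub>F n in sequentially. dist (\<integral>\<omega>. f (X n \<omega>) \<partial>M) (\<integral>x. f x \<partial>N) < e"
      by eventually_elim (use gN in \<open>unfold dist_real_def, linarith\<close>)
  qed
qed


section \<open>Asymptotic normality of asymptotically linear statistics\<close>

context iid_sample
begin

text \<open>Slutsky's lemma for characteristic functions: two values of \<open>iexp\<close> differ
  by at most the distance of the arguments, which is used on the likely event, and by at most 2,
  which is used off it.\<close>

lemma char_limit_perturbed:
  fixes X Y :: "nat \<Rightarrow> 'w \<Rightarrow> 'b::euclidean_space"
  assumes [measurable]: "\<And>n. X n \<in> borel_measurable M" "\<And>n. Y n \<in> borel_measurable M"
    and close: "\<And>e \<epsilon>. e > 0 \<Longrightarrow> \<epsilon> > 0 \<Longrightarrow> likely M \<epsilon> (\<lambda>n \<omega>. norm (X n \<omega> - Y n \<omega>) \<le> e)"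
    and lim: "(\<lambda>n. \<integral>\<omega>. iexp (a \<bullet> Y n \<omega>) \<partial>M) \<longlonglongrightarrow> l"
  shows "(\<lambda>n. \<integral>\<omega>. iexp (a \<bullet> X n \<omega>) \<partial>M) \<longlonglongrightarrow> l"
proof -
  have "(\<lambda>n. (\<integral>\<omega>. iexp (a \<bullet> X n \<omega>) \<partial>M) - (\<integral>\<omega>. iexp (a \<bullet> Y n \<omega>) \<partial>M)) \<longlonglongrightarrow> 0"
  proof (rule tendstoI)
    fix r :: real assume "r > 0"
    \<comment> \<open>The likely event contributes \<open>norm a * e < r / 2\<close> and its
      complement at most \<open>2 * (r / 4)\<close>, which together stay below
      \<open>r\<close>.\<close>
    define e where "e = r / (2 * (norm a + 1))"
    have na: "norm a + 1 > 0" by (simp add: add_nonneg_pos)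
    have e: "e > 0" "norm a * e < r / 2" using \<open>r > 0\<close> na by (auto simp: e_def field_simps)
    have "likely M (r / 4) (\<lambda>n \<omega>. norm (X n \<omega> - Y n \<omega>) \<le> e)" using close e(1) \<open>r > 0\<close> by simp
    then show "\<forall>\<^sub>F n in sequentially. dist ((\<integral>\<omega>. iexp (a \<bullet> X n \<omega>) \<partial>M) - (\<integral>\<omega>. iexp (a \<bullet> Y n \<omega>) \<partial>M)) 0 < r"
      unfolding likely_def
    proof eventually_elim
      case (elim n)
      then obtain G where G: "G \<in> events" "prob G > 1 - r / 4" "\<forall>\<omega>\<in>G. norm (X n \<omega> - Y n \<omega>) \<le> e" by blast
      have i: "integrable M (\<lambda>\<omega>. iexp (a \<bullet> X n \<omega>))" "integrable M (\<lambda>\<omega>. iexp (a \<bullet> Y n \<omega>))"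
        by (intro integrable_const_bound[of _ 1]; simp)+
      have le2: "cmod (iexp s - iexp t) \<le> 2" for s t
        using norm_triangle_ineq4[of "iexp s" "iexp t"] by simp
      have lip: "cmod (iexp s - iexp t) \<le> \<bar>s - t\<bar>" for s t
      proof -
        have "iexp s - iexp t = iexp t * (iexp (s - t) - 1)"
          by (simp add: right_diff_distrib flip: exp_add)
        then have "cmod (iexp s - iexp t) = cmod (iexp (s - t) - 1)" by (simp add: norm_mult)
        also have "\<dots> \<le> \<bar>s - t\<bar>" using iexp_approx1[of "s - t" 0] by simp
        finally show ?thesis .
      qed
      have pw: "cmod (iexp (a \<bullet> X n \<omega>) - iexp (a \<bullet> Y n \<omega>)) \<le> norm a * e + 2 * indicator (space M - G) \<omega>"
        if "\<omega> \<in> space M" for \<omega>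
      proof (cases "\<omega> \<in> G")
        case True
        have "cmod (iexp (a \<bullet> X n \<omega>) - iexp (a \<bullet> Y n \<omega>)) \<le> \<bar>a \<bullet> (X n \<omega> - Y n \<omega>)\<bar>"
          using lip[of "a \<bullet> X n \<omega>" "a \<bullet> Y n \<omega>"] by (simp add: inner_diff_right)
        also have "\<dots> \<le> norm a * norm (X n \<omega> - Y n \<omega>)" by (rule Cauchy_Schwarz_ineq2)
        also have "\<dots> \<le> norm a * e" using G(3) True by (intro mult_left_mono) auto
        finally show ?thesis using True by simp
      next
        case False
        have "0 \<le> norm a * e" using e by simp
        then show ?thesis using False that le2[of "a \<bullet> X n \<omega>" "a \<bullet> Y n \<omega>"] by simp
      qed
      have ib: "integrable M (\<lambda>\<omega>. norm a * e + 2 * indicator (space M - G) \<omega>)"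
        using G(1) by (intro Bochner_Integration.integrable_add integrable_const integrable_mult_right integrable_real_indicator)
          (auto simp: emeasure_eq_measure)
      have "cmod ((\<integral>\<omega>. iexp (a \<bullet> X n \<omega>) \<partial>M) - (\<integral>\<omega>. iexp (a \<bullet> Y n \<omega>) \<partial>M))
        = cmod (\<integral>\<omega>. iexp (a \<bullet> X n \<omega>) - iexp (a \<bullet> Y n \<omega>) \<partial>M)" using i by simp
      also have "\<dots> \<le> (\<integral>\<omega>. cmod (iexp (a \<bullet> X n \<omega>) - iexp (a \<bullet> Y n \<omega>)) \<partial>M)" by (rule integral_norm_bound)
      also have "\<dots> \<le> (\<integral>\<omega>. norm a * e + 2 * indicator (space M - G) \<omega> \<partial>M)"
        using i ib pw by (intro integral_mono) auto
      also have "\<dots> = norm a * e + 2 * prob (space M - G)" 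
      proof -
        have "integrable M (\<lambda>\<omega>. 2 * indicator (space M - G) \<omega> :: real)"
          using G(1) by (intro integrable_mult_right integrable_real_indicator) (auto simp: emeasure_eq_measure)
        then show ?thesis by (subst Bochner_Integration.integral_add) (simp_all add: prob_space Int_absorb2)
      qed
      also have "\<dots> < r" using e(2) G(1,2) by (simp add: prob_compl)
      finally show ?case by (simp add: dist_norm)
    qed
  qed
  from tendsto_add[OF this lim] show ?thesis by simp
qed

text \<open>Each linear functional of \<open>A *v sample_mean Z n \<omega> g\<close> is a scalar
  sample mean, so the one-dimensional limit theorem gives all characteristic functions; the
  remainder disappears by perturbation, and tightness follows from the Chebyshev bound.\<close>

theorem asymptotically_linear_imp_normal:
  fixes g :: "'z \<Rightarrow> real ^ 'm" and A :: "real ^ 'm ^ 'p"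
  assumes g: "g \<in> borel_measurable F" and sq: "integrable F (\<lambda>z. (norm (g z))\<^sup>2)" and mean: "(\<integral>z. g z \<partial>F) = 0"
    and X[measurable]: "\<And>n. X n \<in> borel_measurable M"
    and lin: "\<And>e \<epsilon>. e > 0 \<Longrightarrow> \<epsilon> > 0 \<Longrightarrow>
      likely M \<epsilon> (\<lambda>n \<omega>. norm (X n \<omega> - A *v sample_mean Z n \<omega> g) \<le> e / sqrt (real n))"
  shows "\<exists>N. is_multivariate_normal N 0 (A ** variance_matrix F g ** transpose A) \<and>
    converges_in_law M (\<lambda>n \<omega>. sqrt (real n) *\<^sub>R X n \<omega>) N"
proof -
  interpret F: prob_space F by (rule prob_space_F)
  let ?S = "A ** variance_matrix F g ** transpose A"
  have gi: "integrable F g"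
  proof -
    have "integrable F (\<lambda>z. norm (g z))" using F.square_integrable_imp_integrable[of "\<lambda>z. norm (g z)"] g sq by simp
    then show ?thesis using g by (simp add: integrable_norm_iff)
  qed
  have gm: "(\<lambda>z. g z $ k) \<in> borel_measurable F" for k
    using borel_measurable_inner[OF g borel_measurable_const, of "axis k 1"] by (simp add: inner_axis)
  have gk: "(\<integral>z. g z $ k \<partial>F) = 0" for k
    using integral_inner_left[OF gi, of "axis k 1"] mean by (simp add: inner_axis)
  have gg: "integrable F (\<lambda>z. g z $ k * g z $ l)" for k l
  proof (rule Bochner_Integration.integrable_bound[OF sq])
    show "(\<lambda>z. g z $ k * g z $ l) \<in> borel_measurable F" using gm by measurable
    have "\<bar>g z $ k * g z $ l\<bar> \<le> norm (g z) * norm (g z)" for z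
      unfolding abs_mult using component_le_norm_cart[of "g z"] by (intro mult_mono) auto
    then show "AE z in F. norm (g z $ k * g z $ l) \<le> norm ((norm (g z))\<^sup>2)" by (simp add: power2_eq_square)
  qed
  have V: "variance_matrix F g $ k $ l = (\<integral>z. g z $ k * g z $ l \<partial>F)" for k l
    by (simp add: variance_matrix_def gk)
  have Vq: "w \<bullet> (variance_matrix F g *v w) = (\<integral>z. (w \<bullet> g z)\<^sup>2 \<partial>F)" for w
  proof -
    have "(\<integral>z. (w \<bullet> g z)\<^sup>2 \<partial>F) = (\<integral>z. (\<Sum>k\<in>UNIV. \<Sum>l\<in>UNIV. (w $ k * w $ l) * (g z $ k * g z $ l)) \<partial>F)"
      by (simp add: inner_vec_def power2_eq_square sum_product ac_simps)
    also have "\<dots> = (\<Sum>k\<in>UNIV. \<Sum>l\<in>UNIV. (w $ k * w $ l) * (\<integral>z. g z $ k * g z $ l \<partial>F))"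
      using gg by (simp add: Bochner_Integration.integral_sum)
    also have "\<dots> = w \<bullet> (variance_matrix F g *v w)"
      by (simp add: inner_vec_def matrix_vector_mult_def V sum_distrib_left ac_simps)
    finally show ?thesis by simp
  qed
  have Sq: "u \<bullet> (?S *v u) = (\<integral>z. (u \<bullet> (A *v g z))\<^sup>2 \<partial>F)" for u
  proof -
    have "u \<bullet> (?S *v u) = (transpose A *v u) \<bullet> (variance_matrix F g *v (transpose A *v u))"
      by (simp add: dot_lmul_matrix matrix_vector_mul_assoc[symmetric])
    also have "\<dots> = (\<integral>z. (u \<bullet> (A *v g z))\<^sup>2 \<partial>F)"
      unfolding Vq by (simp add: dot_lmul_matrix)
    finally show ?thesis .
  qed
  have St: "transpose ?S = ?S"
  proof -
    have "transpose (variance_matrix F g) = variance_matrix F g"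
      by (simp add: transpose_def vec_eq_iff V mult.commute)
    then show ?thesis by (simp add: matrix_transpose_mul matrix_mul_assoc)
  qed
  have Sp: "0 \<le> u \<bullet> (?S *v u)" for u unfolding Sq by simp
  obtain N where N: "is_multivariate_normal N 0 ?S" using multivariate_normal_exists[OF St Sp] by blast
  have Np: "prob_space N" "sets N = sets borel"
    and Nd: "\<And>u. distr N borel (\<lambda>x. u \<bullet> x) = normal_law 0 (u \<bullet> (?S *v u))"
    using N by (auto simp: is_multivariate_normal_def)
  define Y where "Y n \<omega> = sqrt (real n) *\<^sub>R (A *v sample_mean Z n \<omega> g)" for n \<omega>
  have bA: "bounded_linear (\<lambda>x. A *v x)" by (rule matrix_vector_mul_bounded_linear)
  have [measurable]: "(\<lambda>\<omega>. A *v sample_mean Z n \<omega> g) \<in> borel_measurable M" for n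
    by (rule borel_measurable_continuous_on[OF linear_continuous_on[OF bA] sample_mean_measurable[OF g]])
  have Ym: "Y n \<in> borel_measurable M" for n unfolding Y_def[abs_def] by measurable
  have close: "likely M \<epsilon> (\<lambda>n \<omega>. norm (sqrt (real n) *\<^sub>R X n \<omega> - Y n \<omega>) \<le> e)" if "e > 0" "\<epsilon> > 0" for e \<epsilon>
  proof (rule likely_mono[OF lin[OF that]])
    show "\<forall>\<^sub>F n in sequentially. \<forall>\<omega>\<in>space M. norm (X n \<omega> - A *v sample_mean Z n \<omega> g) \<le> e / sqrt (real n) \<longrightarrow>
      norm (sqrt (real n) *\<^sub>R X n \<omega> - Y n \<omega>) \<le> e"
      using eventually_gt_at_top[of 0]
      by eventually_elim (auto simp: Y_def pos_le_divide_eq mult.commute simp flip: scaleR_diff_right)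
  qed simp
  have "converges_in_law M (\<lambda>n \<omega>. sqrt (real n) *\<^sub>R X n \<omega>) N"
  proof (rule converges_in_law_of_char[OF prob_space_axioms _ Np])
    fix a :: "real ^ 'p"
    define f where "f z = a \<bullet> (A *v g z)" for z
    have fm: "f \<in> borel_measurable F"
      unfolding f_def by (intro borel_measurable_inner borel_measurable_const borel_measurable_continuous_on[OF linear_continuous_on[OF bA] g])
    obtain C where C: "C > 0" "\<And>x. norm (A *v x) \<le> norm x * C" using bounded_linear.pos_bounded[OF bA] by blast
    have f2: "integrable F (\<lambda>z. (f z)\<^sup>2)"
    proof (rule Bochner_Integration.integrable_bound)
      show "integrable F (\<lambda>z. (norm a * C)\<^sup>2 * (norm (g z))\<^sup>2)" using sq by simp
      show "(\<lambda>z. (f z)\<^sup>2) \<in> borel_measurable F" using fm by simp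
      have "\<bar>f z\<bar> \<le> norm a * C * norm (g z)" for z
      proof -
        have "\<bar>f z\<bar> \<le> norm a * norm (A *v g z)" unfolding f_def by (rule Cauchy_Schwarz_ineq2)
        also have "\<dots> \<le> norm a * (norm (g z) * C)" using C by (intro mult_left_mono) auto
        finally show ?thesis by (simp add: ac_simps)
      qed
      then have "(f z)\<^sup>2 \<le> (norm a * C * norm (g z))\<^sup>2" for z
        by (metis abs_ge_zero power2_abs power_mono)
      then show "AE z in F. norm ((f z)\<^sup>2) \<le> norm ((norm a * C)\<^sup>2 * (norm (g z))\<^sup>2)"
        by (simp add: power_mult_distrib)
    qed
    have f0: "(\<integral>z. f z \<partial>F) = 0"
    proof -
      have "(\<integral>z. A *v g z \<partial>F) = A *v (\<integral>z. g z \<partial>F)" by (rule integral_bounded_linear[OF bA gi])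
      moreover have "integrable F (\<lambda>z. A *v g z)" by (rule integrable_bounded_linear[OF bA gi])
      ultimately show ?thesis using mean by (simp add: f_def)
    qed
    have smf: "a \<bullet> Y n \<omega> = sqrt (real n) * sample_mean Z n \<omega> f" for n \<omega>
      by (simp add: Y_def f_def sample_mean_def inner_sum_right matrix_vector_mult_scaleR
          linear_sum[OF bounded_linear.linear[OF bA]])
    have um: "(\<lambda>x. a \<bullet> x) \<in> borel_measurable N" using Np(2) by (simp cong: measurable_cong_sets)
    have "(\<lambda>n. \<integral>\<omega>. iexp (a \<bullet> Y n \<omega>) \<partial>M) \<longlonglongrightarrow> exp (- complex_of_real ((\<integral>z. (f z)\<^sup>2 \<partial>F) / 2))"
      unfolding smf by (rule char_sample_mean_limit[OF fm f2 f0])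
    \<comment> \<open>The limit is identified through the law of \<open>a \<bullet> x\<close> under
      \<open>N\<close>, whose variance is the second moment of \<open>f\<close> by
      \<open>Sq\<close>, evaluated at the argument 1.\<close>
    also have "exp (- complex_of_real ((\<integral>z. (f z)\<^sup>2 \<partial>F) / 2)) = char (distr N borel (\<lambda>x. a \<bullet> x)) 1"
      unfolding Nd char_normal_law[OF Sp] unfolding Sq f_def by simp
    also have "\<dots> = (\<integral>x. iexp (a \<bullet> x) \<partial>N)"
      unfolding char_def by (subst integral_distr[OF um]) simp_all
    finally show "(\<lambda>n. \<integral>\<omega>. iexp (a \<bullet> (sqrt (real n) *\<^sub>R X n \<omega>)) \<partial>M) \<longlonglongrightarrow> (\<integral>x. iexp (a \<bullet> x) \<partial>N)"
      by (intro char_limit_perturbed[OF _ Ym close]) simp_all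
  next
    fix \<epsilon> :: real assume "\<epsilon> > 0"
    obtain C where C: "C > 0" "\<And>x. norm (A *v x) \<le> norm x * C" using bounded_linear.pos_bounded[OF bA] by blast
    obtain K where K: "K > 0" "likely M (\<epsilon> / 2) (\<lambda>n \<omega>. norm (sample_mean Z n \<omega> g - (\<integral>z. g z \<partial>F)) \<le> K / sqrt (real n))"
      using sample_mean_root_n_bounded[OF g sq, of "\<epsilon> / 2"] \<open>\<epsilon> > 0\<close> by auto
    have "likely M (\<epsilon> / 2 + \<epsilon> / 2) (\<lambda>n \<omega>. norm (sample_mean Z n \<omega> g - (\<integral>z. g z \<partial>F)) \<le> K / sqrt (real n) \<and>
       norm (sqrt (real n) *\<^sub>R X n \<omega> - Y n \<omega>) \<le> 1)"
      using \<open>\<epsilon> > 0\<close> by (intro likely_conj K close) auto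
    then have "likely M \<epsilon> (\<lambda>n \<omega>. norm (sqrt (real n) *\<^sub>R X n \<omega>) \<le> K * C + 1)"
    proof (rule likely_mono)
      show "\<forall>\<^sub>F n in sequentially. \<forall>\<omega>\<in>space M. norm (sample_mean Z n \<omega> g - (\<integral>z. g z \<partial>F)) \<le> K / sqrt (real n) \<and>
         norm (sqrt (real n) *\<^sub>R X n \<omega> - Y n \<omega>) \<le> 1 \<longrightarrow> norm (sqrt (real n) *\<^sub>R X n \<omega>) \<le> K * C + 1"
        using eventually_gt_at_top[of 0]
      proof eventually_elim
        case (elim n)
        show ?case
        proof (intro ballI impI)
          fix \<omega> assume "\<omega> \<in> space M"
            and h: "norm (sample_mean Z n \<omega> g - (\<integral>z. g z \<partial>F)) \<le> K / sqrt (real n) \<and> norm (sqrt (real n) *\<^sub>R X n \<omega> - Y n \<omega>) \<le> 1"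
          have "norm (Y n \<omega>) \<le> sqrt (real n) * (norm (sample_mean Z n \<omega> g) * C)"
            unfolding Y_def using C by (auto intro!: mult_left_mono)
          also have "\<dots> \<le> sqrt (real n) * ((K / sqrt (real n)) * C)"
            using h mean C by (intro mult_left_mono mult_right_mono) auto
          also have "\<dots> = K * C" using elim by simp
          finally show "norm (sqrt (real n) *\<^sub>R X n \<omega>) \<le> K * C + 1"
            using h norm_triangle_sub[of "sqrt (real n) *\<^sub>R X n \<omega>" "Y n \<omega>"] by linarith
        qed
      qed
    qed simp
    then show "\<exists>K. likely M \<epsilon> (\<lambda>n \<omega>. norm (sqrt (real n) *\<^sub>R X n \<omega>) \<le> K)" by blast
  qed simp
  then show ?thesis using N by blast
qed

end

section \<open>Estimating functions in block form\<close>

abbreviation (input) mk :: "real ^ 'p::finite \<Rightarrow> real ^ 'q::finite \<Rightarrow> real ^ 'q ^ 'p \<Rightarrow> real ^ ('p + 'q + 'q \<times> 'p)" where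
  "mk t l X \<equiv> stack3 t l (vec_cols X)"

lemma parts_mk [simp]:
  "theta_part (mk t l X) = t" "lambda_part (mk t l X) = l" "D_part (mk t l X) = X"
  by (simp_all add: theta_part_def lambda_part_def D_part_def stack3_def vec_cols_def vec_eq_iff)

lemma mk_parts [simp]: "mk (theta_part \<alpha>) (lambda_part \<alpha>) (D_part \<alpha>) = \<alpha>"
  by (simp add: theta_part_def lambda_part_def D_part_def stack3_def vec_cols_def vec_eq_iff split: sum.split)

lemma parts_eq_iff: "\<alpha> = \<beta> \<longleftrightarrow> theta_part \<alpha> = theta_part \<beta> \<and> lambda_part \<alpha> = lambda_part \<beta> \<and> D_part \<alpha> = D_part \<beta>"
  by (metis mk_parts)

lemma bounded_linear_parts:
  "bounded_linear theta_part" "bounded_linear lambda_part" "bounded_linear D_part"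
  unfolding linear_conv_bounded_linear[symmetric]
  by (auto intro!: linearI simp: theta_part_def lambda_part_def D_part_def vec_eq_iff)

lemma parts_linear:
  "theta_part 0 = 0" "lambda_part 0 = 0" "D_part 0 = 0"
  "theta_part (x + y) = theta_part x + theta_part y" "lambda_part (x + y) = lambda_part x + lambda_part y"
  "D_part (x + y) = D_part x + D_part y"
  "theta_part (x - y) = theta_part x - theta_part y" "lambda_part (x - y) = lambda_part x - lambda_part y"
  "D_part (x - y) = D_part x - D_part y"
  "theta_part (- x) = - theta_part x" "lambda_part (- x) = - lambda_part x" "D_part (- x) = - D_part x"
  "theta_part (c *\<^sub>R x) = c *\<^sub>R theta_part x" "lambda_part (c *\<^sub>R x) = c *\<^sub>R lambda_part x"
  "D_part (c *\<^sub>R x) = c *\<^sub>R D_part x"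
  by (simp_all add: theta_part_def lambda_part_def D_part_def vec_eq_iff)

lemma bounded_linear_mk:
  "bounded_linear (\<lambda>x. mk (fst x) (fst (snd x)) (snd (snd x)))"
  unfolding linear_conv_bounded_linear[symmetric]
  by (rule linearI) (simp_all add: parts_eq_iff parts_linear)

lemma mk_add: "mk t l X + mk t' l' X' = mk (t + t') (l + l') (X + X')"
  by (simp add: parts_eq_iff parts_linear)

lemma mk_scaleR: "c *\<^sub>R mk t l X = mk (c *\<^sub>R t) (c *\<^sub>R l) (c *\<^sub>R X)"
  by (simp add: parts_eq_iff parts_linear)

lemma mk_zero: "mk 0 0 0 = 0"
  by (simp add: parts_eq_iff parts_linear)

lemma bounded_bilinear_matrix_vector: "bounded_bilinear (\<lambda>(A :: real ^ 'n ^ 'm) x. A *v x)"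
  unfolding bilinear_conv_bounded_bilinear[symmetric] bilinear_def
  by (auto intro!: linearI simp: matrix_vector_right_distrib matrix_vector_mult_scaleR
      matrix_vector_mult_add_rdistrib scaleR_matrix_vector_assoc)

lemma bounded_bilinear_matrix_matrix: "bounded_bilinear (\<lambda>(A :: real ^ 'n ^ 'm) (B :: real ^ 'k ^ 'n). A ** B)"
  unfolding bilinear_conv_bounded_bilinear[symmetric] bilinear_def
  by (auto intro!: linearI simp: matrix_matrix_mult_def vec_eq_iff
      sum_distrib_left sum.distrib algebra_simps)

lemma bounded_linear_matrix_left:
  "bounded_linear (\<lambda>A :: real ^ 'n ^ 'm. A *v x)" "bounded_linear (\<lambda>A :: real ^ 'n ^ 'm. A ** X)"
  using bounded_bilinear.bounded_linear_left[OF bounded_bilinear_matrix_vector]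
    bounded_bilinear.bounded_linear_left[OF bounded_bilinear_matrix_matrix] by blast+

lemma bounded_linear_transpose: "bounded_linear (transpose :: real ^ 'n ^ 'm \<Rightarrow> real ^ 'm ^ 'n)"
  unfolding linear_conv_bounded_linear[symmetric]
  by (rule linearI) (simp_all add: transpose_def vec_eq_iff)

lemma bounded_linear_axis: "bounded_linear (axis i :: 'b::euclidean_space \<Rightarrow> 'b ^ 'n)"
  unfolding linear_conv_bounded_linear[symmetric]
  by (rule linearI) (simp_all add: axis_def vec_eq_iff)

lemma sum_axis_components: "(\<Sum>i\<in>UNIV. axis i (x $ i)) = (x :: 'b::euclidean_space ^ 'n)"
  by (simp add: vec_eq_iff axis_def sum.delta if_distrib[of "\<lambda>z. z $ _"] cong: if_cong)

lemma differentiable_vecI: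
  fixes f :: "'a::real_normed_vector \<Rightarrow> 'b::euclidean_space ^ 'n"
  assumes "\<And>i. (\<lambda>x. f x $ i) differentiable (at a)"
  shows "f differentiable (at a)"
proof -
  have "(\<lambda>x. \<Sum>i\<in>UNIV. axis i (f x $ i)) differentiable (at a)"
    by (intro differentiable_sum ballI differentiable_compose[OF bounded_linear_imp_differentiable[OF bounded_linear_axis] assms]) simp
  then show ?thesis by (simp add: sum_axis_components)
qed

text \<open>Matrices through which the entries of \<open>P\<close> and \<open>G\<close> are recovered from the products with
  \<open>D\<close> that occur in \<open>est\<close>, although \<open>p\<close> and \<open>q\<close> differ.\<close>

definition unit_rows :: "'p \<Rightarrow> real ^ 'q ^ 'p" where
  "unit_rows k = (\<chi> i j. if i = k then 1 else 0)"

lemma unit_rows_mult: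
  "(A ** unit_rows k) $ i $ j = A $ i $ k" "(v v* unit_rows k) $ j = v $ k"
  by (simp_all add: matrix_matrix_mult_def vector_matrix_mult_def unit_rows_def
      if_distrib[of "\<lambda>z. _ * z"] if_distrib[of "\<lambda>z. z * _"] cong: if_cong)

text \<open>The coefficients are free functions, not derivatives of \<open>f\<close>, because an
  expectation of Jacobians becomes the Jacobian of an expectation only after proof. For fixed
  \<alpha> the value is linear in the coefficients, so one definition covers a single observation,
  the sample mean and the expectation.\<close>

definition est ::
  "(real ^ 'p \<Rightarrow> real ^ 'q \<Rightarrow> real ^ 'p) \<Rightarrow> (real ^ 'p \<Rightarrow> real ^ 'p) \<Rightarrow>
   (real ^ 'p \<Rightarrow> real ^ 'q \<Rightarrow> real ^ 'p ^ 'p) \<Rightarrow> (real ^ 'p \<Rightarrow> real ^ 'q \<Rightarrow> real ^ 'q ^ 'p) \<Rightarrow>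
   real ^ ('p::finite + 'q::finite + 'q \<times> 'p) \<Rightarrow> real ^ ('p + 'q + 'q \<times> 'p)" where
  "est f G P Q \<alpha> = (let t = theta_part \<alpha>; l = lambda_part \<alpha>; X = D_part \<alpha> in
     mk (f t l) (transpose X *v G t) (P t l ** X + Q t l))"

lemma est_mk: "est f G P Q (mk t l X) = mk (f t l) (transpose X *v G t) (P t l ** X + Q t l)"
  by (simp add: est_def)

lemma eta_eq_est: "eta \<phi> \<psi> z = est (\<phi> z) (grad (\<psi> z)) (\<lambda>t l. jacobian (\<lambda>t. \<phi> z t l) (at t)) (\<lambda>t l. jacobian (\<lambda>l. \<phi> z t l) (at l))"
  by (simp add: fun_eq_iff eta_def est_def Let_def)

lemma differentiable_parts:
  fixes h :: "real ^ 'p \<Rightarrow> real ^ 'q \<Rightarrow> 'b::real_normed_vector"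
  assumes "(\<lambda>(t, l). h t l) differentiable (at (theta_part \<alpha>, lambda_part \<alpha>))"
  shows "(\<lambda>\<alpha>. h (theta_part \<alpha>) (lambda_part \<alpha>)) differentiable (at \<alpha>)"
proof -
  have "(\<lambda>\<alpha>. (theta_part \<alpha>, lambda_part \<alpha>)) differentiable (at \<alpha>)"
    by (intro bounded_linear_imp_differentiable bounded_linear_Pair bounded_linear_parts)
  from differentiable_chain_at[OF this assms] show ?thesis by (simp add: o_def)
qed

lemma differentiable_bilinear:
  assumes "bounded_bilinear B" "f differentiable (at a)" "g differentiable (at a)"
  shows "(\<lambda>x. B (f x) (g x)) differentiable (at a)"
  using bounded_bilinear.FDERIV[OF assms(1)] assms(2,3) unfolding differentiable_def by blast

lemma est_differentiable:
  assumes "(\<lambda>(t, l). f t l) differentiable (at (theta_part \<alpha>, lambda_part \<alpha>))"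
    and "G differentiable (at (theta_part \<alpha>))"
    and "(\<lambda>(t, l). P t l) differentiable (at (theta_part \<alpha>, lambda_part \<alpha>))"
    and "(\<lambda>(t, l). Q t l) differentiable (at (theta_part \<alpha>, lambda_part \<alpha>))"
  shows "est f G P Q differentiable (at \<alpha>)"
proof -
  have D: "D_part differentiable (at \<alpha>)" by (rule bounded_linear_imp_differentiable[OF bounded_linear_parts(3)])
  have f: "(\<lambda>\<alpha>. f (theta_part \<alpha>) (lambda_part \<alpha>)) differentiable (at \<alpha>)" by (rule differentiable_parts[OF assms(1)])
  have "(\<lambda>\<alpha>. G (theta_part \<alpha>)) differentiable (at \<alpha>)"
    by (rule differentiable_compose[OF assms(2) bounded_linear_imp_differentiable[OF bounded_linear_parts(1)]])
  from differentiable_bilinear[OF bounded_bilinear_matrix_vector differentiable_compose[OF bounded_linear_imp_differentiable[OF bounded_linear_transpose] D] this]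
  have g: "(\<lambda>\<alpha>. transpose (D_part \<alpha>) *v G (theta_part \<alpha>)) differentiable (at \<alpha>)" .
  have p: "(\<lambda>\<alpha>. P (theta_part \<alpha>) (lambda_part \<alpha>) ** D_part \<alpha> + Q (theta_part \<alpha>) (lambda_part \<alpha>)) differentiable (at \<alpha>)"
    by (intro differentiable_add differentiable_bilinear[OF bounded_bilinear_matrix_matrix] D differentiable_parts assms)
  obtain f' g' p' where d: "((\<lambda>\<alpha>. f (theta_part \<alpha>) (lambda_part \<alpha>)) has_derivative f') (at \<alpha>)"
    "((\<lambda>\<alpha>. transpose (D_part \<alpha>) *v G (theta_part \<alpha>)) has_derivative g') (at \<alpha>)"
    "((\<lambda>\<alpha>. P (theta_part \<alpha>) (lambda_part \<alpha>) ** D_part \<alpha> + Q (theta_part \<alpha>) (lambda_part \<alpha>)) has_derivative p') (at \<alpha>)"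
    using f g p unfolding differentiable_def by blast
  from bounded_linear.has_derivative[OF bounded_linear_mk has_derivative_Pair[OF d(1) has_derivative_Pair[OF d(2,3)]]]
  show ?thesis unfolding differentiable_def est_def by (auto simp: Let_def)
qed

section \<open>The population system\<close>

lemma gderiv_iff: "GDERIV f x :> D \<longleftrightarrow> (f has_derivative (\<lambda>h. D \<bullet> h)) (at x)"
  by (simp add: gderiv_def inner_commute)

lemma grad_eqI: "GDERIV f x :> D \<Longrightarrow> grad f x = D"
  unfolding grad_def
proof (rule the_equality)
  fix E assume "GDERIV f x :> E" "GDERIV f x :> D"
  then have "(\<lambda>h. E \<bullet> h) = (\<lambda>h. D \<bullet> h)" unfolding gderiv_iff by (rule has_derivative_unique)
  then have "E \<bullet> (E - D) = D \<bullet> (E - D)" by (rule fun_cong)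
  then have "(E - D) \<bullet> (E - D) = 0" by (simp add: inner_diff_left)
  then show "E = D" by simp
qed

lemma jacobian_eqI:
  fixes f :: "real ^ 'n \<Rightarrow> real ^ 'm"
  assumes "(f has_derivative f') (at x)"
  shows "jacobian f (at x) *v h = f' h"
proof -
  have "(f has_derivative (\<lambda>h. jacobian f (at x) *v h)) (at x)"
    using assms jacobian_works differentiableI by blast
  from has_derivative_unique[OF this assms] show ?thesis by (rule fun_cong)
qed

lemma jacobian_eq_matrixI:
  fixes f :: "real ^ 'n \<Rightarrow> real ^ 'm"
  assumes "(f has_derivative (*v) A) (at x)"
  shows "jacobian f (at x) = A"
  unfolding matrix_eq by (intro allI jacobian_eqI[OF assms])

lemma uminus_matrix_vector: "(- A) *v x = - (A *v x)" for A :: "real ^ 'n ^ 'm"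
  by (simp add: matrix_vector_mult_def vec_eq_iff sum_negf)

lemma matrix_inv_cancel:
  fixes A :: "real ^ 'n ^ 'n"
  assumes "invertible A"
  shows "matrix_inv A *v (A *v x) = x" "A *v (matrix_inv A *v x) = x"
    "matrix_inv A ** (A ** X) = X" "A ** (matrix_inv A ** X) = X"
proof -
  have "A ** matrix_inv A = mat 1 \<and> matrix_inv A ** A = mat 1"
    using assms unfolding invertible_def matrix_inv_def by (rule someI_ex)
  then show "matrix_inv A *v (A *v x) = x" "A *v (matrix_inv A *v x) = x"
    "matrix_inv A ** (A ** X) = X" "A ** (matrix_inv A ** X) = X"
    by (simp_all add: matrix_vector_mul_assoc matrix_mul_assoc)
qed

lemma invertible_injective: "(\<And>x. A *v x = 0 \<Longrightarrow> x = 0) \<Longrightarrow> invertible A" for A :: "real ^ 'n ^ 'n"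
  using matrix_left_invertible_ker invertible_left_inverse by blast

text \<open>\<open>A ** X + B = 0\<close> says that \<open>X\<close> is the derivative provided by
  the implicit function theorem; the chain rule then turns the second block into the gradient of the
  profiled loss. Used for the population system and for each realised sample.\<close>

lemma root_gradient:
  fixes f :: "real ^ 'p \<Rightarrow> real ^ 'q \<Rightarrow> real ^ 'p"
  assumes der: "((\<lambda>(t, l). f t l) has_derivative (\<lambda>(u, w). A *v u + B *v w)) (at (t0, l0))"
    and zero: "f t0 l0 = 0"
    and cont: "open S" "(t0, l0) \<in> S" "continuous_on S (\<lambda>(t, l). f t l)"
    and A: "invertible A" and X: "A ** X + B = 0"
    and uniq: "\<forall>t l. f t l = 0 \<longrightarrow> t = \<theta> l"
  shows "(\<theta> has_derivative (*v) X) (at l0)"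
    and "GDERIV L t0 :> g \<Longrightarrow> GDERIV (\<lambda>l. L (\<theta> l)) l0 :> transpose X *v g"
proof -
  have "(\<theta> has_derivative (\<lambda>x. - (matrix_inv A *v (case (0, x) of (u, w) \<Rightarrow> A *v u + B *v w)))) (at l0)"
    using uniq by (intro has_derivative_implicit_root[OF der _ cont]) (auto simp: zero matrix_inv_cancel[OF A])
  moreover have "B = - (A ** X)" using X by (simp add: eq_neg_iff_add_eq_0 add.commute)
  then have "- (matrix_inv A *v (B *v x)) = X *v x" for x
    using matrix_inv_cancel(1)[OF A, of "X *v x"]
    by (simp add: uminus_matrix_vector matrix_vector_mul_assoc[symmetric] linear_neg[OF matrix_vector_mul_linear])
  ultimately show d: "(\<theta> has_derivative (*v) X) (at l0)" by simp
  assume "GDERIV L t0 :> g"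
  then have "(L has_derivative (\<lambda>h. g \<bullet> h)) (at (\<theta> l0))" using uniq zero by (auto simp: gderiv_iff)
  from diff_chain_at[OF d this] show "GDERIV (\<lambda>l. L (\<theta> l)) l0 :> transpose X *v g"
    by (simp add: gderiv_iff o_def dot_lmul_matrix[symmetric])
qed

text \<open>\<open>est f G P Q\<close> is \<open>\<Psi>\<close> for \<open>f = E \<phi>\<close>, \<open>L = E \<psi>\<close>, with \<open>G\<close>, \<open>P\<close>, \<open>Q\<close> the expectations of the
  derivatives of \<open>\<psi>\<close> and \<open>\<phi>\<close>.\<close>

locale estimating_system =
  fixes f :: "real ^ 'p \<Rightarrow> real ^ 'q \<Rightarrow> real ^ 'p"
    and G :: "real ^ 'p \<Rightarrow> real ^ 'p" and P :: "real ^ 'p \<Rightarrow> real ^ 'q \<Rightarrow> real ^ 'p ^ 'p"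
    and Q :: "real ^ 'p \<Rightarrow> real ^ 'q \<Rightarrow> real ^ 'q ^ 'p" and L :: "real ^ 'p \<Rightarrow> real"
    and \<theta> :: "real ^ 'q \<Rightarrow> real ^ 'p" and l0 :: "real ^ 'q"
    and \<alpha>0 :: "real ^ ('p + 'q + 'q \<times> 'p)" and U :: "(real ^ ('p + 'q + 'q \<times> 'p)) set"
    and V :: "real ^ ('p + 'q + 'q \<times> 'p) ^ ('p + 'q + 'q \<times> 'p)"
  assumes U: "open U" "\<alpha>0 \<in> U"
    and est_diff: "\<And>\<alpha>. \<alpha> \<in> U \<Longrightarrow> est f G P Q differentiable (at \<alpha>)"
    and f_der: "\<And>\<alpha>. \<alpha> \<in> U \<Longrightarrow> ((\<lambda>(t, l). f t l) has_derivative
      (\<lambda>(u, w). P (theta_part \<alpha>) (lambda_part \<alpha>) *v u + Q (theta_part \<alpha>) (lambda_part \<alpha>) *v w))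
      (at (theta_part \<alpha>, lambda_part \<alpha>))"
    and L_der: "\<And>\<alpha>. \<alpha> \<in> U \<Longrightarrow> GDERIV L (theta_part \<alpha>) :> G (theta_part \<alpha>)"
    and root: "est f G P Q \<alpha>0 = 0"
    and V_der: "(est f G P Q has_derivative (*v) V) (at \<alpha>0)" and V_inv: "invertible V"
    and f_root: "\<And>t l. f t l = 0 \<longleftrightarrow> t = \<theta> l"
    and grad_root: "\<And>l. (GDERIV (\<lambda>l. L (\<theta> l)) l :> 0) \<longleftrightarrow> l = l0"
begin

abbreviation "t0 \<equiv> theta_part \<alpha>0"
abbreviation "D0 \<equiv> D_part \<alpha>0"
abbreviation "P0 \<equiv> P t0 (lambda_part \<alpha>0)"
abbreviation "Q0 \<equiv> Q t0 (lambda_part \<alpha>0)"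

lemma root_parts: "f t0 (lambda_part \<alpha>0) = 0" "transpose D0 *v G t0 = 0" "P0 ** D0 + Q0 = 0"
  using root unfolding est_def Let_def by (simp_all add: parts_eq_iff parts_linear)

text \<open>The block rows of \<open>V\<close> are read off by differentiating each block of
  \<open>est\<close> directly and invoking uniqueness of derivatives. \<open>X\<close> is absent
  here since the first block of \<open>est\<close> does not depend on \<open>D\<close>.\<close>

lemma theta_part_V: "theta_part (V *v mk u w X) = P0 *v u + Q0 *v w"
proof -
  have "((\<lambda>\<alpha>. theta_part (est f G P Q \<alpha>)) has_derivative (\<lambda>h. theta_part (V *v h))) (at \<alpha>0)"
    by (rule bounded_linear.has_derivative[OF bounded_linear_parts(1) V_der])
  moreover have "((\<lambda>\<alpha>. (theta_part \<alpha>, lambda_part \<alpha>)) has_derivative (\<lambda>\<alpha>. (theta_part \<alpha>, lambda_part \<alpha>))) (at \<alpha>0)"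
    by (intro bounded_linear_imp_has_derivative bounded_linear_Pair bounded_linear_parts)
  from diff_chain_at[OF this f_der[OF U(2)]]
  have "((\<lambda>\<alpha>. theta_part (est f G P Q \<alpha>)) has_derivative (\<lambda>h. P0 *v theta_part h + Q0 *v lambda_part h)) (at \<alpha>0)"
    by (simp add: o_def est_def Let_def)
  ultimately have "(\<lambda>h. theta_part (V *v h)) = (\<lambda>h. P0 *v theta_part h + Q0 *v lambda_part h)"
    by (rule has_derivative_unique)
  from fun_cong[OF this, of "mk u w X"] show ?thesis by simp
qed

lemma Q0_eq: "Q0 = - (P0 ** D0)"
  using root_parts(3) by (simp add: eq_neg_iff_add_eq_0 add.commute)

text \<open>The rows of \<open>P0\<close> and \<open>Q0 = - P0 D0\<close> have the same left kernel, so a non-singular \<open>V\<close>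
  forces \<open>P0\<close> to be non-singular.\<close>

lemma P0_invertible: "invertible P0"
proof -
  have "\<exists>x. P0 *v x = u" for u
  proof -
    have "V *v (matrix_inv V *v mk u 0 0) = mk u 0 0" by (rule matrix_inv_cancel[OF V_inv])
    then have "theta_part (V *v mk (theta_part (matrix_inv V *v mk u 0 0)) (lambda_part (matrix_inv V *v mk u 0 0))
       (D_part (matrix_inv V *v mk u 0 0))) = u" by simp
    then have "P0 *v (theta_part (matrix_inv V *v mk u 0 0) - D0 *v lambda_part (matrix_inv V *v mk u 0 0)) = u"
      unfolding theta_part_V Q0_eq
      by (simp add: matrix_vector_mult_diff_distrib matrix_vector_mul_assoc uminus_matrix_vector)
    then show ?thesis by blast
  qed
  then have "surj ((*v) P0)" by (metis surjI)
  then show ?thesis using invertible_right_inverse matrix_right_invertible_surjective by blast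
qed

text \<open>The neighbourhood \<open>U\<close> lives in the space of \<alpha>, whereas the implicit
  function theorem needs one in \<open>(t, l)\<close>: it is the slice of \<open>U\<close> at
  \<open>D = D0\<close>.\<close>

lemma f_continuous: "open {(t, l). mk t l D0 \<in> U}" "continuous_on {(t, l). mk t l D0 \<in> U} (\<lambda>(t, l). f t l)"
proof -
  have "continuous_on UNIV (\<lambda>x. mk (fst x) (snd x) D0)"
  proof -
    have "continuous_on UNIV (\<lambda>x :: (real ^ 'p) \<times> (real ^ 'q). (fst x, snd x, D0))" by (intro continuous_intros)
    from continuous_on_compose2[OF linear_continuous_on[OF bounded_linear_mk] this subset_UNIV] show ?thesis by simp
  qed
  from open_vimage[OF U(1) this] show "open {(t, l). mk t l D0 \<in> U}" by (simp add: vimage_def case_prod_unfold)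
  show "continuous_on {(t, l). mk t l D0 \<in> U} (\<lambda>(t, l). f t l)"
  proof (intro continuous_at_imp_continuous_on ballI)
    fix x assume "x \<in> {(t, l). mk t l D0 \<in> U}"
    then show "isCont (\<lambda>(t, l). f t l) x" using has_derivative_continuous[OF f_der[of "mk (fst x) (snd x) D0"]] by auto
  qed
qed

lemma root_derivative:
  assumes "mk (\<theta> l) l D0 \<in> U" "invertible (P (\<theta> l) l)" "P (\<theta> l) l ** X + Q (\<theta> l) l = 0"
  shows "(\<theta> has_derivative (*v) X) (at l)" "GDERIV (\<lambda>l. L (\<theta> l)) l :> transpose X *v G (\<theta> l)"
proof -
  have d: "((\<lambda>(t, l). f t l) has_derivative (\<lambda>(u, w). P (\<theta> l) l *v u + Q (\<theta> l) l *v w)) (at (\<theta> l, l))"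
    using f_der[OF assms(1)] by simp
  have S: "(\<theta> l, l) \<in> {(t, l). mk t l D0 \<in> U}" using assms(1) by simp
  have z: "f (\<theta> l) l = 0" by (simp add: f_root)
  have uq: "\<forall>t l. f t l = 0 \<longrightarrow> t = \<theta> l" by (simp add: f_root)
  note r = root_gradient[OF d z f_continuous(1) S f_continuous(2) assms(2,3) uq]
  show "(\<theta> has_derivative (*v) X) (at l)" by (rule r(1))
  show "GDERIV (\<lambda>l. L (\<theta> l)) l :> transpose X *v G (\<theta> l)" by (rule r(2)[OF L_der[OF assms(1), unfolded parts_mk]])
qed

lemma theta_t0: "\<theta> (lambda_part \<alpha>0) = t0"
  using root_parts(1) by (simp add: f_root)

text \<open>The middle block of \<open>est f G P Q \<alpha>0 = 0\<close> is the gradient of the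
  profiled loss at the \<lambda>-part of \<open>\<alpha>0\<close>, so uniqueness of the critical
  point identifies that part.\<close>

lemma lambda_part_root: "lambda_part \<alpha>0 = l0"
  using root_derivative(2)[of "lambda_part \<alpha>0" D0] U(2) P0_invertible root_parts
  unfolding theta_t0 by (simp add: grad_root)

lemma theta_l0: "\<theta> l0 = t0"
  using theta_t0 by (simp add: lambda_part_root)

lemma theta_derivative_l0: "(\<theta> has_derivative (*v) D0) (at l0)"
  using root_derivative(1)[of l0 D0] U(2) P0_invertible root_parts mk_parts[of \<alpha>0]
  by (simp add: theta_l0 lambda_part_root)

lemma jacobian_theta: "jacobian \<theta> (at l0) = D0"
  by (rule jacobian_eq_matrixI[OF theta_derivative_l0])

text \<open>\<open>est\<close> is differentiable at \<open>(t0, l0, D)\<close> for every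
  \<open>D\<close> near \<open>D0\<close>, and its blocks are affine in \<open>D\<close>.
  Subtracting the values at \<open>D0\<close> from those at \<open>D0 + s *\<^sub>R E k\<close>
  isolates column \<open>k\<close> of \<open>P\<close> and entry \<open>k\<close> of
  \<open>G\<close>; \<open>Q\<close> is what then remains of the third block.\<close>

lemma
  shows P_diff: "(\<lambda>(t, l). P t l) differentiable (at (t0, l0))"
    and Q_diff: "(\<lambda>(t, l). Q t l) differentiable (at (t0, l0))"
    and G_diff: "G differentiable (at t0)"
proof -
  obtain d where d: "d > 0" "ball \<alpha>0 d \<subseteq> U" using U openE by blast
  define E :: "'p \<Rightarrow> real ^ 'q ^ 'p" where "E = unit_rows"
  have a0: "\<alpha>0 = mk t0 l0 D0" using mk_parts[of \<alpha>0] by (simp add: lambda_part_root)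
  have near: "\<exists>s>0. mk t0 l0 (D0 + s *\<^sub>R E k) \<in> U" for k
  proof -
    define m where "m = norm (mk 0 0 (E k)) + 1"
    define s where "s = d / m"
    have m: "m > 0" "norm (mk 0 0 (E k)) < m" by (simp_all add: m_def add_nonneg_pos)
    have s: "s > 0" using d m by (simp add: s_def)
    have "s * norm (mk 0 0 (E k)) < s * m" using s m by simp
    then have "s * norm (mk 0 0 (E k)) < d" using m by (simp add: s_def)
    moreover have "mk t0 l0 (D0 + s *\<^sub>R E k) = \<alpha>0 + s *\<^sub>R mk 0 0 (E k)"
      by (simp add: parts_eq_iff parts_linear lambda_part_root)
    ultimately have "mk t0 l0 (D0 + s *\<^sub>R E k) \<in> ball \<alpha>0 d" using s by (simp add: dist_norm)
    then show ?thesis using d s by blast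
  qed
  have dmk: "(\<lambda>x. mk (fst x) (snd x) X) differentiable (at y)" for X :: "real ^ 'q ^ 'p" and y :: "(real ^ 'p) \<times> (real ^ 'q)"
  proof -
    have "(\<lambda>x. (fst x, snd x, X)) differentiable (at y)"
      unfolding differentiable_def by (rule exI) (rule derivative_intros)+
    from differentiable_compose[OF bounded_linear_imp_differentiable[OF bounded_linear_mk] this]
    show ?thesis by simp
  qed
  have dest: "(\<lambda>x. est f G P Q (mk (fst x) (snd x) X)) differentiable (at (t0, l0))" if "mk t0 l0 X \<in> U" for X
    by (rule differentiable_compose[OF _ dmk]) (use est_diff[OF that] in simp)
  have dD: "(\<lambda>x. P (fst x) (snd x) ** X + Q (fst x) (snd x)) differentiable (at (t0, l0))" if "mk t0 l0 X \<in> U" for X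
    using differentiable_compose[OF bounded_linear_imp_differentiable[OF bounded_linear_parts(3)] dest[OF that]]
    by (simp add: est_mk)
  have dG: "(\<lambda>x. transpose X *v G (fst x)) differentiable (at (t0, l0))" if "mk t0 l0 X \<in> U" for X
    using differentiable_compose[OF bounded_linear_imp_differentiable[OF bounded_linear_parts(2)] dest[OF that]]
    by (simp add: est_mk)
  have d0: "mk t0 l0 D0 \<in> U" using U(2) a0 by simp
  have comp: "(\<lambda>x. F x $ i) differentiable (at y)" if "F differentiable (at y)" for F :: "_ \<Rightarrow> 'x::euclidean_space ^ 'y" and i and y :: "'u::real_normed_vector"
    by (rule differentiable_compose[OF bounded_linear_imp_differentiable[OF bounded_linear_vec_nth] that])
  have sc: "(\<lambda>x. c *\<^sub>R F x) differentiable (at y)" if "F differentiable (at y)"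
    for F :: "'u::real_normed_vector \<Rightarrow> 'x::real_normed_vector" and c y
    by (rule differentiable_compose[OF bounded_linear_imp_differentiable[OF bounded_linear_scaleR_right] that])
  have PE: "(\<lambda>x. P (fst x) (snd x) ** E k) differentiable (at (t0, l0))" for k
  proof -
    obtain s where s: "s > 0" "mk t0 l0 (D0 + s *\<^sub>R E k) \<in> U" using near by blast
    have "(\<lambda>x. (1 / s) *\<^sub>R ((P (fst x) (snd x) ** (D0 + s *\<^sub>R E k) + Q (fst x) (snd x)) - (P (fst x) (snd x) ** D0 + Q (fst x) (snd x)))) differentiable (at (t0, l0))"
      by (rule sc[OF differentiable_diff[OF dD[OF s(2)] dD[OF d0]]])
    moreover have "A ** (s *\<^sub>R B) = s *\<^sub>R (A ** B)" for A :: "real ^ 'p ^ 'p" and B :: "real ^ 'q ^ 'p"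
      by (simp add: matrix_matrix_mult_def vec_eq_iff sum_distrib_left ac_simps)
    ultimately show ?thesis using s by (simp add: matrix_add_ldistrib)
  qed
  have GE: "(\<lambda>x. transpose (E k) *v G (fst x)) differentiable (at (t0, l0))" for k
  proof -
    obtain s where s: "s > 0" "mk t0 l0 (D0 + s *\<^sub>R E k) \<in> U" using near by blast
    have "(\<lambda>x. (1 / s) *\<^sub>R (transpose (D0 + s *\<^sub>R E k) *v G (fst x) - transpose D0 *v G (fst x))) differentiable (at (t0, l0))"
      by (rule sc[OF differentiable_diff[OF dG[OF s(2)] dG[OF d0]]])
    moreover have "transpose (D0 + s *\<^sub>R E k) *v v = transpose D0 *v v + s *\<^sub>R (transpose (E k) *v v)" for v
      by (simp add: matrix_vector_mult_def transpose_def vec_eq_iff sum_distrib_left sum.distrib algebra_simps)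
    ultimately show ?thesis using s by simp
  qed
  \<comment> \<open>Every column of \<open>A ** E k\<close> repeats column \<open>k\<close> of
    \<open>A\<close>, so any index \<open>j\<close> will do; \<open>undefined\<close> is taken
    below.\<close>
  have Pe: "A $ i $ k = (A ** E k) $ i $ j" for A :: "real ^ 'p ^ 'p" and i k j
    by (simp add: E_def unit_rows_mult)
  have P: "(\<lambda>x. P (fst x) (snd x)) differentiable (at (t0, l0))"
  proof (intro differentiable_vecI)
    show "(\<lambda>x. P (fst x) (snd x) $ i $ k) differentiable (at (t0, l0))" for i k
      using comp[OF comp[OF PE[of k], of i], of undefined] by (simp only: Pe[symmetric])
  qed
  then show "(\<lambda>(t, l). P t l) differentiable (at (t0, l0))" by (simp add: case_prod_unfold)
  have "(\<lambda>x. (P (fst x) (snd x) ** D0 + Q (fst x) (snd x)) - P (fst x) (snd x) ** D0) differentiable (at (t0, l0))"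
    by (rule differentiable_diff[OF dD[OF d0] differentiable_bilinear[OF bounded_bilinear_matrix_matrix P differentiable_const]])
  then show "(\<lambda>(t, l). Q t l) differentiable (at (t0, l0))" by (simp add: case_prod_unfold)
  have Ge: "v $ k = (transpose (E k) *v v) $ j" for v :: "real ^ 'p" and k j
    by (simp add: E_def unit_rows_mult)
  have "(\<lambda>x. G (fst x)) differentiable (at (t0, l0))"
  proof (intro differentiable_vecI)
    show "(\<lambda>x. G (fst x) $ k) differentiable (at (t0, l0))" for k
      using comp[OF GE[of k], of undefined] by (simp only: Ge[symmetric])
  qed
  moreover have "(\<lambda>t. (t, l0)) differentiable (at t0)"
    unfolding differentiable_def by (rule exI) (rule derivative_intros)+
  ultimately have "(\<lambda>t. G (fst (t, l0))) differentiable (at t0)" using differentiable_compose[of "\<lambda>x. G (fst x)" "\<lambda>t. (t, l0)" t0] by blast 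
  then show "G differentiable (at t0)" by simp
qed

abbreviation "dP \<equiv> frechet_derivative (\<lambda>(t, l). P t l) (at (t0, l0))"
abbreviation "dQ \<equiv> frechet_derivative (\<lambda>(t, l). Q t l) (at (t0, l0))"

lemma mk_t0: "mk t0 l0 D0 = \<alpha>0"
  using mk_parts[of \<alpha>0] by (simp add: lambda_part_root)

lemma dP: "((\<lambda>x. P (fst x) (snd x)) has_derivative dP) (at (t0, l0))"
  using P_diff unfolding frechet_derivative_works by (simp add: case_prod_unfold)

lemma dQ: "((\<lambda>x. Q (fst x) (snd x)) has_derivative dQ) (at (t0, l0))"
  using Q_diff unfolding frechet_derivative_works by (simp add: case_prod_unfold)

lemma pair_derivative:
  assumes "(h has_derivative h') (at (t0, l0))"
  shows "((\<lambda>\<alpha>. h (theta_part \<alpha>, lambda_part \<alpha>)) has_derivative (\<lambda>k. h' (theta_part k, lambda_part k))) (at \<alpha>0)"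
proof -
  have "((\<lambda>\<alpha>. (theta_part \<alpha>, lambda_part \<alpha>)) has_derivative (\<lambda>\<alpha>. (theta_part \<alpha>, lambda_part \<alpha>))) (at \<alpha>0)"
    by (intro bounded_linear_imp_has_derivative bounded_linear_Pair bounded_linear_parts)
  from diff_chain_at[OF this] assms show ?thesis by (simp add: o_def lambda_part_root)
qed

lemma lambda_part_V: "lambda_part (V *v mk u w X) = transpose D0 *v (jacobian G (at t0) *v u) + transpose X *v G t0"
proof -
  have "((\<lambda>\<alpha>. lambda_part (est f G P Q \<alpha>)) has_derivative (\<lambda>h. lambda_part (V *v h))) (at \<alpha>0)"
    by (rule bounded_linear.has_derivative[OF bounded_linear_parts(2) V_der])
  moreover have "(G has_derivative (\<lambda>h. jacobian G (at t0) *v h)) (at t0)"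
    using G_diff jacobian_works by blast
  from diff_chain_at[OF bounded_linear_imp_has_derivative[OF bounded_linear_parts(1)] this]
  have "((\<lambda>\<alpha>. G (theta_part \<alpha>)) has_derivative (\<lambda>h. jacobian G (at t0) *v theta_part h)) (at \<alpha>0)" by (simp add: o_def)
  from bounded_bilinear.FDERIV[OF bounded_bilinear_matrix_vector bounded_linear_imp_has_derivative[OF bounded_linear_compose[OF bounded_linear_transpose bounded_linear_parts(3)]] this]
  have "((\<lambda>\<alpha>. lambda_part (est f G P Q \<alpha>)) has_derivative
      (\<lambda>h. transpose D0 *v (jacobian G (at t0) *v theta_part h) + transpose (D_part h) *v G t0)) (at \<alpha>0)"
    by (simp add: est_def Let_def)
  ultimately have "(\<lambda>h. lambda_part (V *v h)) = (\<lambda>h. transpose D0 *v (jacobian G (at t0) *v theta_part h) + transpose (D_part h) *v G t0)"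
    by (rule has_derivative_unique)
  from fun_cong[OF this, of "mk u w X"] show ?thesis by simp
qed

lemma D_part_V: "D_part (V *v mk u w X) = dP (u, w) ** D0 + dQ (u, w) + P0 ** X"
proof -
  have "((\<lambda>\<alpha>. D_part (est f G P Q \<alpha>)) has_derivative (\<lambda>h. D_part (V *v h))) (at \<alpha>0)"
    by (rule bounded_linear.has_derivative[OF bounded_linear_parts(3) V_der])
  moreover note has_derivative_add[OF bounded_bilinear.FDERIV[OF bounded_bilinear_matrix_matrix pair_derivative[OF dP]
      bounded_linear_imp_has_derivative[OF bounded_linear_parts(3)]] pair_derivative[OF dQ]]
  then have "((\<lambda>\<alpha>. D_part (est f G P Q \<alpha>)) has_derivative
      (\<lambda>h. P0 ** D_part h + dP (theta_part h, lambda_part h) ** D0 + dQ (theta_part h, lambda_part h))) (at \<alpha>0)"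
    by (simp add: est_def Let_def)
  ultimately have "(\<lambda>h. D_part (V *v h)) = (\<lambda>h. P0 ** D_part h + dP (theta_part h, lambda_part h) ** D0 + dQ (theta_part h, lambda_part h))"
    by (rule has_derivative_unique)
  from fun_cong[OF this, of "mk u w X"] show ?thesis by (simp add: ac_simps)
qed

text \<open>Membership in \<open>U\<close> and invertibility of \<open>P\<close> are open
  conditions, so the implicit function theorem applies at every \<open>l\<close> near
  \<open>l0\<close>. Formulas for the Jacobian and the gradient on a whole neighbourhood are what a
  second differentiation requires.\<close>

lemma eventually_regular:
  obtains S where "open S" "l0 \<in> S" "\<And>l. l \<in> S \<Longrightarrow> mk (\<theta> l) l D0 \<in> U" "\<And>l. l \<in> S \<Longrightarrow> invertible (P (\<theta> l) l)"
    "\<And>l. l \<in> S \<Longrightarrow> P (\<theta> l) l ** jacobian \<theta> (at l) + Q (\<theta> l) l = 0"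
    "\<And>l. l \<in> S \<Longrightarrow> isCont \<theta> l"
    "\<And>l. l \<in> S \<Longrightarrow> GDERIV (\<lambda>l. L (\<theta> l)) l :> transpose (jacobian \<theta> (at l)) *v G (\<theta> l)"
proof -
  have \<theta>c: "isCont \<theta> l0" using theta_derivative_l0 by (rule has_derivative_continuous)
  have "isCont (\<lambda>l. (\<theta> l, l, D0)) l0" by (intro continuous_intros \<theta>c)
  from isCont_o2[OF this linear_continuous_at[OF bounded_linear_mk]]
  have "isCont (\<lambda>l. mk (\<theta> l) l D0) l0" by simp
  then have "((\<lambda>l. mk (\<theta> l) l D0) \<longlongrightarrow> mk (\<theta> l0) l0 D0) (nhds l0)"
    using tendsto_at_iff_tendsto_nhds[of "\<lambda>l. mk (\<theta> l) l D0" l0] by (simp add: isCont_def)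
  then have "\<forall>\<^sub>F l in nhds l0. mk (\<theta> l) l D0 \<in> U"
    by (rule topological_tendstoD) (use U in \<open>simp_all add: theta_l0 mk_t0\<close>)
  \<comment> \<open>Invertibility is an open condition because the determinant is continuous;
    continuity of \<open>P\<close> along the curve comes from \<open>dP\<close>.\<close>
  moreover have "\<forall>\<^sub>F l in nhds l0. det (P (\<theta> l) l) \<noteq> 0"
  proof -
    have "isCont (\<lambda>x. P (fst x) (snd x)) (\<theta> l0, l0)" using has_derivative_continuous[OF dP] by (simp add: theta_l0)
    moreover have "isCont (\<lambda>l. (\<theta> l, l)) l0" by (intro continuous_intros \<theta>c)
    ultimately have "isCont (\<lambda>l. P (\<theta> l) l) l0" 
      using isCont_o2[of l0 "\<lambda>l. (\<theta> l, l)" "\<lambda>x. P (fst x) (snd x)"] by simp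
    then have "isCont (\<lambda>l. det (P (\<theta> l) l)) l0"
      unfolding det_def by (intro continuous_intros isCont_vec_nth) auto
    moreover have "det (P (\<theta> l0) l0) \<noteq> 0" using P0_invertible by (simp add: invertible_det_nz theta_l0 lambda_part_root)
    ultimately show ?thesis
      using tendsto_at_iff_tendsto_nhds[of "\<lambda>l. det (P (\<theta> l) l)" l0] tendsto_imp_eventually_ne
      by (simp add: isCont_def)
  qed
  ultimately have "\<forall>\<^sub>F l in nhds l0. mk (\<theta> l) l D0 \<in> U \<and> invertible (P (\<theta> l) l)"
    by eventually_elim (simp add: invertible_det_nz)
  then obtain S where S: "open S" "l0 \<in> S" "\<And>l. l \<in> S \<Longrightarrow> mk (\<theta> l) l D0 \<in> U" "\<And>l. l \<in> S \<Longrightarrow> invertible (P (\<theta> l) l)"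
    unfolding eventually_nhds by blast
  define X where "X l = - (matrix_inv (P (\<theta> l) l) ** Q (\<theta> l) l)" for l
  have neg: "A ** (- B) = - (A ** B)" for A :: "real ^ 'p ^ 'p" and B :: "real ^ 'q ^ 'p"
    by (simp add: matrix_matrix_mult_def vec_eq_iff sum_negf)
  have X: "P (\<theta> l) l ** X l + Q (\<theta> l) l = 0" if "l \<in> S" for l
    by (simp add: X_def neg matrix_inv_cancel[OF S(4)[OF that]])
  have d: "(\<theta> has_derivative (*v) (X l)) (at l)" "GDERIV (\<lambda>l. L (\<theta> l)) l :> transpose (X l) *v G (\<theta> l)" if "l \<in> S" for l
    using root_derivative[OF S(3)[OF that] S(4)[OF that] X[OF that]] by auto
  have j: "jacobian \<theta> (at l) = X l" if "l \<in> S" for l by (rule jacobian_eq_matrixI[OF d(1)[OF that]])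
  show thesis
    by (rule that[OF S]) (use X d j has_derivative_continuous[OF d(1)] in auto)
qed

text \<open>The implicit function theorem a second time: near \<open>l0\<close> the Jacobian of
  \<theta> is the unique matrix \<open>X\<close> with
  \<open>P (\<theta> l) l ** X + Q (\<theta> l) l = 0\<close>, and this equation, being the third
  block of \<open>est\<close> along a curve, is differentiable at \<open>(D0, l0)\<close>. No
  derivative of a matrix inverse has to be computed.\<close>

lemma jacobian_theta_differentiable: "(\<lambda>l. jacobian \<theta> (at l)) differentiable (at l0)"
proof -
  obtain S where S: "open S" "l0 \<in> S" "\<And>l. l \<in> S \<Longrightarrow> mk (\<theta> l) l D0 \<in> U" "\<And>l. l \<in> S \<Longrightarrow> invertible (P (\<theta> l) l)"
    "\<And>l. l \<in> S \<Longrightarrow> P (\<theta> l) l ** jacobian \<theta> (at l) + Q (\<theta> l) l = 0" "\<And>l. l \<in> S \<Longrightarrow> isCont \<theta> l"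
    using eventually_regular by metis
  define b where "b x = mk (\<theta> (snd x)) (snd x) (fst x)" for x :: "(real ^ 'q ^ 'p) \<times> (real ^ 'q)"
  define Fx where "Fx x = D_part (est f G P Q (b x))" for x
  have Fx: "Fx (X, l) = P (\<theta> l) l ** X + Q (\<theta> l) l" for X l by (simp add: Fx_def b_def est_mk)
  have "((\<lambda>x. (\<theta> (snd x), snd x, fst x)) has_derivative (\<lambda>h. (D0 *v snd h, snd h, fst h))) (at (D0, l0))"
    by (intro has_derivative_Pair diff_chain_at[where f=snd and g=\<theta>, unfolded o_def] bounded_linear_imp_has_derivative
        bounded_linear_fst bounded_linear_snd) (simp add: theta_derivative_l0)
  from bounded_linear.has_derivative[OF bounded_linear_mk this]
  have bd: "(b has_derivative (\<lambda>h. mk (D0 *v snd h) (snd h) (fst h))) (at (D0, l0))" by (simp add: b_def[abs_def])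
  have b0: "b (D0, l0) = \<alpha>0" by (simp add: b_def theta_l0 mk_t0)
  have "(est f G P Q has_derivative (*v) V) (at (b (D0, l0)))" using V_der by (simp add: b0)
  from bounded_linear.has_derivative[OF bounded_linear_parts(3) diff_chain_at[OF bd this]]
  have der: "(Fx has_derivative (\<lambda>h. D_part (V *v mk (D0 *v snd h) (snd h) (fst h)))) (at (D0, l0))"
    by (simp add: Fx_def[abs_def] o_def)
  have bc: "isCont b x" if "x \<in> UNIV \<times> S" for x
  proof -
    have "isCont (\<lambda>x. \<theta> (snd x)) x" using S(6)[of "snd x"] that by (intro isCont_o2[of x snd \<theta>] continuous_intros) auto
    then have "isCont (\<lambda>x. (\<theta> (snd x), snd x, fst x)) x" by (intro continuous_intros)
    from isCont_o2[OF this linear_continuous_at[OF bounded_linear_mk]] show ?thesis by (simp add: b_def[abs_def])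
  qed
  then have bcon: "continuous_on (UNIV \<times> S) b" by (intro continuous_at_imp_continuous_on) auto
  define S' where "S' = (UNIV \<times> S) \<inter> b -` U"
  have o: "open S'" unfolding S'_def
    by (rule continuous_open_preimage[OF bcon _ U(1)]) (simp add: S(1) open_Times)
  have m: "(D0, l0) \<in> S'" using S(2) U(2) by (simp add: S'_def b0)
  have c: "continuous_on S' Fx"
  proof (intro continuous_at_imp_continuous_on ballI)
    fix x assume x: "x \<in> S'"
    have "isCont (est f G P Q) (b x)" using x est_diff[of "b x"] by (simp add: S'_def differentiable_imp_continuous_within)
    from isCont_o2[OF bc this] x have "isCont (\<lambda>x. est f G P Q (b x)) x" by (simp add: S'_def)
    from isCont_o2[OF this linear_continuous_at[OF bounded_linear_parts(3)]] show "isCont Fx x" by (simp add: Fx_def[abs_def])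
  qed
  have z: "Fx (D0, l0) = 0" using root_parts(3) by (simp add: Fx theta_l0 lambda_part_root)
  have lin: "linear (\<lambda>X. matrix_inv P0 ** X)"
    by (rule bounded_linear.linear[OF bounded_bilinear.bounded_linear_right[OF bounded_bilinear_matrix_matrix]])
  \<comment> \<open>In directions \<open>(X, 0)\<close> both \<open>dP\<close> and \<open>dQ\<close>
    are evaluated at 0, which leaves \<open>P0 ** X\<close>.\<close>
  have inv: "matrix_inv P0 ** D_part (V *v mk (D0 *v snd (X, 0)) (snd (X, 0)) (fst (X, 0))) = X" for X
    using linear_0[OF bounded_linear.linear[OF has_derivative_bounded_linear[OF dP]]]
      linear_0[OF bounded_linear.linear[OF has_derivative_bounded_linear[OF dQ]]]
    by (simp add: D_part_V zero_prod_def matrix_inv_cancel[OF P0_invertible])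
  have uq: "\<forall>\<^sub>F l in nhds l0. \<forall>X. Fx (X, l) = 0 \<longrightarrow> X = jacobian \<theta> (at l)"
    unfolding eventually_nhds
  proof (intro exI[of _ S] conjI ballI allI impI S(1,2))
    fix l X assume l: "l \<in> S" and "Fx (X, l) = 0"
    then have "P (\<theta> l) l ** X = P (\<theta> l) l ** jacobian \<theta> (at l)"
      using S(5)[OF l] unfolding Fx by (metis add_right_cancel)
    then show "X = jacobian \<theta> (at l)" by (metis matrix_inv_cancel(3)[OF S(4)[OF l]])
  qed
  show ?thesis
    using has_derivative_implicit_root[OF der z o m c lin inv uq] by (auto simp: differentiable_def)
qed

text \<open>\<open>E\<close> is the derivative at \<open>l0\<close> of the Jacobian of \<theta>. It
  is left unspecified because both applications look only at the \<lambda>-component or eliminate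
  the third one.\<close>

lemma hessian_curve:
  obtains E where "\<And>w. V *v mk (D0 *v w) w (E w) = mk 0 (hessian (\<lambda>l. L (\<theta> l)) l0 *v w) 0"
proof -
  obtain S where S: "open S" "l0 \<in> S" "\<And>l. l \<in> S \<Longrightarrow> mk (\<theta> l) l D0 \<in> U"
    "\<And>l. l \<in> S \<Longrightarrow> P (\<theta> l) l ** jacobian \<theta> (at l) + Q (\<theta> l) l = 0"
    "\<And>l. l \<in> S \<Longrightarrow> GDERIV (\<lambda>l. L (\<theta> l)) l :> transpose (jacobian \<theta> (at l)) *v G (\<theta> l)"
    using eventually_regular by metis
  obtain E where E: "((\<lambda>l. jacobian \<theta> (at l)) has_derivative E) (at l0)"
    using jacobian_theta_differentiable unfolding differentiable_def by blast
  define b where "b l = mk (\<theta> l) l (jacobian \<theta> (at l))" for l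
  from bounded_linear.has_derivative[OF bounded_linear_mk has_derivative_Pair[OF theta_derivative_l0 has_derivative_Pair[OF has_derivative_ident E]]]
  have bd: "(b has_derivative (\<lambda>w. mk (D0 *v w) w (E w))) (at l0)" by (simp add: b_def[abs_def])
  have b0: "b l0 = \<alpha>0" by (simp add: b_def theta_l0 jacobian_theta mk_t0)
  have "(est f G P Q has_derivative (*v) V) (at (b l0))" using V_der by (simp add: b0)
  from diff_chain_at[OF bd this]
  have eb: "((\<lambda>l. est f G P Q (b l)) has_derivative (\<lambda>w. V *v mk (D0 *v w) w (E w))) (at l0)" by (simp add: o_def)
  have eq: "est f G P Q (b l) = mk 0 (grad (\<lambda>l. L (\<theta> l)) l) 0" if "l \<in> S" for l
    using grad_eqI[OF S(5)[OF that]] S(4)[OF that] f_root[of "\<theta> l" l] by (simp add: b_def est_mk)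
  have g: "((\<lambda>l. mk 0 (grad (\<lambda>l. L (\<theta> l)) l) 0) has_derivative (\<lambda>w. V *v mk (D0 *v w) w (E w))) (at l0)"
    by (rule has_derivative_transform_within_open[OF eb S(1,2)]) (rule eq)
  have "theta_part (V *v mk (D0 *v w) w (E w)) = 0" for w
    using fun_cong[OF has_derivative_unique[OF bounded_linear.has_derivative[OF bounded_linear_parts(1) g, unfolded parts_mk] has_derivative_const]] .
  moreover have "D_part (V *v mk (D0 *v w) w (E w)) = 0" for w
    using fun_cong[OF has_derivative_unique[OF bounded_linear.has_derivative[OF bounded_linear_parts(3) g, unfolded parts_mk] has_derivative_const]] .
  moreover have "lambda_part (V *v mk (D0 *v w) w (E w)) = hessian (\<lambda>l. L (\<theta> l)) l0 *v w" for w
    unfolding hessian_def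
    using jacobian_eqI[of "grad (\<lambda>l. L (\<theta> l))" _ l0 w] bounded_linear.has_derivative[OF bounded_linear_parts(2) g] by simp
  ultimately have "V *v mk (D0 *v w) w (E w) = mk 0 (hessian (\<lambda>l. L (\<theta> l)) l0 *v w) 0" for w
    by (simp add: parts_eq_iff)
  then show thesis by (rule that)
qed

text \<open>A null vector \<open>w\<close> of the Hessian would give a null vector of
  \<open>V\<close> with \<lambda>-part \<open>w\<close>.\<close>

lemma hessian_invertible: "invertible (hessian (\<lambda>l. L (\<theta> l)) l0)"
proof (rule invertible_injective)
  fix w assume w: "hessian (\<lambda>l. L (\<theta> l)) l0 *v w = 0"
  obtain E where E: "V *v mk (D0 *v w) w (E w) = mk 0 (hessian (\<lambda>l. L (\<theta> l)) l0 *v w) 0" using hessian_curve by metis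
  then have "V *v mk (D0 *v w) w (E w) = 0" using w by (simp add: mk_zero)
  then have "mk (D0 *v w) w (E w) = 0" using matrix_inv_cancel(1)[OF V_inv, of "mk (D0 *v w) w (E w)"] by simp
  from arg_cong[OF this, of lambda_part] show "w = 0" by (simp only: parts_mk parts_linear)
qed

end

lemma sum_UNIV_Plus: "(\<Sum>k\<in>UNIV. h k) = (\<Sum>i\<in>UNIV. h (Inl i)) + (\<Sum>j\<in>UNIV. h (Inr j))"
  for h :: "'a::finite + 'b::finite \<Rightarrow> real"
  by (simp add: UNIV_Plus_UNIV[symmetric] sum.Plus del: UNIV_Plus_UNIV)

lemma hcat3_mult: "hcat3 A B C *v stack3 x y z = A *v x + B *v y + C *v z"
  by (simp add: vec_eq_iff hcat3_def stack3_def matrix_vector_mult_def sum_UNIV_Plus)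

lemma block_diag_row_mult: "(block_diag_row r *v vec_cols Y) $ j = r \<bullet> column j Y"
proof -
  have "(block_diag_row r *v vec_cols Y) $ j = (\<Sum>(j', i)\<in>UNIV \<times> UNIV. (if j' = j then r $ i else 0) * Y $ i $ j')"
    by (simp add: block_diag_row_def vec_cols_def matrix_vector_mult_def case_prod_unfold)
  also have "\<dots> = (\<Sum>j'\<in>UNIV. \<Sum>i\<in>UNIV. (if j' = j then r $ i else 0) * Y $ i $ j')"
    by (rule sum.cartesian_product[symmetric])
  also have "\<dots> = (\<Sum>j'\<in>UNIV. if j' = j then \<Sum>i\<in>UNIV. r $ i * Y $ i $ j else 0)"
    by (rule sum.cong) auto
  also have "\<dots> = r \<bullet> column j Y" by (simp add: inner_vec_def column_def)
  finally show ?thesis .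
qed

lemma column_add: "column j (A + B) = column j A + column j B"
  by (simp add: column_def vec_eq_iff)

lemma column_mult: "column j (A ** B) = A *v column j B"
  by (simp add: column_def vec_eq_iff matrix_vector_mult_def matrix_matrix_mult_def)

section \<open>Identification of the matrices in the statement and inversion of
  \<open>V\<close>\<close>

context estimating_system
begin

lemma partial_t: "open {t. mk t l0 D0 \<in> U}" "t0 \<in> {t. mk t l0 D0 \<in> U}"
    "mk t l0 D0 \<in> U \<Longrightarrow> ((\<lambda>t. f t l0) has_derivative (*v) (P t l0)) (at t)"
  and partial_l: "open {l. mk t0 l D0 \<in> U}" "l0 \<in> {l. mk t0 l D0 \<in> U}"
    "mk t0 l D0 \<in> U \<Longrightarrow> ((\<lambda>t. f t l) has_derivative (*v) (P t0 l)) (at t0)"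
proof -
  have pt: "((\<lambda>t. f t l) has_derivative (*v) (P t l)) (at t)" if "mk t l D0 \<in> U" for t l
  proof -
    have "((\<lambda>t. (t, l)) has_derivative (\<lambda>u. (u, 0))) (at t)" by (auto intro!: derivative_eq_intros)
    from diff_chain_at[OF this f_der[OF that, unfolded parts_mk]] show ?thesis by (simp add: o_def)
  qed
  show "mk t l0 D0 \<in> U \<Longrightarrow> ((\<lambda>t. f t l0) has_derivative (*v) (P t l0)) (at t)"
    "mk t0 l D0 \<in> U \<Longrightarrow> ((\<lambda>t. f t l) has_derivative (*v) (P t0 l)) (at t0)" by (rule pt; assumption)+
  show "t0 \<in> {t. mk t l0 D0 \<in> U}" "l0 \<in> {l. mk t0 l D0 \<in> U}" using U(2) by (simp_all add: mk_t0)
  have "open ((\<lambda>t. (t, l0)) -` {(t, l). mk t l D0 \<in> U})"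
    by (intro open_vimage f_continuous(1) continuous_intros)
  then show "open {t. mk t l0 D0 \<in> U}" by (simp add: vimage_def)
  have "open ((\<lambda>l. (t0, l)) -` {(t, l). mk t l D0 \<in> U})"
    by (intro open_vimage f_continuous(1) continuous_intros)
  then show "open {l. mk t0 l D0 \<in> U}" by (simp add: vimage_def)
qed

lemma jacobian_f: "jacobian (\<lambda>t. f t l0) (at t0) = P0"
  using jacobian_eq_matrixI[OF partial_t(3)[of t0]] U(2) by (simp add: mk_t0 lambda_part_root)

lemma grad_L: "grad L t0 = G t0"
  by (rule grad_eqI[OF L_der[OF U(2)]])

lemma hessian_L: "hessian L t0 = jacobian G (at t0)"
  unfolding hessian_def
proof (rule jacobian_eq_matrixI, rule has_derivative_transform_within_open[OF _ partial_t(1,2)])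
  show "(G has_derivative (*v) (jacobian G (at t0))) (at t0)" using G_diff jacobian_works by blast
  show "G t = grad L t" if "t \<in> {t. mk t l0 D0 \<in> U}" for t
    using that grad_eqI[OF L_der[of "mk t l0 D0"]] by simp
qed

lemma bounded_linear_dP: "bounded_linear dP"
  by (rule has_derivative_bounded_linear[OF dP])

lemma P_partial_t: "((\<lambda>t. P t l0) has_derivative (\<lambda>u. dP (u, 0))) (at t0)"
proof -
  have "((\<lambda>t. (t, l0)) has_derivative (\<lambda>u. (u, 0))) (at t0)" by (auto intro!: derivative_eq_intros)
  from diff_chain_at[OF this dP] show ?thesis by (simp add: o_def)
qed

lemma P_partial_l: "(P t0 has_derivative (\<lambda>w. dP (0, w))) (at l0)"
proof -
  have "((\<lambda>l. (t0, l)) has_derivative (\<lambda>w. (0, w))) (at l0)" by (auto intro!: derivative_eq_intros)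
  from diff_chain_at[OF this dP] show ?thesis by (simp add: o_def)
qed

text \<open>On a neighbourhood of \<open>t0\<close> the gradient of the k-th component of
  \<open>f\<close> is the k-th row of \<open>P\<close>, so its Hessian is the k-th row of the
  derivative of \<open>P\<close>.\<close>

lemma hessian_f: "hessian (\<lambda>t. f t l0 $ k) t0 *v u = dP (u, 0) $ k"
  unfolding hessian_def
proof (rule jacobian_eqI, rule has_derivative_transform_within_open[OF _ partial_t(1,2)])
  show "((\<lambda>t. P t l0 $ k) has_derivative (\<lambda>u. dP (u, 0) $ k)) (at t0)"
    by (rule bounded_linear.has_derivative[OF bounded_linear_vec_nth P_partial_t])
  show "P t l0 $ k = grad (\<lambda>t. f t l0 $ k) t" if "t \<in> {t. mk t l0 D0 \<in> U}" for t
  proof -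
    have "((\<lambda>t. f t l0 $ k) has_derivative (\<lambda>h. (P t l0 *v h) $ k)) (at t)"
      using that by (intro bounded_linear.has_derivative[OF bounded_linear_vec_nth partial_t(3)]) simp
    then have "GDERIV (\<lambda>t. f t l0 $ k) t :> P t l0 $ k" by (simp add: gderiv_iff matrix_vector_mul_component)
    then show ?thesis using grad_eqI by metis
  qed
qed

lemma jacobian_partial_l: "frechet_derivative (\<lambda>l. jacobian (\<lambda>t. f t l) (at t0)) (at l0) = (\<lambda>w. dP (0, w))"
proof (rule frechet_derivative_at[symmetric], rule has_derivative_transform_within_open[OF _ partial_l(1,2)])
  show "(P t0 has_derivative (\<lambda>w. dP (0, w))) (at l0)" by (rule P_partial_l)
  show "P t0 l = jacobian (\<lambda>t. f t l) (at t0)" if "l \<in> {l. mk t0 l D0 \<in> U}" for l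
    using that jacobian_eq_matrixI[OF partial_l(3)[of l]] by simp
qed

text \<open>Symmetry of mixed partials for each component of \<open>f\<close>, with one direction
  purely in \<theta> and the other purely in \<lambda>. It reconciles \<open>Wj\<close>, which
  differentiates \<open>P\<close> in \<lambda>, with \<open>V\<close>, which differentiates
  \<open>Q\<close> in \<theta>.\<close>

lemma dP_dQ: "dP (0, w) *v u = dQ (u, 0) *v w"
proof -
  have "(dP (0, w) *v u) $ k = (dQ (u, 0) *v w) $ k" for k
  proof -
    define f' where "f' x h = (P (fst x) (snd x) *v fst h + Q (fst x) (snd x) *v snd h) $ k" for x h
    have d: "\<forall>\<^sub>F x in nhds (t0, l0). ((\<lambda>x. f (fst x) (snd x) $ k) has_derivative f' x) (at x)"
      unfolding eventually_nhds
    proof (intro exI[of _ "{(t, l). mk t l D0 \<in> U}"] conjI ballI f_continuous(1))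
      show "(t0, l0) \<in> {(t, l). mk t l D0 \<in> U}" using U(2) by (simp add: mk_t0)
      fix x assume "x \<in> {(t, l). mk t l D0 \<in> U}"
      then have "mk (fst x) (snd x) D0 \<in> U" by auto
      from bounded_linear.has_derivative[OF bounded_linear_vec_nth f_der[OF this]]
      show "((\<lambda>x. f (fst x) (snd x) $ k) has_derivative f' x) (at x)"
        by (simp add: f'_def[abs_def] case_prod_unfold)
    qed
    have mv: "bounded_linear (\<lambda>A. (A *v v) $ k)" for v :: "real ^ 'n" and k :: "'m::finite"
      by (rule bounded_linear_compose[OF bounded_linear_vec_nth
          bounded_bilinear.bounded_linear_left[OF bounded_bilinear_matrix_vector]])
    have A: "((\<lambda>x. f' x (u, 0)) has_derivative (\<lambda>h. (dP h *v u) $ k)) (at (t0, l0))"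
      unfolding f'_def using bounded_linear.has_derivative[OF mv dP, of u k] by simp
    have B: "((\<lambda>x. f' x (0, w)) has_derivative (\<lambda>h. (dQ h *v w) $ k)) (at (t0, l0))"
      unfolding f'_def using bounded_linear.has_derivative[OF mv dQ, of w k] by simp
    show ?thesis using mixed_partials_symmetric[OF d A B] .
  qed
  then show ?thesis by (simp add: vec_eq_iff)
qed

text \<open>Invertibility of \<open>P0\<close> in quantitative form: moving \<open>D\<close> alone
  moves the third block of the linearised system proportionally. This excludes singular empirical
  matrices near \<open>\<alpha>0\<close>.\<close>

lemma D_part_V_bounded_below:
  obtains p0 where "p0 > 0" "\<And>X. p0 * norm (mk 0 0 X) \<le> norm (D_part (V *v mk 0 0 X))"
proof -
  have lin: "linear (\<lambda>X :: real ^ 'q ^ 'p. P0 ** X)"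
    by (rule bounded_linear.linear[OF bounded_bilinear.bounded_linear_right[OF bounded_bilinear_matrix_matrix]])
  have "inj (\<lambda>X :: real ^ 'q ^ 'p. P0 ** X)" by (metis injI matrix_inv_cancel(3)[OF P0_invertible])
  then obtain B where B: "B > 0" "\<And>X :: real ^ 'q ^ 'p. B * norm X \<le> norm (P0 ** X)"
    using linear_inj_bounded_below_pos[OF lin] by blast
  obtain C where C: "C > 0" "\<And>x :: (real ^ 'p) \<times> (real ^ 'q) \<times> (real ^ 'q ^ 'p). norm (mk (fst x) (fst (snd x)) (snd (snd x))) \<le> norm x * C"
    using bounded_linear.pos_bounded[OF bounded_linear_mk] by blast
  have "(B / C) * norm (mk 0 0 X :: real ^ ('p + 'q + 'q \<times> 'p)) \<le> norm (D_part (V *v mk 0 0 X))" for X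
  proof -
    have "norm (mk 0 0 X :: real ^ ('p + 'q + 'q \<times> 'p)) \<le> norm X * C" using C(2)[of "(0, 0, X)"] by simp
    then have "(B / C) * norm (mk 0 0 X :: real ^ ('p + 'q + 'q \<times> 'p)) \<le> (B / C) * (norm X * C)"
      using B(1) C(1) by (intro mult_left_mono) auto
    also have "\<dots> = B * norm X" using C(1) by simp
    also have "\<dots> \<le> norm (P0 ** X)" by (rule B(2))
    finally show ?thesis
      using linear_0[OF bounded_linear.linear[OF bounded_linear_dP]] linear_0[OF has_derivative_linear[OF dQ]]
      by (simp add: D_part_V zero_prod_def)
  qed
  then show thesis using that[of "B / C"] B(1) C(1) by simp
qed

text \<open>Solve \<open>V *v mk x w X = mk u v Y\<close> by blocks. The first block gives
  \<open>x = D *v w - matrix_inv J *v u\<close>; the third gives the columns of \<open>X\<close>;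
  inserted into the second they leave \<open>S *v x + \<Lambda> w = v + Mb *v vec_cols Y\<close>.
  Replacing \<open>x\<close> makes \<open>S *v (D *v w) + \<Lambda> w\<close> appear, which is
  \<open>Z1 *v w\<close>.\<close>

lemma
  fixes D Z1 Z2 J b Wj W Mb A1 A3 Astar
  assumes D: "D = jacobian \<theta> (at l0)"
    and Z1: "Z1 = hessian (\<lambda>l. L (\<theta> l)) l0"
    and Z2: "Z2 = hessian L (\<theta> l0)"
    and J: "J = - jacobian (\<lambda>t. f t l0) (at (\<theta> l0))"
    and b: "b = grad L (\<theta> l0)"
    and Wj: "\<And>j. Wj j = (\<chi> k. column j D v* hessian (\<lambda>t. f t l0 $ k) (\<theta> l0)) +
          frechet_derivative (\<lambda>l. jacobian (\<lambda>t. f t l) (at (\<theta> l0))) (at l0) (axis j 1)"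
    and W: "W = (\<chi> j. (b v* matrix_inv J) v* Wj j)"
    and Mb: "Mb = block_diag_row (b v* matrix_inv J)"
    and A1: "A1 = matrix_inv J - D ** matrix_inv Z1 ** (transpose D ** Z2 + W) ** matrix_inv J"
    and A3: "A3 = - (D ** matrix_inv Z1 ** Mb)"
    and Astar: "Astar = hcat3 A1 (- (D ** matrix_inv Z1)) A3"
  shows J_invertible: "invertible J" and Z1_invertible: "invertible Z1"
    and root_eq: "\<alpha>0 = stack3 (\<theta> l0) l0 (vec_cols D)"
    and influence: "theta_part (matrix_inv V *v y) = - (Astar *v y)"
proof -
  have D0: "D = D0" by (simp add: D jacobian_theta)
  have J0: "J = - P0" by (simp add: J theta_l0 jacobian_f)
  have b0: "b = G t0" by (simp add: b theta_l0 grad_L)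
  have Z20: "Z2 = jacobian G (at t0)" by (simp add: Z2 theta_l0 hessian_L)
  show "\<alpha>0 = stack3 (\<theta> l0) l0 (vec_cols D)" by (simp add: D0 theta_l0 mk_t0)
  have P0J: "P0 *v x = - (J *v x)" for x by (simp add: J0 uminus_matrix_vector)
  show J_inv: "invertible J"
  proof (rule invertible_injective)
    fix x assume "J *v x = 0"
    then have "P0 *v x = 0" by (simp add: P0J)
    then show "x = 0" using matrix_inv_cancel(1)[OF P0_invertible, of x] by simp
  qed
  show Z_inv: "invertible Z1" unfolding Z1 by (rule hessian_invertible)
  define r where "r = b v* matrix_inv J"
  define S where "S = transpose D ** Z2 + W"
  \<comment> \<open>\<open>Wj j\<close> is the derivative in \<theta> of column \<open>j\<close> of
    the third block at fixed \<open>D\<close>: the Hessians supply the part from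
    \<open>P ** D\<close>, and the mixed partials are exchanged to supply the part from
    \<open>Q\<close>.\<close>
  have Wj_mult: "Wj j *v u = column j (dP (u, 0) ** D + dQ (u, 0))" for j u
  proof -
    have "(Wj j *v u) $ k = column j (dP (u, 0) ** D + dQ (u, 0)) $ k" for k
    proof -
      have "(Wj j *v u) $ k = column j D \<bullet> (hessian (\<lambda>t. f t l0 $ k) t0 *v u) + dP (0, axis j 1) $ k \<bullet> u"
        by (simp add: Wj matrix_vector_mul_component theta_l0 jacobian_partial_l inner_add_left dot_lmul_matrix)
      also have "dP (0, axis j 1) $ k \<bullet> u = (dQ (u, 0) *v axis j 1) $ k"
        by (simp add: dP_dQ[symmetric] matrix_vector_mul_component)
      finally show ?thesis
        by (simp add: hessian_f column_add column_mult matrix_vector_mult_basis matrix_vector_mul_component inner_commute)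
    qed
    then show ?thesis by (simp add: vec_eq_iff)
  qed
  have Wr: "(W *v x) $ j = r \<bullet> (Wj j *v x)" for x j
    by (simp add: W r_def matrix_vector_mul_component dot_lmul_matrix)
  \<comment> \<open>The contribution of the derivatives in \<lambda>. It has no counterpart in the
    statement; it enters the result only inside \<open>Z1\<close>.\<close>
  define \<Lambda> where "\<Lambda> w = (\<chi> j. r \<bullet> column j (dP (0, w) ** D + dQ (0, w)))" for w
  have key: "S *v x + \<Lambda> w = v + Mb *v vec_cols Y" "x = D *v w - matrix_inv J *v u"
    if eq: "V *v mk x w X = mk u v Y" for x w X u v Y
  proof -
    have e1: "P0 *v x + Q0 *v w = u" using theta_part_V[of x w X] eq by simp
    have e2: "transpose D *v (Z2 *v x) + transpose X *v b = v" using lambda_part_V[of x w X] eq by (simp add: D0 Z20 b0)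
    have e3: "dP (x, w) ** D + dQ (x, w) + P0 ** X = Y" using D_part_V[of x w X] eq by (simp add: D0)
    have "J *v (x - D *v w) = - u"
      using e1 unfolding Q0_eq J0
      by (simp add: D0 uminus_matrix_vector matrix_vector_mult_diff_distrib matrix_vector_mul_assoc[symmetric] algebra_simps)
    then have "x - D *v w = matrix_inv J *v (- u)" by (metis matrix_inv_cancel(1)[OF J_inv])
    then show "x = D *v w - matrix_inv J *v u"
      by (simp add: linear_neg[OF matrix_vector_mul_linear] algebra_simps)
    have "(S *v x + \<Lambda> w) $ j = (v + Mb *v vec_cols Y) $ j" for j
    proof -
      have spl: "dP (x, w) = dP (x, 0) + dP (0, w)" "dQ (x, w) = dQ (x, 0) + dQ (0, w)"
        using linear_add[OF bounded_linear.linear[OF bounded_linear_dP], of "(x, 0)" "(0, w)"]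
          linear_add[OF has_derivative_linear[OF dQ], of "(x, 0)" "(0, w)"] by simp_all
      have "dP (x, w) ** D + dQ (x, w) = (dP (x, 0) ** D + dQ (x, 0)) + (dP (0, w) ** D + dQ (0, w))"
        unfolding spl by (simp add: bounded_bilinear.add_left[OF bounded_bilinear_matrix_matrix] algebra_simps)
      then have "column j Y = Wj j *v x + column j (dP (0, w) ** D + dQ (0, w)) - J *v column j X"
        unfolding e3[symmetric] by (simp add: column_add column_mult Wj_mult P0J)
      then have "J *v column j X = Wj j *v x + column j (dP (0, w) ** D + dQ (0, w)) - column j Y" by simp
      then have "column j X = matrix_inv J *v (Wj j *v x + column j (dP (0, w) ** D + dQ (0, w)) - column j Y)"
        by (metis matrix_inv_cancel(1)[OF J_inv])
      then have "b \<bullet> column j X = r \<bullet> (Wj j *v x + column j (dP (0, w) ** D + dQ (0, w)) - column j Y)"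
        by (simp add: r_def dot_lmul_matrix)
      moreover have "(transpose X *v b) $ j = b \<bullet> column j X"
        by (simp add: matrix_vector_mul_component row_transpose[symmetric] row_def transpose_def column_def inner_commute)
      moreover have "(Mb *v vec_cols Y) $ j = r \<bullet> column j Y" by (simp add: Mb r_def block_diag_row_mult)
      moreover have "(S *v x) $ j = (transpose D *v (Z2 *v x)) $ j + r \<bullet> (Wj j *v x)"
        by (simp add: S_def matrix_vector_mult_add_rdistrib matrix_vector_mul_assoc Wr)
      ultimately show ?thesis unfolding e2[symmetric] by (simp add: \<Lambda>_def inner_add_right inner_diff_right)
    qed
    then show "S *v x + \<Lambda> w = v + Mb *v vec_cols Y" by (simp add: vec_eq_iff)
  qed
  \<comment> \<open>The curve of \<open>hessian_curve\<close> solves the same equations with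
    \<open>u = 0\<close>, \<open>v = Z1 *v w\<close> and \<open>Y = 0\<close>, so \<open>key\<close>
    evaluates \<open>Z1\<close> in terms of \<open>S\<close> and \<Lambda>.\<close>
  have Z1_eq: "Z1 *v w = S *v (D *v w) + \<Lambda> w" for w
  proof -
    obtain E where E: "V *v mk (D *v w) w (E w) = mk 0 (Z1 *v w) 0"
      using hessian_curve unfolding Z1 D0 by metis
    have "vec_cols (0 :: real ^ 'q ^ 'p) = 0" by (simp add: vec_cols_def vec_eq_iff)
    then show ?thesis using key(1)[OF E] by simp
  qed
  define \<beta> where "\<beta> = matrix_inv V *v y"
  obtain u v Y where y: "y = mk u v Y" using mk_parts by metis
  have "V *v mk (theta_part \<beta>) (lambda_part \<beta>) (D_part \<beta>) = mk u v Y"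
    by (simp add: \<beta>_def matrix_inv_cancel[OF V_inv] y)
  note k = key[OF this]
  define w where "w = lambda_part \<beta>"
  have "Z1 *v w = v + Mb *v vec_cols Y + S *v (matrix_inv J *v u)"
    using k unfolding Z1_eq w_def[symmetric] by (simp add: matrix_vector_mult_diff_distrib algebra_simps)
  then have "w = matrix_inv Z1 *v (v + Mb *v vec_cols Y + S *v (matrix_inv J *v u))"
    by (metis matrix_inv_cancel(1)[OF Z_inv])
  then have "theta_part \<beta> = D *v (matrix_inv Z1 *v (v + Mb *v vec_cols Y + S *v (matrix_inv J *v u))) - matrix_inv J *v u"
    using k(2) by (simp add: w_def)
  also have "\<dots> = - (Astar *v y)"
    unfolding Astar y hcat3_mult A1 A3 S_def[symmetric]
    by (simp add: matrix_vector_mult_diff_rdistrib uminus_matrix_vector matrix_vector_right_distrib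
        matrix_vector_mul_assoc[symmetric])
  finally show "theta_part (matrix_inv V *v y) = - (Astar *v y)" by (simp add: \<beta>_def)
qed

end

section \<open>Roots of the empirical system\<close>

lemma (in prob_space) likely_finite_conj:
  assumes "finite I" "\<And>i \<epsilon>. i \<in> I \<Longrightarrow> \<epsilon> > 0 \<Longrightarrow> likely M \<epsilon> (A i)" "\<epsilon> > 0"
  shows "likely M \<epsilon> (\<lambda>n \<omega>. \<forall>i\<in>I. A i n \<omega>)"
  using assms
proof (induction I arbitrary: \<epsilon>)
  case empty
  show ?case unfolding likely_def
    by (rule always_eventually) (use \<open>\<epsilon> > 0\<close> prob_space in \<open>auto intro!: bexI[of _ "space M"]\<close>)
next
  case (insert i I)
  have "likely M (\<epsilon> / 2 + \<epsilon> / 2) (\<lambda>n \<omega>. A i n \<omega> \<and> (\<forall>i\<in>I. A i n \<omega>))"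
    using insert by (intro likely_conj insert.IH) auto
  then show ?case by (simp add: ball_insert)
qed

lemma sample_mean_bounded_linear:
  assumes "bounded_linear h"
  shows "sample_mean Z n \<omega> (\<lambda>z. h (g z)) = h (sample_mean Z n \<omega> g)"
  unfolding sample_mean_def
  by (simp add: linear_scale[OF bounded_linear.linear[OF assms]] linear_sum[OF bounded_linear.linear[OF assms]])

lemma sample_mean_add: "sample_mean Z n \<omega> (\<lambda>z. g z + h z) = sample_mean Z n \<omega> g + sample_mean Z n \<omega> h"
  by (simp add: sample_mean_def sum.distrib scaleR_add_right)

lemma sample_mean_diff: "sample_mean Z n \<omega> (\<lambda>z. g z - h z) = sample_mean Z n \<omega> g - sample_mean Z n \<omega> h"
  by (simp add: sample_mean_def sum_subtractf scaleR_diff_right)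

lemma norm_sample_mean_le:
  assumes "\<And>z. norm (g z) \<le> h z"
  shows "norm (sample_mean Z n \<omega> g) \<le> sample_mean Z n \<omega> h"
  unfolding sample_mean_def norm_scaleR
  using assms by (auto intro!: divide_right_mono sum_norm_le)

text \<open>Uniformity in \<open>x\<close> reduces to finitely many laws of large numbers: one for
  the remainder envelope \<open>r\<close>, whose mean is at most \<open>c / 4\<close>, and one for
  the derivative at \<open>a\<close> in each basis direction. The ball does not depend on
  \<epsilon>.\<close>

lemma (in iid_sample) uniform_linearization:
  fixes g :: "'z \<Rightarrow> 'a::euclidean_space \<Rightarrow> 'b::euclidean_space"
  assumes U: "open U" "a \<in> U"
    and int: "\<And>x. x \<in> U \<Longrightarrow> integrable F (\<lambda>z. g z x)"
    and der: "\<And>x z. x \<in> U \<Longrightarrow> (g z has_derivative g' z x) (at x)"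
    and bd: "\<And>x z v. x \<in> U \<Longrightarrow> norm (g' z x v) \<le> h z * norm v"
    and h: "integrable F h" "integrable F (\<lambda>z. (h z)\<^sup>2)" and "c > 0"
  obtains \<delta> where "\<delta> > 0" "cball a \<delta> \<subseteq> U"
    "\<And>\<epsilon>. \<epsilon> > 0 \<Longrightarrow> likely M \<epsilon> (\<lambda>n \<omega>. \<forall>x\<in>cball a \<delta>.
      norm (sample_mean Z n \<omega> (\<lambda>z. g z x) - sample_mean Z n \<omega> (\<lambda>z. g z a) - (\<integral>z. g' z a (x - a) \<partial>F)) \<le> c * norm (x - a))"
proof -
  obtain \<delta> r where r: "\<delta> > 0" "cball a \<delta> \<subseteq> U" "r \<in> borel_measurable F"
    "\<And>z. 0 \<le> r z" "\<And>z. r z \<le> 2 * h z" "(\<integral>z. r z \<partial>F) \<le> c / 4"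
    "\<And>z x. x \<in> cball a \<delta> \<Longrightarrow> norm (g z x - g z a - g' z a (x - a)) \<le> r z * norm (x - a)"
    using dominated_remainder[OF U int der bd h(1), of "c / 4"] \<open>c > 0\<close> by (metis divide_pos_pos zero_less_numeral)
  have r2: "integrable F (\<lambda>z. (norm (r z))\<^sup>2)"
  proof (rule Bochner_Integration.integrable_bound)
    show "integrable F (\<lambda>z. 4 * (h z)\<^sup>2)" using h(2) by simp
    show "(\<lambda>z. (norm (r z))\<^sup>2) \<in> borel_measurable F" using r(3) by measurable
    have "(r z)\<^sup>2 \<le> (2 * h z)\<^sup>2" for z using r(4,5) by (intro power_mono)
    then show "AE z in F. norm ((norm (r z))\<^sup>2) \<le> norm (4 * (h z)\<^sup>2)" by (simp add: power_mult_distrib)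
  qed
  have i': "integrable F (\<lambda>z. g' z a v)" for v
    using integrable_derivative_dominated[OF U int der[OF U(2)] bd[OF U(2)] h(1)] .
  have i2: "integrable F (\<lambda>z. (norm (g' z a v))\<^sup>2)" for v
  proof (rule Bochner_Integration.integrable_bound)
    show "integrable F (\<lambda>z. (norm v)\<^sup>2 * (h z)\<^sup>2)" using h(2) by simp
    show "(\<lambda>z. (norm (g' z a v))\<^sup>2) \<in> borel_measurable F" using i'[of v] by (simp add: borel_measurable_integrable)
    have "(norm (g' z a v))\<^sup>2 \<le> (h z * norm v)\<^sup>2" for z using bd[OF U(2)] by (intro power_mono) auto
    then show "AE z in F. norm ((norm (g' z a v))\<^sup>2) \<le> norm ((norm v)\<^sup>2 * (h z)\<^sup>2)" by (simp add: power_mult_distrib mult.commute)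
  qed
  have lin: "bounded_linear (g' z a)" for z using der[OF U(2)] by (rule has_derivative_bounded_linear)
  \<comment> \<open>Summed over the basis, errors of size \<open>d\<close> contribute
    \<open>c / 4\<close>; the envelope contributes its mean plus deviation, at most
    \<open>c / 2\<close>.\<close>
  define d where "d = c / (4 * real DIM('a))"
  have d: "d > 0" using \<open>c > 0\<close> by (simp add: d_def)
  have "likely M \<epsilon> (\<lambda>n \<omega>. \<forall>x\<in>cball a \<delta>.
      norm (sample_mean Z n \<omega> (\<lambda>z. g z x) - sample_mean Z n \<omega> (\<lambda>z. g z a) - (\<integral>z. g' z a (x - a) \<partial>F)) \<le> c * norm (x - a))"
    if "\<epsilon> > 0" for \<epsilon>
  proof (rule likely_mono)
    show "likely M (\<epsilon> / 2 + \<epsilon> / 2) (\<lambda>n \<omega>. (\<forall>b\<in>Basis. norm (sample_mean Z n \<omega> (\<lambda>z. g' z a b) - (\<integral>z. g' z a b \<partial>F)) \<le> d) \<and>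
      norm (sample_mean Z n \<omega> r - (\<integral>z. r z \<partial>F)) \<le> c / 4)"
      using that d \<open>c > 0\<close>
      by (intro likely_conj likely_finite_conj sample_mean_likely_near r r2 i2 finite_Basis borel_measurable_integrable i') auto
    show "\<forall>\<^sub>F n in sequentially. \<forall>\<omega>\<in>space M. (\<forall>b\<in>Basis. norm (sample_mean Z n \<omega> (\<lambda>z. g' z a b) - (\<integral>z. g' z a b \<partial>F)) \<le> d) \<and>
      norm (sample_mean Z n \<omega> r - (\<integral>z. r z \<partial>F)) \<le> c / 4 \<longrightarrow>
      (\<forall>x\<in>cball a \<delta>. norm (sample_mean Z n \<omega> (\<lambda>z. g z x) - sample_mean Z n \<omega> (\<lambda>z. g z a) - (\<integral>z. g' z a (x - a) \<partial>F)) \<le> c * norm (x - a))"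
    proof (intro always_eventually allI ballI impI)
      fix n \<omega> x assume H: "(\<forall>b\<in>Basis. norm (sample_mean Z n \<omega> (\<lambda>z. g' z a b) - (\<integral>z. g' z a b \<partial>F)) \<le> d) \<and>
        norm (sample_mean Z n \<omega> r - (\<integral>z. r z \<partial>F)) \<le> c / 4" and x: "x \<in> cball a \<delta>"
      define v where "v = x - a"
      have g'v: "g' z a v = (\<Sum>b\<in>Basis. (v \<bullet> b) *\<^sub>R g' z a b)" for z
        by (subst euclidean_representation[of v, symmetric])
          (simp only: linear_sum[OF bounded_linear.linear[OF lin]] linear_scale[OF bounded_linear.linear[OF lin]])
      have m: "sample_mean Z n \<omega> (\<lambda>z. g' z a v) = (\<Sum>b\<in>Basis. (v \<bullet> b) *\<^sub>R sample_mean Z n \<omega> (\<lambda>z. g' z a b))"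
        unfolding g'v sample_mean_def
        by (simp add: scaleR_sum_right sum.swap[of _ Basis] mult.commute)
      have "(\<integral>z. g' z a v \<partial>F) = (\<Sum>b\<in>Basis. (v \<bullet> b) *\<^sub>R (\<integral>z. g' z a b \<partial>F))"
        unfolding g'v using i' by (simp add: Bochner_Integration.integral_sum)
      then have "norm (sample_mean Z n \<omega> (\<lambda>z. g' z a v) - (\<integral>z. g' z a v \<partial>F))
        = norm (\<Sum>b\<in>Basis. (v \<bullet> b) *\<^sub>R (sample_mean Z n \<omega> (\<lambda>z. g' z a b) - (\<integral>z. g' z a b \<partial>F)))"
        unfolding m by (simp add: sum_subtractf scaleR_diff_right)
      also have "\<dots> \<le> (\<Sum>b\<in>(Basis :: 'a set). norm v * d)"
        using H d Basis_le_norm[of _ v] by (intro sum_norm_le) (auto intro!: mult_mono)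
      also have "\<dots> = c / 4 * norm v" by (simp add: d_def)
      finally have 1: "norm (sample_mean Z n \<omega> (\<lambda>z. g' z a v) - (\<integral>z. g' z a v \<partial>F)) \<le> c / 4 * norm v" .
      have "norm (sample_mean Z n \<omega> (\<lambda>z. g z x - g z a - g' z a v)) \<le> sample_mean Z n \<omega> (\<lambda>z. r z * norm v)"
        unfolding v_def by (rule norm_sample_mean_le[OF r(7)[OF x]])
      also have "\<dots> = sample_mean Z n \<omega> r * norm v"
        by (rule sample_mean_bounded_linear[OF bounded_linear_mult_left])
      also have "\<dots> \<le> (c / 2) * norm v"
      proof (rule mult_right_mono)
        show "sample_mean Z n \<omega> r \<le> c / 2" using H r(6) unfolding real_norm_def by linarith
      qed simp
      finally have 2: "norm (sample_mean Z n \<omega> (\<lambda>z. g z x) - sample_mean Z n \<omega> (\<lambda>z. g z a) - sample_mean Z n \<omega> (\<lambda>z. g' z a v)) \<le> (c / 2) * norm v"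
        by (simp only: sample_mean_diff)
      have "norm ((A - B - D') + (D' - E)) \<le> c / 2 * norm v + c / 4 * norm v"
        if "norm (A - B - D') \<le> c / 2 * norm v" "norm (D' - E) \<le> c / 4 * norm v" for A B D' E :: 'b
        using that by (rule norm_triangle_mono)
      from this[OF 2 1] have "norm (sample_mean Z n \<omega> (\<lambda>z. g z x) - sample_mean Z n \<omega> (\<lambda>z. g z a) - (\<integral>z. g' z a v \<partial>F)) \<le> c / 2 * norm v + c / 4 * norm v"
        by simp
      also have "\<dots> \<le> c * norm v" using \<open>c > 0\<close> by (simp add: distrib_right[symmetric] mult_right_mono)
      finally show "norm (sample_mean Z n \<omega> (\<lambda>z. g z x) - sample_mean Z n \<omega> (\<lambda>z. g z a) - (\<integral>z. g' z a (x - a) \<partial>F)) \<le> c * norm (x - a)"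
        by (simp add: v_def)
    qed
  qed simp
  then show thesis using that r(1,2) by blast
qed

text \<open>Deterministic: it concerns one sample for which the linearisation holds. Its root
  satisfies the estimating equation and, once \<open>P\<close> is known to be invertible there, the
  gradient equation with right-hand side \<open>r\<close>; uniqueness then makes its \<lambda>-part
  \<open>lh\<close> and its \<theta>-part \<open>\<theta> lh\<close>.\<close>

lemma sample_root:
  fixes f :: "real ^ 'p \<Rightarrow> real ^ 'q \<Rightarrow> real ^ 'p"
    and V :: "real ^ ('p + 'q + 'q \<times> 'p) ^ ('p + 'q + 'q \<times> 'p)"
  assumes f_der: "\<And>t l. ((\<lambda>(t, l). f t l) has_derivative (\<lambda>(u, w). P t l *v u + Q t l *v w)) (at (t, l))"
    and L_der: "\<And>t. GDERIV L t :> G t"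
    and cont: "continuous_on UNIV (est f G P Q)"
    and f_root: "\<And>l t. f t l = 0 \<longleftrightarrow> t = \<theta> l"
    and grad_root: "\<And>l. (GDERIV (\<lambda>l. L (\<theta> l)) l :> r) \<longleftrightarrow> l = lh"
    and near: "\<And>\<alpha>. \<alpha> \<in> cball \<alpha>0 \<delta> \<Longrightarrow> norm (est f G P Q \<alpha> - est f G P Q \<alpha>0 - V *v (\<alpha> - \<alpha>0)) \<le> c * norm (\<alpha> - \<alpha>0)"
    and V: "invertible V" "\<And>x. norm (matrix_inv V *v x) \<le> \<kappa> * norm x" "\<kappa> > 0" "c > 0" "\<delta> > 0"
    and p0: "\<And>X. p0 * norm (mk 0 0 X) \<le> norm (D_part (V *v mk 0 0 X))" and B: "B \<ge> 0" "\<And>x :: real ^ ('p + 'q + 'q \<times> 'p). norm (D_part x) \<le> B * norm x"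
    and small: "\<kappa> * c \<le> 1 / 2" "\<kappa> * norm (est f G P Q \<alpha>0 - mk 0 r 0) \<le> \<delta> / 4" "3 * c * B < p0"
  shows "\<exists>\<alpha>. theta_part \<alpha> = \<theta> lh \<and>
    norm (\<alpha> - \<alpha>0 + matrix_inv V *v (est f G P Q \<alpha>0 - mk 0 r 0)) \<le> 2 * \<kappa>\<^sup>2 * c * norm (est f G P Q \<alpha>0 - mk 0 r 0)"
proof -
  define h where "h \<alpha> = est f G P Q \<alpha> - mk 0 r 0" for \<alpha>
  have "\<exists>\<alpha>\<in>cball \<alpha>0 (\<delta> / 2). h \<alpha> = 0 \<and> norm (\<alpha> - \<alpha>0) \<le> 2 * \<kappa> * norm (h \<alpha>0) \<and>
    norm (\<alpha> - \<alpha>0 + matrix_inv V *v (h \<alpha>0)) \<le> 2 * \<kappa>\<^sup>2 * c * norm (h \<alpha>0)"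
  \<comment> \<open>The root is sought in the ball of half the radius, so that a perturbation of
    size \<open>\<delta> / 2\<close> in \<open>D\<close> stays where the linearisation is
    valid.\<close>
  proof (rule brouwer_root_near_linear[where L="(*v) V"])
    show "continuous_on (cball \<alpha>0 (\<delta> / 2)) h"
      unfolding h_def by (intro continuous_intros continuous_on_subset[OF cont]) auto
    show "norm (h x - h \<alpha>0 - V *v (x - \<alpha>0)) \<le> c * norm (x - \<alpha>0)" if "x \<in> cball \<alpha>0 (\<delta> / 2)" for x
      using near[of x] that V(5) by (simp add: h_def)
  qed (use V small in \<open>simp_all add: matrix_inv_cancel h_def\<close>)
  then obtain \<alpha> where \<alpha>: "\<alpha> \<in> cball \<alpha>0 (\<delta> / 2)" "h \<alpha> = 0"
    "norm (\<alpha> - \<alpha>0 + matrix_inv V *v (h \<alpha>0)) \<le> 2 * \<kappa>\<^sup>2 * c * norm (h \<alpha>0)" by blast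
  define t where "t = theta_part \<alpha>"
  define l where "l = lambda_part \<alpha>"
  define X where "X = D_part \<alpha>"
  have a: "\<alpha> = mk t l X" by (simp add: t_def l_def X_def)
  have "est f G P Q \<alpha> = mk 0 r 0" using \<alpha>(2) by (simp add: h_def)
  then have e: "f t l = 0" "transpose X *v G t = r" "P t l ** X + Q t l = 0"
    unfolding a est_mk by (simp_all only: parts_eq_iff parts_mk)
  have "invertible (P t l)"
  proof (rule invertible_injective, rule ccontr)
    fix x assume x: "P t l *v x = 0" "x \<noteq> 0"
    \<comment> \<open>All columns equal the supposed null vector, so \<open>P t l ** Y = 0\<close>.
      Adding the multiple \<open>E\<close> of norm \<open>\<delta> / 2\<close> to \<open>X\<close>
      leaves the third block unchanged, although \<open>V\<close> changes it by at least
      \<open>p0 * (\<delta> / 2)\<close>.\<close>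
    define Y :: "real ^ 'q ^ 'p" where "Y = (\<chi> i j. x $ i)"
    define m where "m = norm (mk 0 0 Y)"
    have "Y \<noteq> 0" using x(2) by (auto simp: Y_def vec_eq_iff)
    then have m: "m > 0" unfolding m_def
      by (metis mk_zero norm_eq_zero parts_mk(3) zero_less_norm_iff)
    define E where "E = (\<delta> / (2 * m)) *\<^sub>R Y"
    have nE: "norm (mk 0 0 E) = \<delta> / 2"
    proof -
      have "mk 0 0 E = (\<delta> / (2 * m)) *\<^sub>R mk 0 0 Y" by (simp add: E_def mk_scaleR)
      then show ?thesis using m V(5) by (simp add: m_def)
    qed
    have "P t l ** Y = 0"
      using x(1) by (simp add: Y_def vec_eq_iff matrix_matrix_mult_def matrix_vector_mult_def)
    then have PE: "P t l ** E = 0"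
      unfolding E_def by (simp add: bounded_bilinear.scaleR_right[OF bounded_bilinear_matrix_matrix])
    define \<beta> where "\<beta> = mk t l (X + E)"
    have \<beta>: "\<beta> = \<alpha> + mk 0 0 E" by (simp add: \<beta>_def a mk_add)
    have na: "norm (\<alpha> - \<alpha>0) \<le> \<delta> / 2" using \<alpha>(1) by (simp add: dist_norm norm_minus_commute)
    then have nb: "norm (\<beta> - \<alpha>0) \<le> \<delta>"
      using norm_triangle_ineq[of "\<alpha> - \<alpha>0" "mk 0 0 E"] nE by (simp add: \<beta> algebra_simps)
    have nn: "norm (est f G P Q x - est f G P Q \<alpha>0 - V *v (x - \<alpha>0)) \<le> c * d" if "norm (x - \<alpha>0) \<le> d" "d \<le> \<delta>" for x d
    proof -
      have "x \<in> cball \<alpha>0 \<delta>" using that by (simp add: dist_norm norm_minus_commute)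
      from near[OF this] show ?thesis using mult_left_mono[OF that(1), of c] V(4) by linarith
    qed
    note b1 = nn[OF nb order_refl]
    have b2: "norm (est f G P Q \<alpha> - est f G P Q \<alpha>0 - V *v (\<alpha> - \<alpha>0)) \<le> c * (\<delta> / 2)"
      by (rule nn[OF na]) (use V(5) in simp)
    have err: "norm (est f G P Q \<beta> - est f G P Q \<alpha> - V *v mk 0 0 E) \<le> c * \<delta> + c * (\<delta> / 2)"
    proof -
      have "est f G P Q \<beta> - est f G P Q \<alpha> - V *v mk 0 0 E = (est f G P Q \<beta> - est f G P Q \<alpha>0 - V *v (\<beta> - \<alpha>0)) -
        (est f G P Q \<alpha> - est f G P Q \<alpha>0 - V *v (\<alpha> - \<alpha>0))"
        by (simp add: \<beta> matrix_vector_right_distrib matrix_vector_mult_diff_distrib)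
      then show ?thesis by (simp only: order_trans[OF norm_triangle_ineq4 add_mono[OF b1 b2]])
    qed
    have "D_part (est f G P Q \<beta> - est f G P Q \<alpha> - V *v mk 0 0 E) = - D_part (V *v mk 0 0 E)"
    proof -
      have "P t l ** (X + E) = P t l ** X" using PE by (simp add: matrix_add_ldistrib)
      then have "D_part (est f G P Q \<beta>) = D_part (est f G P Q \<alpha>)" unfolding \<beta>_def a est_mk by simp
      then show ?thesis by (simp only: parts_linear) simp
    qed
    then have "norm (D_part (V *v mk 0 0 E)) \<le> B * (c * \<delta> + c * (\<delta> / 2))"
      using order_trans[OF B(2)[of "est f G P Q \<beta> - est f G P Q \<alpha> - V *v mk 0 0 E"] mult_left_mono[OF err B(1)]]
      by (simp only: norm_minus_cancel)
    \<comment> \<open>The linearisation errors at distance \<delta> and \<open>\<delta> / 2\<close>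
      add up to \<open>c * 3 * (\<delta> / 2)\<close>; this is the origin of the condition
      \<open>3 * c * B < p0\<close>.\<close>
    then have "p0 * (\<delta> / 2) \<le> (3 * c * B) * (\<delta> / 2)" using p0[of E] by (simp add: nE algebra_simps)
    then show False using small(3) V(5) by simp
  qed
  note root = root_gradient[OF f_der e(1) open_UNIV UNIV_I _ this e(3)]
  have "continuous_on UNIV (\<lambda>(t, l). f t l)"
    using f_der has_derivative_continuous by (intro continuous_at_imp_continuous_on) fastforce
  then have "GDERIV (\<lambda>l. L (\<theta> l)) l :> r"
    using root(2)[OF _ _ L_der, of \<theta>] f_root e(2) by simp
  then have "l = lh" by (simp add: grad_root)
  then have "theta_part \<alpha> = \<theta> lh" using e(1) f_root by (simp add: t_def)
  then show ?thesis using \<alpha>(3) by (auto simp: h_def)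
qed

section \<open>Sums, integrals and bounds in block form\<close>

lemma integrable_vecI:
  fixes f :: "'z \<Rightarrow> 'b::euclidean_space ^ 'n"
  assumes "\<And>i. integrable F (\<lambda>z. f z $ i)"
  shows "integrable F f"
proof -
  have "integrable F (\<lambda>z. \<Sum>i\<in>UNIV. axis i (f z $ i))"
    by (intro Bochner_Integration.integrable_sum integrable_bounded_linear[OF bounded_linear_axis assms])
  then show ?thesis by (simp add: sum_axis_components)
qed

lemma bounded_linear_est:
  "bounded_linear (\<lambda>x. mk (fst x) (transpose X *v fst (snd x)) (fst (snd (snd x)) ** X + snd (snd (snd x))))"
  unfolding linear_conv_bounded_linear[symmetric]
  by (rule linearI) (simp_all add: parts_eq_iff parts_linear matrix_vector_right_distrib matrix_vector_mult_scaleR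
      bounded_bilinear.add_left[OF bounded_bilinear_matrix_matrix] bounded_bilinear.scaleR_left[OF bounded_bilinear_matrix_matrix]
      scaleR_add_right)

lemma sample_mean_est:
  "sample_mean Z n \<omega> (\<lambda>z. est (f z) (G z) (P z) (Q z) \<alpha>) =
    est (\<lambda>t l. sample_mean Z n \<omega> (\<lambda>z. f z t l)) (\<lambda>t. sample_mean Z n \<omega> (\<lambda>z. G z t))
      (\<lambda>t l. sample_mean Z n \<omega> (\<lambda>z. P z t l)) (\<lambda>t l. sample_mean Z n \<omega> (\<lambda>z. Q z t l)) \<alpha>"
proof -
  let ?t = "theta_part \<alpha>" and ?l = "lambda_part \<alpha>"
  let ?h = "\<lambda>z. (f z ?t ?l, G z ?t, P z ?t ?l, Q z ?t ?l)"
  have fst: "fst (sample_mean Z n \<omega> h) = sample_mean Z n \<omega> (\<lambda>z. fst (h z))" for h :: "_ \<Rightarrow> 'x::real_normed_vector \<times> 'y::real_normed_vector"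
    by (rule sample_mean_bounded_linear[OF bounded_linear_fst, symmetric])
  have snd: "snd (sample_mean Z n \<omega> h) = sample_mean Z n \<omega> (\<lambda>z. snd (h z))" for h :: "_ \<Rightarrow> 'x::real_normed_vector \<times> 'y::real_normed_vector"
    by (rule sample_mean_bounded_linear[OF bounded_linear_snd, symmetric])
  show ?thesis
    using sample_mean_bounded_linear[OF bounded_linear_est[of "D_part \<alpha>"], of Z n \<omega> ?h]
    by (simp add: est_def Let_def fst snd)
qed

text \<open>Integrability of the coefficients is tested at special \<open>D\<close>: the value
  \<open>D = 0\<close> yields \<open>f\<close> and \<open>Q\<close>, the matrices
  \<open>unit_rows k\<close> yield the entries of \<open>G\<close> and, after subtracting
  \<open>Q\<close>, those of \<open>P\<close>.\<close>

lemma
  fixes P :: "'z \<Rightarrow> real ^ 'p \<Rightarrow> real ^ 'q \<Rightarrow> real ^ 'p ^ 'p" and Q :: "'z \<Rightarrow> real ^ 'p \<Rightarrow> real ^ 'q \<Rightarrow> real ^ 'q ^ 'p"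
  assumes int: "\<And>\<alpha>. integrable F (\<lambda>z. est (f z) (G z) (P z) (Q z) \<alpha>)"
  shows integrable_est_f: "integrable F (\<lambda>z. f z t l)"
    and integrable_est_G: "integrable F (\<lambda>z. G z t)"
    and integrable_est_P: "integrable F (\<lambda>z. P z t l)"
    and integrable_est_Q: "integrable F (\<lambda>z. Q z t l)"
proof -
  fix t l
  show f: "integrable F (\<lambda>z. f z t l)"
    using integrable_bounded_linear[OF bounded_linear_parts(1) int[of "mk t l 0"]] by (simp add: est_mk)
  have "integrable F (\<lambda>z. transpose (unit_rows k :: real ^ 'q ^ 'p) *v G z t)" for k
    using integrable_bounded_linear[OF bounded_linear_parts(2) int[of "mk t l (unit_rows k)"]] by (simp add: est_mk)
  then have "integrable F (\<lambda>z. (transpose (unit_rows k :: real ^ 'q ^ 'p) *v G z t) $ undefined)" for k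
    by (rule integrable_bounded_linear[OF bounded_linear_vec_nth])
  then show "integrable F (\<lambda>z. G z t)" by (intro integrable_vecI) (simp add: unit_rows_mult)
  have PX: "integrable F (\<lambda>z. P z t l ** X + Q z t l)" for X
    using integrable_bounded_linear[OF bounded_linear_parts(3) int[of "mk t l X"]] by (simp add: est_mk)
  have z: "A ** (0 :: real ^ 'q ^ 'p) = 0" for A :: "real ^ 'p ^ 'p"
    by (rule bounded_bilinear.zero_right[OF bounded_bilinear_matrix_matrix])
  show Q: "integrable F (\<lambda>z. Q z t l)" using PX[of 0] by (simp add: z)
  have "integrable F (\<lambda>z. P z t l ** (unit_rows k :: real ^ 'q ^ 'p))" for k
    using Bochner_Integration.integrable_diff[OF PX[of "unit_rows k"] Q] by simp
  then have "integrable F (\<lambda>z. (P z t l ** (unit_rows k :: real ^ 'q ^ 'p)) $ i $ undefined)" for k i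
    by (intro integrable_bounded_linear[OF bounded_linear_vec_nth])
  then show "integrable F (\<lambda>z. P z t l)" by (intro integrable_vecI) (simp add: unit_rows_mult)
qed

lemma integral_est:
  fixes P :: "'z \<Rightarrow> real ^ 'p \<Rightarrow> real ^ 'q \<Rightarrow> real ^ 'p ^ 'p" and Q :: "'z \<Rightarrow> real ^ 'p \<Rightarrow> real ^ 'q \<Rightarrow> real ^ 'q ^ 'p"
  assumes int: "\<And>\<alpha>. integrable F (\<lambda>z. est (f z) (G z) (P z) (Q z) \<alpha>)"
  shows "(\<integral>z. est (f z) (G z) (P z) (Q z) \<alpha> \<partial>F) =
    est (\<lambda>t l. \<integral>z. f z t l \<partial>F) (\<lambda>t. \<integral>z. G z t \<partial>F) (\<lambda>t l. \<integral>z. P z t l \<partial>F) (\<lambda>t l. \<integral>z. Q z t l \<partial>F) \<alpha>"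
proof -
  have i: "integrable F (\<lambda>z. f z t l)" "integrable F (\<lambda>z. G z t)" "integrable F (\<lambda>z. P z t l)" "integrable F (\<lambda>z. Q z t l)" for t l
    using integrable_est_f[OF int] integrable_est_G[OF int] integrable_est_P[OF int] integrable_est_Q[OF int] by blast+
  let ?X = "D_part \<alpha>" and ?t = "theta_part \<alpha>" and ?l = "lambda_part \<alpha>"
  have t: "theta_part (\<integral>z. est (f z) (G z) (P z) (Q z) \<alpha> \<partial>F) = (\<integral>z. f z ?t ?l \<partial>F)"
    by (subst integral_bounded_linear[OF bounded_linear_parts(1) int, symmetric]) (simp add: est_def Let_def)
  have l: "lambda_part (\<integral>z. est (f z) (G z) (P z) (Q z) \<alpha> \<partial>F) = transpose ?X *v (\<integral>z. G z ?t \<partial>F)"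
    by (subst integral_bounded_linear[OF bounded_linear_parts(2) int, symmetric])
      (simp add: est_def Let_def integral_bounded_linear[OF matrix_vector_mul_bounded_linear i(2)] del: transpose_matrix_vector)
  have PX: "integrable F (\<lambda>z. P z ?t ?l ** ?X)" "(\<integral>z. P z ?t ?l ** ?X \<partial>F) = (\<integral>z. P z ?t ?l \<partial>F) ** ?X"
    using integrable_bounded_linear[OF bounded_bilinear.bounded_linear_left[OF bounded_bilinear_matrix_matrix] i(3)]
      integral_bounded_linear[OF bounded_bilinear.bounded_linear_left[OF bounded_bilinear_matrix_matrix] i(3)] by blast+
  have d: "D_part (\<integral>z. est (f z) (G z) (P z) (Q z) \<alpha> \<partial>F) = (\<integral>z. P z ?t ?l \<partial>F) ** ?X + (\<integral>z. Q z ?t ?l \<partial>F)"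
    by (subst integral_bounded_linear[OF bounded_linear_parts(3) int, symmetric])
      (simp add: est_def Let_def Bochner_Integration.integral_add[OF PX(1) i(4)] PX(2))
  show ?thesis unfolding parts_eq_iff t l d by (simp add: est_def Let_def)
qed

text \<open>The bound is assumed for \<eta> alone. Two points of \<open>U\<close> that differ by
  \<open>s *\<^sub>R unit_rows k\<close> in \<open>D\<close> have middle blocks that differ by
  \<open>s\<close> times the k-th entry of \<open>G\<close>, so this entry is at most
  \<open>2 / s\<close> times \<open>m\<close>. This provides the domination for differentiating the
  expected loss.\<close>

lemma est_bound_gradient:
  fixes \<alpha> :: "real ^ ('p::finite + 'q::finite + 'q \<times> 'p)"
  assumes U: "open U" "\<alpha> \<in> U" and bound: "\<And>\<beta> z. \<beta> \<in> U \<Longrightarrow> norm (est (f z) (G z) (P z) (Q z) \<beta>) \<le> m z"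
  obtains W C where "open W" "theta_part \<alpha> \<in> W" "\<And>t z. t \<in> W \<Longrightarrow> norm (G z t) \<le> C * m z"
proof -
  let ?X = "D_part \<alpha>" and ?l = "lambda_part \<alpha>"
  obtain e where e: "e > 0" "ball \<alpha> e \<subseteq> U" using U openE by blast
  define E :: "'p \<Rightarrow> real ^ ('p + 'q + 'q \<times> 'p)" where "E k = mk 0 0 (unit_rows k)" for k
  define K where "K = (\<Sum>k\<in>UNIV. norm (E k)) + 1"
  have K: "K > 0" "norm (E k) \<le> K" for k
    using member_le_sum[of k UNIV "\<lambda>k. norm (E k)"] by (auto simp: K_def add_nonneg_pos sum_nonneg)
  \<comment> \<open>One step length for all \<open>k\<close>: it moves a point of the ball of radius
    \<open>e / 2\<close> by at most \<open>e / 2\<close>, hence keeps it in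
    \<open>U\<close>.\<close>
  define s where "s = e / (2 * K)"
  have s: "s > 0" "s * norm (E k) \<le> e / 2" for k
    using e K mult_left_mono[OF K(2)[of k], of s] by (auto simp: s_def)
  define W where "W = (\<lambda>t. mk t ?l ?X) -` ball \<alpha> (e / 2)"
  have "continuous_on UNIV (\<lambda>t. (t, ?l, ?X))" by (intro continuous_intros)
  from continuous_on_compose2[OF linear_continuous_on[OF bounded_linear_mk] this subset_UNIV]
  have "open W" unfolding W_def by (intro open_vimage) simp_all
  moreover have "theta_part \<alpha> \<in> W" using e(1) by (simp add: W_def)
  moreover have "norm (G z t) \<le> (real CARD('p) * (2 / s)) * m z" if t: "t \<in> W" for t z
  proof -
    have G: "\<bar>G z t $ k\<bar> \<le> (2 / s) * m z" for k
    proof -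
      let ?a = "mk t ?l ?X" and ?b = "mk t ?l (?X + s *\<^sub>R unit_rows k)"
      have d: "dist \<alpha> ?a < e / 2" using t by (simp add: W_def)
      have "?b = ?a + s *\<^sub>R E k" by (simp add: E_def mk_scaleR mk_add)
      then have "dist ?a ?b \<le> e / 2" using s by (simp add: dist_norm)
      then have "?b \<in> U" using d e(2) dist_triangle[of \<alpha> ?b ?a] by (intro subsetD[OF e(2)]) simp
      moreover have "?a \<in> U" using d e by (intro subsetD[OF e(2)]) simp
      ultimately have b: "norm (est (f z) (G z) (P z) (Q z) ?a) \<le> m z" "norm (est (f z) (G z) (P z) (Q z) ?b) \<le> m z"
        using bound by blast+
      have c: "\<bar>lambda_part x $ j\<bar> \<le> norm x" for x :: "real ^ ('p + 'q + 'q \<times> 'p)" and j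
        using component_le_norm_cart[of x "Inr (Inl j)"] by (simp add: lambda_part_def)
      have "transpose (?X + s *\<^sub>R unit_rows k) *v v = transpose ?X *v v + s *\<^sub>R (transpose (unit_rows k) *v v)" for v
        by (simp add: matrix_vector_mult_def transpose_def vec_eq_iff sum_distrib_left sum.distrib algebra_simps)
      then have "lambda_part (est (f z) (G z) (P z) (Q z) ?b) $ undefined - lambda_part (est (f z) (G z) (P z) (Q z) ?a) $ undefined
        = s * G z t $ k" by (simp add: est_mk unit_rows_mult)
      then have "\<bar>s * G z t $ k\<bar> \<le> 2 * m z"
        using b c[of "est (f z) (G z) (P z) (Q z) ?b" undefined] c[of "est (f z) (G z) (P z) (Q z) ?a" undefined] by linarith
      then show ?thesis using s(1) by (simp add: abs_mult field_simps)
    qed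
    have "norm (G z t) \<le> (\<Sum>k\<in>UNIV. \<bar>G z t $ k\<bar>)" by (rule norm_le_l1_cart)
    also have "\<dots> \<le> (\<Sum>k\<in>(UNIV :: 'p set). (2 / s) * m z)" by (intro sum_mono G)
    finally show ?thesis by simp
  qed
  ultimately show thesis by (rule that)
qed

lemma jacobian_partials:
  fixes f :: "real ^ 'p \<Rightarrow> real ^ 'q \<Rightarrow> real ^ 'm"
  assumes "(\<lambda>(t, l). f t l) differentiable (at (t, l))"
  shows "((\<lambda>(t, l). f t l) has_derivative
    (\<lambda>(u, w). jacobian (\<lambda>t. f t l) (at t) *v u + jacobian (\<lambda>l. f t l) (at l) *v w)) (at (t, l))"
proof -
  obtain f' where f': "((\<lambda>(t, l). f t l) has_derivative f') (at (t, l))" using assms unfolding differentiable_def by blast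
  have "((\<lambda>t. (t, l)) has_derivative (\<lambda>u. (u, 0))) (at t)" by (auto intro!: derivative_eq_intros)
  from diff_chain_at[OF this f'] have "((\<lambda>t. f t l) has_derivative (\<lambda>u. f' (u, 0))) (at t)" by (simp add: o_def)
  note j1 = jacobian_eqI[OF this]
  have "((\<lambda>l. (t, l)) has_derivative (\<lambda>w. (0, w))) (at l)" by (auto intro!: derivative_eq_intros)
  from diff_chain_at[OF this f'] have "((\<lambda>l. f t l) has_derivative (\<lambda>w. f' (0, w))) (at l)" by (simp add: o_def)
  note j2 = jacobian_eqI[OF this]
  have "f' = (\<lambda>(u, w). jacobian (\<lambda>t. f t l) (at t) *v u + jacobian (\<lambda>l. f t l) (at l) *v w)"
  proof
    fix h
    show "f' h = (case h of (u, w) \<Rightarrow> jacobian (\<lambda>t. f t l) (at t) *v u + jacobian (\<lambda>l. f t l) (at l) *v w)"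
      using linear_add[OF has_derivative_linear[OF f'], of "(fst h, 0)" "(0, snd h)"]
      by (simp add: j1 j2 case_prod_unfold)
  qed
  then show ?thesis using f' by simp
qed

text \<open>At fixed \<open>D\<close> the first block of \<open>est\<close> is \<open>f\<close>, so
  its derivative comes from directions with zero \<open>D\<close>-component. This transfers
  differentiability from \<Psi> to the expectation of \<phi>.\<close>

lemma est_derivative_f:
  assumes "(est f G P Q has_derivative E) (at \<alpha>)"
  shows "((\<lambda>(t, l). f t l) has_derivative (\<lambda>h. theta_part (E (mk (fst h) (snd h) 0)))) (at (theta_part \<alpha>, lambda_part \<alpha>))"
proof -
  let ?x = "(theta_part \<alpha>, lambda_part \<alpha>)"
  have "((\<lambda>x. (fst x, snd x, D_part \<alpha>)) has_derivative (\<lambda>h. (fst h, snd h, 0))) (at ?x)"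
    by (auto intro!: derivative_eq_intros)
  from bounded_linear.has_derivative[OF bounded_linear_mk this]
  have "((\<lambda>x. mk (fst x) (snd x) (D_part \<alpha>)) has_derivative (\<lambda>h. mk (fst h) (snd h) 0)) (at ?x)" by simp
  moreover have "(est f G P Q has_derivative E) (at (mk (fst ?x) (snd ?x) (D_part \<alpha>)))" using assms by simp
  ultimately have "((\<lambda>x. est f G P Q (mk (fst x) (snd x) (D_part \<alpha>))) has_derivative (\<lambda>h. E (mk (fst h) (snd h) 0))) (at ?x)"
    using diff_chain_at[of "\<lambda>x. mk (fst x) (snd x) (D_part \<alpha>)" _ ?x "est f G P Q" E] by (simp add: o_def)
  from bounded_linear.has_derivative[OF bounded_linear_parts(1) this]
  show ?thesis by (simp add: est_mk case_prod_unfold)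
qed

lemma norm_matrix_vector_le_entries:
  fixes A :: "real ^ 'n ^ 'm"
  assumes "\<And>k l. \<bar>A $ k $ l\<bar> \<le> m"
  shows "norm (A *v x) \<le> (real CARD('m) * real CARD('n) * m) * norm x"
proof -
  have "norm (A *v x) \<le> onorm ((*v) A) * norm x" by (rule onorm[OF matrix_vector_mul_bounded_linear])
  also have "\<dots> \<le> (real CARD('m) * real CARD('n) * m) * norm x"
    using onorm_le_matrix_component[of A m] assms by (intro mult_right_mono) auto
  finally show ?thesis .
qed

section \<open>The main theorem\<close>

lemma has_derivative_sample_mean:
  assumes "\<And>z. (g z has_derivative g' z) (at x)"
  shows "((\<lambda>x. sample_mean Z n \<omega> (\<lambda>z. g z x)) has_derivative (\<lambda>h. sample_mean Z n \<omega> (\<lambda>z. g' z h))) (at x)"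
  unfolding sample_mean_def by (intro has_derivative_scaleR_right has_derivative_sum assms)

lemma sample_mean_partials:
  fixes f :: "'z \<Rightarrow> real ^ 'p \<Rightarrow> real ^ 'q \<Rightarrow> real ^ 'm"
  assumes "\<And>z. ((\<lambda>(t, l). f z t l) has_derivative (\<lambda>(u, w). P z t l *v u + Q z t l *v w)) (at (t, l))"
  shows "((\<lambda>(t, l). sample_mean Z n \<omega> (\<lambda>z. f z t l)) has_derivative
    (\<lambda>(u, w). sample_mean Z n \<omega> (\<lambda>z. P z t l) *v u + sample_mean Z n \<omega> (\<lambda>z. Q z t l) *v w)) (at (t, l))"
proof -
  have "sample_mean Z n \<omega> (\<lambda>z. P z t l *v u + Q z t l *v w)
      = sample_mean Z n \<omega> (\<lambda>z. P z t l) *v u + sample_mean Z n \<omega> (\<lambda>z. Q z t l) *v w" for u w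
    unfolding sample_mean_add
    by (simp add: sample_mean_bounded_linear[OF bounded_linear_matrix_left(1)])
  then show ?thesis
    using has_derivative_sample_mean[of "\<lambda>z x. f z (fst x) (snd x)" "\<lambda>z h. P z t l *v fst h + Q z t l *v snd h" "(t, l)" Z n \<omega>] assms
    by (simp add: case_prod_unfold)
qed

lemma GDERIV_sample_mean:
  assumes "\<And>z. GDERIV (g z) x :> g' z"
  shows "GDERIV (\<lambda>x. sample_mean Z n \<omega> (\<lambda>z. g z x)) x :> sample_mean Z n \<omega> g'"
proof -
  have "sample_mean Z n \<omega> (\<lambda>z. g' z \<bullet> h) = sample_mean Z n \<omega> g' \<bullet> h" for h
    by (rule sample_mean_bounded_linear[OF bounded_linear_inner_left])
  then show ?thesis
    using has_derivative_sample_mean[of g "\<lambda>z h. g' z \<bullet> h" x Z n \<omega>] assms by (simp add: gderiv_iff)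
qed

theorem corollary1:
  fixes M :: "'w measure"
    and F :: "(real ^ 'd) measure"
    and Z :: "nat \<Rightarrow> 'w \<Rightarrow> real ^ 'd"
    and \<phi> :: "real ^ 'd \<Rightarrow> real ^ 'p \<Rightarrow> real ^ 'q \<Rightarrow> real ^ 'p"
    and \<psi> :: "real ^ 'd \<Rightarrow> real ^ 'p \<Rightarrow> real"
    and theta_hat :: "nat \<Rightarrow> 'w \<Rightarrow> real ^ 'q \<Rightarrow> real ^ 'p"
    and lambda_hat :: "nat \<Rightarrow> 'w \<Rightarrow> real ^ 'q"
    and R :: "nat \<Rightarrow> 'w \<Rightarrow> real ^ 'q"
    and \<Psi> :: "real ^ ('p + 'q + 'q \<times> 'p) \<Rightarrow> real ^ ('p + 'q + 'q \<times> 'p)"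
    and \<alpha>\<^sub>0 :: "real ^ ('p + 'q + 'q \<times> 'p)"
    and m\<^sub>0 m\<^sub>1 :: "real ^ 'd \<Rightarrow> real"
    and \<theta> :: "real ^ 'q \<Rightarrow> real ^ 'p"
    and lambda0 :: "real ^ 'q"
    and \<theta>\<^sub>0 b :: "real ^ 'p"
    and D :: "real ^ 'q ^ 'p"
    and Z1 :: "real ^ 'q ^ 'q"
    and Z2 J :: "real ^ 'p ^ 'p"
    and Wj :: "'q \<Rightarrow> real ^ 'p ^ 'p"
    and W :: "real ^ 'p ^ 'q"
    and Mb :: "real ^ ('q \<times> 'p) ^ 'q"
    and A1 :: "real ^ 'p ^ 'p"
    and A2 :: "real ^ 'p ^ 'p"
    and A3 :: "real ^ ('q \<times> 'p) ^ 'p"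
    and Astar :: "real ^ ('p + 'q + 'q \<times> 'p) ^ 'p"
    and Kstar :: "real ^ ('p + 'q + 'q \<times> 'p) ^ ('p + 'q + 'q \<times> 'p)"
  assumes prob: "prob_space M"
    and Z_indep: "prob_space.indep_vars M (\<lambda>_. borel) Z {1..}"
    and Z_distr: "\<And>i. i \<ge> 1 \<Longrightarrow> distr M borel (Z i) = F"
    \<comment> \<open>regularity of the estimating function and the loss\<close>
    and \<phi>_meas: "\<And>t l. (\<lambda>z. \<phi> z t l) \<in> borel_measurable borel"
    and \<psi>_meas: "\<And>t. (\<lambda>z. \<psi> z t) \<in> borel_measurable borel"
    and \<phi>_diff: "\<And>z x. (\<lambda>(t, l). \<phi> z t l) differentiable (at x)"
    and \<phi>_diff_t: "\<And>z x. (\<lambda>(t, l). jacobian (\<lambda>t. \<phi> z t l) (at t)) differentiable (at x)"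
    and \<phi>_diff_l: "\<And>z x. (\<lambda>(t, l). jacobian (\<lambda>l. \<phi> z t l) (at l)) differentiable (at x)"
    and \<psi>_diff: "\<And>z t. \<psi> z differentiable (at t)"
    and \<psi>_diff2: "\<And>z t. grad (\<psi> z) differentiable (at t)"
    and \<eta>_int: "\<And>\<alpha>. integrable F (\<lambda>z. eta \<phi> \<psi> z \<alpha>)"
    and \<psi>_int: "\<And>t. integrable F (\<lambda>z. \<psi> z t)"
    \<comment> \<open>the estimators; \<open>lambda_hat\<close> is the unique solution of \<open>TE'(\<lambda>) = R n\<close>,
      where \<open>R n = o\<^sub>p(1 / sqrt n)\<close>\<close>
    and theta_hat_root: "\<forall>\<^sub>F n in sequentially. AE \<omega> in M. \<forall>l t.
          sample_mean Z n \<omega> (\<lambda>z. \<phi> z t l) = 0 \<longleftrightarrow> t = theta_hat n \<omega> l"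
    and R_op: "small_op M R (\<lambda>n. 1 / sqrt (real n))"
    and lambda_hat_root: "\<forall>\<^sub>F n in sequentially. AE \<omega> in M. \<forall>l.
          (GDERIV (\<lambda>l. sample_mean Z n \<omega> (\<lambda>z. \<psi> z (theta_hat n \<omega> l))) l :> R n \<omega>)
            \<longleftrightarrow> l = lambda_hat n \<omega>"
    and hat_meas: "\<And>n. (\<lambda>\<omega>. theta_hat n \<omega> (lambda_hat n \<omega>)) \<in> borel_measurable M"
    \<comment> \<open>the conditions on \<open>\<eta>\<close> and \<open>\<Psi>\<close>\<close>
    and \<Psi>_def: "\<And>\<alpha>. \<Psi> \<alpha> = (\<integral>z. eta \<phi> \<psi> z \<alpha> \<partial>F)"
    and \<Psi>_root: "\<And>\<alpha>. \<Psi> \<alpha> = 0 \<longleftrightarrow> \<alpha> = \<alpha>\<^sub>0"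
    and \<Psi>_C1: "\<exists>U. open U \<and> \<alpha>\<^sub>0 \<in> U \<and> (\<forall>\<alpha>\<in>U. \<Psi> differentiable (at \<alpha>)) \<and>
          continuous_on U (\<lambda>\<alpha>. jacobian \<Psi> (at \<alpha>))"
    and \<Psi>_nonsing: "invertible (jacobian \<Psi> (at \<alpha>\<^sub>0))"
    and m_meas: "m\<^sub>0 \<in> borel_measurable borel" "m\<^sub>1 \<in> borel_measurable borel"
    and m_sq_int: "integrable F (\<lambda>z. (m\<^sub>0 z)\<^sup>2)" "integrable F (\<lambda>z. (m\<^sub>1 z)\<^sup>2)"
    and \<eta>_bound: "\<exists>U. open U \<and> \<alpha>\<^sub>0 \<in> U \<and> (\<forall>\<alpha>\<in>U. \<forall>z.
          norm (eta \<phi> \<psi> z \<alpha>) \<le> m\<^sub>0 z \<and>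
          (\<forall>k l. \<bar>jacobian (eta \<phi> \<psi> z) (at \<alpha>) $ k $ l\<bar> \<le> m\<^sub>1 z))"
    \<comment> \<open>the population quantities\<close>
    and \<theta>_root: "\<And>l t. (\<integral>z. \<phi> z t l \<partial>F) = 0 \<longleftrightarrow> t = \<theta> l"
    and lambda0_root: "\<And>l. (GDERIV (\<lambda>l. \<integral>z. \<psi> z (\<theta> l) \<partial>F) l :> 0) \<longleftrightarrow> l = lambda0"
    and \<theta>\<^sub>0_def: "\<theta>\<^sub>0 = \<theta> lambda0"
    and D_def: "D = jacobian \<theta> (at lambda0)"
    and Z1_def: "Z1 = hessian (\<lambda>l. \<integral>z. \<psi> z (\<theta> l) \<partial>F) lambda0"
    and Z2_def: "Z2 = hessian (\<lambda>t. \<integral>z. \<psi> z t \<partial>F) \<theta>\<^sub>0"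
    and J_def: "J = - jacobian (\<lambda>t. \<integral>z. \<phi> z t lambda0 \<partial>F) (at \<theta>\<^sub>0)"
    and b_def: "b = grad (\<lambda>t. \<integral>z. \<psi> z t \<partial>F) \<theta>\<^sub>0"
    and Wj_def: "\<And>j. Wj j =
          (\<chi> k. column j D v* hessian (\<lambda>t. \<integral>z. \<phi> z t lambda0 $ k \<partial>F) \<theta>\<^sub>0) +
          frechet_derivative (\<lambda>l. jacobian (\<lambda>t. \<integral>z. \<phi> z t l \<partial>F) (at \<theta>\<^sub>0)) (at lambda0) (axis j 1)"
    and W_def: "W = (\<chi> j. (b v* matrix_inv J) v* Wj j)"
    and Mb_def: "Mb = block_diag_row (b v* matrix_inv J)"
    and A1_def: "A1 = matrix_inv J -
          D ** matrix_inv Z1 ** (transpose D ** Z2 + W) ** matrix_inv J"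
    and A2_def: "A2 = - (D ** matrix_inv Z1 ** transpose D)"
    and A3_def: "A3 = - (D ** matrix_inv Z1 ** Mb)"
    and Astar_def: "Astar = hcat3 A1 (- (D ** matrix_inv Z1)) A3"
    and Kstar_def: "Kstar =
          variance_matrix F (\<lambda>z. eta \<phi> \<psi> z (stack3 \<theta>\<^sub>0 lambda0 (vec_cols D)))"
  shows "consistent_for M (\<lambda>n \<omega>. theta_hat n \<omega> (lambda_hat n \<omega>)) \<theta>\<^sub>0
    \<and> invertible J \<and> invertible Z1
    \<and> small_op M
          (\<lambda>n \<omega>. theta_hat n \<omega> (lambda_hat n \<omega>) -
             (\<theta>\<^sub>0 + A1 *v sample_mean Z n \<omega> (\<lambda>z. \<phi> z \<theta>\<^sub>0 lambda0)
                 + A2 *v sample_mean Z n \<omega> (\<lambda>z. grad (\<psi> z) \<theta>\<^sub>0)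
                 + A3 *v vec_cols (sample_mean Z n \<omega> (\<lambda>z.
                     jacobian (\<lambda>t. \<phi> z t lambda0) (at \<theta>\<^sub>0) ** D + jacobian (\<lambda>l. \<phi> z \<theta>\<^sub>0 l) (at lambda0)))))
          (\<lambda>n. 1 / sqrt (real n))
    \<and> (\<exists>N. is_multivariate_normal N 0 (Astar ** Kstar ** transpose Astar) \<and>
          converges_in_law M
            (\<lambda>n \<omega>. sqrt (real n) *\<^sub>R (theta_hat n \<omega> (lambda_hat n \<omega>) - \<theta>\<^sub>0)) N)"
proof -
  interpret iid_sample M Z F
    using prob Z_indep Z_distr by (simp add: iid_sample_def iid_sample_axioms_def)
  interpret F: prob_space F by (rule prob_space_F)

  \<comment> \<open>Block form and domination of \<eta>\<close>
  let ?Pz = "\<lambda>z t l. jacobian (\<lambda>t. \<phi> z t l) (at t)" and ?Qz = "\<lambda>z t l. jacobian (\<lambda>l. \<phi> z t l) (at l)"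
  let ?f = "\<lambda>t l. \<integral>z. \<phi> z t l \<partial>F" and ?G = "\<lambda>t. \<integral>z. grad (\<psi> z) t \<partial>F"
  let ?P = "\<lambda>t l. \<integral>z. ?Pz z t l \<partial>F" and ?Q = "\<lambda>t l. \<integral>z. ?Qz z t l \<partial>F" and ?L = "\<lambda>t. \<integral>z. \<psi> z t \<partial>F"
  define \<eta> where "\<eta> = eta \<phi> \<psi>"
  have \<eta>_est: "\<eta> z \<alpha> = est (\<phi> z) (grad (\<psi> z)) (?Pz z) (?Qz z) \<alpha>" for z \<alpha> by (simp add: \<eta>_def eta_eq_est)
  have \<eta>_est': "\<eta> z = est (\<phi> z) (grad (\<psi> z)) (?Pz z) (?Qz z)" for z by (simp add: \<eta>_def eta_eq_est)
  have int_\<eta>: "integrable F (\<lambda>z. \<eta> z \<alpha>)" for \<alpha> using \<eta>_int by (simp add: \<eta>_def)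
  have int_est: "integrable F (\<lambda>z. est (\<phi> z) (grad (\<psi> z)) (?Pz z) (?Qz z) \<alpha>)" for \<alpha> using int_\<eta> by (simp add: \<eta>_est)
  note int_\<phi> = integrable_est_f[OF int_est] and int_P = integrable_est_P[OF int_est] and int_Q = integrable_est_Q[OF int_est]
  have \<Psi>_\<eta>: "\<Psi> = (\<lambda>\<alpha>. \<integral>z. \<eta> z \<alpha> \<partial>F)" using \<Psi>_def by (simp add: \<eta>_def fun_eq_iff)
  have \<Psi>_est: "\<Psi> = est ?f ?G ?P ?Q" unfolding \<Psi>_\<eta> using integral_est[OF int_est] by (simp add: \<eta>_est fun_eq_iff)
  have \<eta>_diff: "\<eta> z differentiable (at \<alpha>)" for z \<alpha>
    unfolding \<eta>_est' by (rule est_differentiable[OF \<phi>_diff \<psi>_diff2 \<phi>_diff_t \<phi>_diff_l])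
  have \<eta>_der: "(\<eta> z has_derivative (\<lambda>v. jacobian (\<eta> z) (at \<alpha>) *v v)) (at \<alpha>)" for z \<alpha>
    using \<eta>_diff jacobian_works by blast
  obtain U where U: "open U" "\<alpha>\<^sub>0 \<in> U" and U0: "\<And>\<alpha> z. \<alpha> \<in> U \<Longrightarrow> norm (\<eta> z \<alpha>) \<le> m\<^sub>0 z"
    and U1: "\<And>\<alpha> z k l. \<alpha> \<in> U \<Longrightarrow> \<bar>jacobian (\<eta> z) (at \<alpha>) $ k $ l\<bar> \<le> m\<^sub>1 z"
    using \<eta>_bound unfolding \<eta>_def by blast
  have mF: "m\<^sub>0 \<in> borel_measurable F" "m\<^sub>1 \<in> borel_measurable F" using m_meas sets_F by (simp_all cong: measurable_cong_sets)
  have int_m: "integrable F m\<^sub>0" "integrable F m\<^sub>1"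
    using F.square_integrable_imp_integrable mF m_sq_int by blast+
  \<comment> \<open>The dimension factors turn the entrywise bound \<open>m\<^sub>1\<close> into a
    bound for the operator norm of the Jacobian.\<close>
  define h where "h z = real CARD('p + 'q + 'q \<times> 'p) * real CARD('p + 'q + 'q \<times> 'p) * m\<^sub>1 z" for z
  have h_bd: "norm (jacobian (\<eta> z) (at \<alpha>) *v v) \<le> h z * norm v" if "\<alpha> \<in> U" for \<alpha> z v
    unfolding h_def by (rule norm_matrix_vector_le_entries[OF U1[OF that]])
  have h_int: "integrable F h" "integrable F (\<lambda>z. (h z)\<^sup>2)"
    unfolding h_def power_mult_distrib using int_m m_sq_int by auto

  \<comment> \<open>Derivatives of the expectations\<close>
  define V where "V = jacobian \<Psi> (at \<alpha>\<^sub>0)"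
  have \<Psi>_der: "(\<Psi> has_derivative (\<lambda>v. \<integral>z. jacobian (\<eta> z) (at \<alpha>) *v v \<partial>F)) (at \<alpha>)" if "\<alpha> \<in> U" for \<alpha>
    unfolding \<Psi>_\<eta>
    by (rule has_derivative_integral_dominated[OF U(1) that int_\<eta> \<eta>_der h_bd h_int(1)])
  have V_eq: "(\<integral>z. jacobian (\<eta> z) (at \<alpha>\<^sub>0) *v v \<partial>F) = V *v v" for v
    unfolding V_def by (rule jacobian_eqI[OF \<Psi>_der[OF U(2)], symmetric])
  have \<phi>_der: "((\<lambda>(t, l). \<phi> z t l) has_derivative (\<lambda>(u, w). ?Pz z t l *v u + ?Qz z t l *v w)) (at (t, l))" for z t l
    by (rule jacobian_partials[OF \<phi>_diff])
  have \<psi>_der: "GDERIV (\<psi> z) t :> grad (\<psi> z) t" for z t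
  proof -
    obtain D' where D': "(\<psi> z has_derivative D') (at t)" using \<psi>_diff unfolding differentiable_def by blast
    define d where "d = (\<Sum>i\<in>Basis. D' i *\<^sub>R i)"
    have "D' = (\<lambda>v. d \<bullet> v)"
    proof
      fix v
      note lin = has_derivative_linear[OF D']
      have "D' v = D' (\<Sum>b\<in>Basis. (v \<bullet> b) *\<^sub>R b)" by (simp add: euclidean_representation)
      also have "\<dots> = (\<Sum>b\<in>Basis. (v \<bullet> b) * D' b)" by (simp only: linear_sum[OF lin] linear_scale[OF lin] real_scaleR_def)
      finally show "D' v = d \<bullet> v"
        by (simp add: d_def inner_sum_left inner_commute[of v] mult.commute)
    qed
    then have "GDERIV (\<psi> z) t :> d" using D' by (simp only: gderiv_iff)
    then show ?thesis using grad_eqI by metis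
  qed
  \<comment> \<open>\<Psi> is differentiated under the integral sign once, and the derivative of the
    expected \<phi> is then its first block in directions with zero \<open>D\<close>-component. That
    its coefficients are the expected Jacobians is checked for each \<open>z\<close> and
    integrated.\<close>
  have f_der: "((\<lambda>(t, l). ?f t l) has_derivative
      (\<lambda>(u, w). ?P (theta_part \<alpha>) (lambda_part \<alpha>) *v u + ?Q (theta_part \<alpha>) (lambda_part \<alpha>) *v w))
      (at (theta_part \<alpha>, lambda_part \<alpha>))" if a: "\<alpha> \<in> U" for \<alpha>
  proof -
    let ?t = "theta_part \<alpha>" and ?l = "lambda_part \<alpha>"
    have jz: "theta_part (jacobian (\<eta> z) (at \<alpha>) *v mk u w 0) = ?Pz z ?t ?l *v u + ?Qz z ?t ?l *v w" for z u w
    proof -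
      have "(est (\<phi> z) (grad (\<psi> z)) (?Pz z) (?Qz z) has_derivative (\<lambda>v. jacobian (\<eta> z) (at \<alpha>) *v v)) (at \<alpha>)"
        using \<eta>_der unfolding \<eta>_est' .
      from fun_cong[OF has_derivative_unique[OF est_derivative_f[OF this] \<phi>_der[of z ?l ?t]], of "(u, w)"]
      show ?thesis by simp
    qed
    have ij: "integrable F (\<lambda>z. jacobian (\<eta> z) (at \<alpha>) *v v)" for v
      by (rule integrable_derivative_dominated[OF U(1) a int_\<eta> \<eta>_der h_bd[OF a] h_int(1)])
    have "theta_part (\<integral>z. jacobian (\<eta> z) (at \<alpha>) *v mk u w 0 \<partial>F) = ?P ?t ?l *v u + ?Q ?t ?l *v w" for u w
    proof -
      have "theta_part (\<integral>z. jacobian (\<eta> z) (at \<alpha>) *v mk u w 0 \<partial>F) = (\<integral>z. ?Pz z ?t ?l *v u + ?Qz z ?t ?l *v w \<partial>F)"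
        by (subst integral_bounded_linear[OF bounded_linear_parts(1) ij, symmetric]) (simp add: jz)
      also have "\<dots> = (\<integral>z. ?Pz z ?t ?l *v u \<partial>F) + (\<integral>z. ?Qz z ?t ?l *v w \<partial>F)"
        by (intro Bochner_Integration.integral_add
            integrable_bounded_linear[OF bounded_linear_matrix_left(1)] int_P int_Q)
      also have "\<dots> = ?P ?t ?l *v u + ?Q ?t ?l *v w"
        by (simp only: integral_bounded_linear[OF bounded_linear_matrix_left(1) int_P]
            integral_bounded_linear[OF bounded_linear_matrix_left(1) int_Q])
      finally show ?thesis .
    qed
    then have "(\<lambda>h. theta_part (\<integral>z. jacobian (\<eta> z) (at \<alpha>) *v mk (fst h) (snd h) 0 \<partial>F)) = (\<lambda>(u, w). ?P ?t ?l *v u + ?Q ?t ?l *v w)"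
      by (simp add: case_prod_unfold)
    moreover have "(est ?f ?G ?P ?Q has_derivative (\<lambda>v. \<integral>z. jacobian (\<eta> z) (at \<alpha>) *v v \<partial>F)) (at \<alpha>)"
      using \<Psi>_der[OF a] unfolding \<Psi>_est .
    note est_derivative_f[OF this]
    ultimately show ?thesis by (simp only:)
  qed
  have L_der: "GDERIV ?L (theta_part \<alpha>) :> ?G (theta_part \<alpha>)" if a: "\<alpha> \<in> U" for \<alpha>
  proof -
    have "norm (est (\<phi> z) (grad (\<psi> z)) (?Pz z) (?Qz z) \<beta>) \<le> m\<^sub>0 z" if "\<beta> \<in> U" for \<beta> z
      using U0[OF that, of z] by (simp only: \<eta>_est)
    note b = est_bound_gradient[where f=\<phi> and G="\<lambda>z. grad (\<psi> z)" and P="?Pz" and Q="?Qz" and m=m\<^sub>0, OF U(1) a this]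
    obtain S C where S: "open S" "theta_part \<alpha> \<in> S" "\<And>t z. t \<in> S \<Longrightarrow> norm (grad (\<psi> z) t) \<le> C * m\<^sub>0 z"
      by (rule b, assumption, rule that, assumption+)
    have "(?L has_derivative (\<lambda>v. \<integral>z. grad (\<psi> z) (theta_part \<alpha>) \<bullet> v \<partial>F)) (at (theta_part \<alpha>))"
    proof (rule has_derivative_integral_dominated[OF S(1,2) \<psi>_int])
      show "(\<psi> z has_derivative (\<lambda>v. grad (\<psi> z) t \<bullet> v)) (at t)" for z t using \<psi>_der by (simp add: gderiv_iff)
      show "norm (grad (\<psi> z) t \<bullet> v) \<le> (C * m\<^sub>0 z) * norm v" if "t \<in> S" for t z v
      proof -
        have "norm (grad (\<psi> z) t \<bullet> v) \<le> norm (grad (\<psi> z) t) * norm v" using Cauchy_Schwarz_ineq2 by simp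
        also have "\<dots> \<le> (C * m\<^sub>0 z) * norm v" using S(3)[OF that] by (rule mult_right_mono) simp
        finally show ?thesis .
      qed
      show "integrable F (\<lambda>z. C * m\<^sub>0 z)" using int_m by simp
    qed
    then show ?thesis
      unfolding gderiv_iff by (simp only: integral_inner_left[OF integrable_est_G[OF int_est]])
  qed
  \<comment> \<open>\<open>V\<close> is the mean of the Jacobians of \<eta> at
    \<open>\<alpha>\<^sub>0\<close>, so the law of large numbers aims at the same matrix that is
    assumed non-singular.\<close>
  have V_der: "(est ?f ?G ?P ?Q has_derivative (*v) V) (at \<alpha>\<^sub>0)"
    using \<Psi>_der[OF U(2)] unfolding V_eq \<Psi>_est .

  \<comment> \<open>Population system and influence function\<close>
  interpret S: estimating_system ?f ?G ?P ?Q ?L \<theta> lambda0 \<alpha>\<^sub>0 U V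
  proof
    show "est ?f ?G ?P ?Q differentiable (at \<alpha>)" if "\<alpha> \<in> U" for \<alpha>
      using \<Psi>_der[OF that] unfolding \<Psi>_est differentiable_def by blast
    show "est ?f ?G ?P ?Q \<alpha>\<^sub>0 = 0" using \<Psi>_root[of \<alpha>\<^sub>0] unfolding \<Psi>_est by simp
    show "invertible V" using \<Psi>_nonsing by (simp add: V_def)
  qed (use U f_der L_der V_der \<theta>_root lambda0_root in blast)+
  have Wj': "Wj j = (\<chi> k. column j D v* hessian (\<lambda>t. ?f t lambda0 $ k) (\<theta> lambda0)) +
      frechet_derivative (\<lambda>l. jacobian (\<lambda>t. ?f t l) (at (\<theta> lambda0))) (at lambda0) (axis j 1)" for j
    unfolding Wj_def \<theta>\<^sub>0_def
    by (simp add: integral_bounded_linear[OF bounded_linear_vec_nth int_\<phi>])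
  note defs = D_def Z1_def Z2_def[unfolded \<theta>\<^sub>0_def] J_def[unfolded \<theta>\<^sub>0_def] b_def[unfolded \<theta>\<^sub>0_def] Wj' W_def Mb_def A1_def A3_def Astar_def
  have J_inv: "invertible J" by (rule S.J_invertible[OF defs])
  have Z1_inv: "invertible Z1" by (rule S.Z1_invertible[OF defs])
  have \<alpha>0: "\<alpha>\<^sub>0 = stack3 \<theta>\<^sub>0 lambda0 (vec_cols D)" unfolding \<theta>\<^sub>0_def by (rule S.root_eq[OF defs])
  have influence: "theta_part (matrix_inv V *v y) = - (Astar *v y)" for y by (rule S.influence[OF defs])

  \<comment> \<open>Asymptotic expansion of the estimator\<close>
  define g where "g z = \<eta> z \<alpha>\<^sub>0" for z
  have g_meas: "g \<in> borel_measurable F" using int_\<eta>[of \<alpha>\<^sub>0] by (simp add: g_def[abs_def] borel_measurable_integrable)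
  have g_sq: "integrable F (\<lambda>z. (norm (g z))\<^sup>2)"
  proof (rule Bochner_Integration.integrable_bound[OF m_sq_int(1)])
    show "(\<lambda>z. (norm (g z))\<^sup>2) \<in> borel_measurable F" using g_meas by measurable
    have "(norm (g z))\<^sup>2 \<le> (m\<^sub>0 z)\<^sup>2" for z using U0[OF U(2)] by (intro power_mono) (auto simp: g_def)
    then show "AE z in F. norm ((norm (g z))\<^sup>2) \<le> norm ((m\<^sub>0 z)\<^sup>2)" by simp
  qed
  have g_mean: "(\<integral>z. g z \<partial>F) = 0" using \<Psi>_root[of \<alpha>\<^sub>0] by (simp add: g_def \<Psi>_\<eta>)
  define T where "T n \<omega> = theta_hat n \<omega> (lambda_hat n \<omega>) - \<theta>\<^sub>0" for n \<omega>
  have T_meas: "T n \<in> borel_measurable M" for n unfolding T_def[abs_def] using hat_meas[of n] by measurable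
  have expansion: "likely M \<epsilon> (\<lambda>n \<omega>. norm (T n \<omega> - Astar *v sample_mean Z n \<omega> g) \<le> e / sqrt (real n))"
    if "e > 0" "\<epsilon> > 0" for e \<epsilon>
  proof -
    obtain \<kappa> where \<kappa>: "\<kappa> > 0" "\<And>x. norm (matrix_inv V *v x) \<le> \<kappa> * norm x"
      using linear_bounded_pos[OF matrix_vector_mul_linear[of "matrix_inv V"]] by blast
    obtain p0 where p0: "p0 > 0" "\<And>X. p0 * norm (mk 0 0 X) \<le> norm (D_part (V *v mk 0 0 X))"
      using S.D_part_V_bounded_below by blast
    obtain B where B: "B > 0" "\<And>x :: real ^ ('p + 'q + 'q \<times> 'p). norm (D_part x) \<le> norm x * B"
      using bounded_linear.pos_bounded[OF bounded_linear_parts(3)] by blast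
    obtain Bt where Bt: "Bt > 0" "\<And>x :: real ^ ('p + 'q + 'q \<times> 'p). norm (theta_part x) \<le> norm x * Bt"
      using bounded_linear.pos_bounded[OF bounded_linear_parts(1)] by blast
    obtain Ca where Ca: "Ca > 0" "\<And>x. norm (Astar *v x) \<le> Ca * norm x"
      using linear_bounded_pos[OF matrix_vector_mul_linear[of Astar]] by blast
    obtain Cm where Cm: "Cm > 0" "\<And>x :: (real ^ 'p) \<times> (real ^ 'q) \<times> (real ^ 'q ^ 'p). norm (mk (fst x) (fst (snd x)) (snd (snd x))) \<le> norm x * Cm"
      using bounded_linear.pos_bounded[OF bounded_linear_mk] by blast
    have mk_r: "norm (mk 0 r 0 :: real ^ ('p + 'q + 'q \<times> 'p)) \<le> Cm * norm r" for r
      using Cm(2)[of "(0, r, 0)"] by (simp add: mult.commute)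
    \<comment> \<open>Makes the contribution of \<open>R\<close>, passed through
      \<open>Astar\<close>, equal to half of the allowed error \<open>e\<close>.\<close>
    define e' where "e' = e / (2 * (Ca * Cm))"
    have e': "e' > 0" "Ca * (Cm * e') = e / 2" using \<open>e > 0\<close> Ca Cm by (auto simp: e'_def)
    have "\<epsilon> / 3 > 0" using \<open>\<epsilon> > 0\<close> by simp
    obtain K where K: "K > 0" "likely M (\<epsilon> / 3) (\<lambda>n \<omega>. norm (sample_mean Z n \<omega> g - (\<integral>z. g z \<partial>F)) \<le> K / sqrt (real n))"
      using sample_mean_root_n_bounded[OF g_meas g_sq \<open>\<epsilon> / 3 > 0\<close>] by blast
    \<comment> \<open>\<open>H / sqrt (real n)\<close> bounds the initial value of the system,
      sample mean at \<open>\<alpha>\<^sub>0\<close> together with the shift by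
      \<open>R\<close>.\<close>
    define H where "H = K + Cm * e'"
    have H: "H > 0" using K Cm e' by (simp add: H_def add_pos_pos)
    \<comment> \<open>The three entries secure, in this order, the half in Brouwer's argument,
      invertibility of the empirical \<open>P\<close>, and a remainder of at most
      \<open>e / 2\<close> after multiplication by \<open>sqrt (real n)\<close>. Since
      \<open>c\<close> is fixed before the ball, \<delta> may depend on it.\<close>
    define c where "c = min (1 / (2 * \<kappa>)) (min (p0 / (6 * B)) (e / (4 * Bt * \<kappa>\<^sup>2 * H)))"
    have c: "c > 0" using \<kappa> p0 B Bt H \<open>e > 0\<close> by (simp add: c_def)
    have c1: "\<kappa> * c \<le> 1 / 2"
    proof -
      have "\<kappa> * c \<le> \<kappa> * (1 / (2 * \<kappa>))" using \<kappa>(1) by (intro mult_left_mono) (auto simp: c_def)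
      then show ?thesis using \<kappa>(1) by simp
    qed
    have c2: "3 * c * B < p0"
    proof -
      have "3 * c * B \<le> 3 * (p0 / (6 * B)) * B" using B(1) by (intro mult_right_mono mult_left_mono) (auto simp: c_def)
      then show ?thesis using B(1) p0(1) by simp
    qed
    have c3: "Bt * (2 * \<kappa>\<^sup>2 * c * H) \<le> e / 2"
    proof -
      have "Bt * (2 * \<kappa>\<^sup>2 * c * H) \<le> Bt * (2 * \<kappa>\<^sup>2 * (e / (4 * Bt * \<kappa>\<^sup>2 * H)) * H)"
        using \<kappa>(1) Bt(1) H by (intro mult_left_mono mult_right_mono) (auto simp: c_def)
      then show ?thesis using \<kappa>(1) Bt(1) H by (simp add: field_simps)
    qed
    note uniform = uniform_linearization[where g=\<eta> and g'="\<lambda>z x v. jacobian (\<eta> z) (at x) *v v" and h=h and U=U and a="\<alpha>\<^sub>0" and c=c,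
        OF U int_\<eta> \<eta>_der h_bd h_int c]
    obtain \<delta> where \<delta>: "\<delta> > 0" and near: "\<And>\<epsilon>. \<epsilon> > 0 \<Longrightarrow> likely M \<epsilon> (\<lambda>n \<omega>. \<forall>x\<in>cball \<alpha>\<^sub>0 \<delta>.
        norm (sample_mean Z n \<omega> (\<lambda>z. \<eta> z x) - sample_mean Z n \<omega> (\<lambda>z. \<eta> z \<alpha>\<^sub>0) - (\<integral>z. jacobian (\<eta> z) (at \<alpha>\<^sub>0) *v (x - \<alpha>\<^sub>0) \<partial>F)) \<le> c * norm (x - \<alpha>\<^sub>0))"
      by (rule uniform, assumption, rule that, assumption+)
    have R_meas: "R n \<in> borel_measurable M" for n by (rule R_op[unfolded small_op_def, THEN conjunct1, rule_format])
    have R_likely: "likely M (\<epsilon> / 3) (\<lambda>n \<omega>. norm (R n \<omega>) \<le> e' * (1 / sqrt (real n)))"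
      by (rule R_op[unfolded small_op_iff_likely[OF R_meas], rule_format, OF e'(1) \<open>\<epsilon> / 3 > 0\<close>])
    \<comment> \<open>Linearisation, root-n bound and smallness of \<open>R\<close> cost
      \<open>\<epsilon> / 3\<close> each; the two uniqueness statements hold almost surely and cost
      nothing.\<close>
    note events = likely_AE[OF likely_AE[OF likely_conj[OF likely_conj[OF near[OF \<open>\<epsilon> / 3 > 0\<close>] K(2)] R_likely]
      theta_hat_root] lambda_hat_root]
    show ?thesis
    proof (rule likely_mono[OF events])
      have "(\<lambda>n. (\<kappa> * H) / sqrt (real n)) \<longlonglongrightarrow> 0"
        by (intro real_tendsto_divide_at_top[OF tendsto_const] filterlim_compose[OF sqrt_at_top filterlim_real_sequentially])
      then have "\<forall>\<^sub>F n in sequentially. (\<kappa> * H) / sqrt (real n) < \<delta> / 4" using \<delta> by (intro order_tendstoD) auto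
      then show "\<forall>\<^sub>F n in sequentially. \<forall>\<omega>\<in>space M.
        ((((\<forall>x\<in>cball \<alpha>\<^sub>0 \<delta>. norm (sample_mean Z n \<omega> (\<lambda>z. \<eta> z x) - sample_mean Z n \<omega> (\<lambda>z. \<eta> z \<alpha>\<^sub>0) -
            (\<integral>z. jacobian (\<eta> z) (at \<alpha>\<^sub>0) *v (x - \<alpha>\<^sub>0) \<partial>F)) \<le> c * norm (x - \<alpha>\<^sub>0)) \<and>
          norm (sample_mean Z n \<omega> g - (\<integral>z. g z \<partial>F)) \<le> K / sqrt (real n)) \<and>
          norm (R n \<omega>) \<le> e' * (1 / sqrt (real n))) \<and>
          (\<forall>l t. sample_mean Z n \<omega> (\<lambda>z. \<phi> z t l) = 0 \<longleftrightarrow> t = theta_hat n \<omega> l)) \<and>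
          (\<forall>l. (GDERIV (\<lambda>l. sample_mean Z n \<omega> (\<lambda>z. \<psi> z (theta_hat n \<omega> l))) l :> R n \<omega>) \<longleftrightarrow> l = lambda_hat n \<omega>) \<longrightarrow>
        norm (T n \<omega> - Astar *v sample_mean Z n \<omega> g) \<le> e / sqrt (real n)"
      proof eventually_elim
        case (elim n)
        show ?case
        proof (intro ballI impI, elim conjE)
          fix \<omega>
          assume near_\<omega>: "\<forall>x\<in>cball \<alpha>\<^sub>0 \<delta>. norm (sample_mean Z n \<omega> (\<lambda>z. \<eta> z x) - sample_mean Z n \<omega> (\<lambda>z. \<eta> z \<alpha>\<^sub>0) -
              (\<integral>z. jacobian (\<eta> z) (at \<alpha>\<^sub>0) *v (x - \<alpha>\<^sub>0) \<partial>F)) \<le> c * norm (x - \<alpha>\<^sub>0)"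
            and g_\<omega>: "norm (sample_mean Z n \<omega> g - (\<integral>z. g z \<partial>F)) \<le> K / sqrt (real n)"
            and R_\<omega>: "norm (R n \<omega>) \<le> e' * (1 / sqrt (real n))"
            and theta_\<omega>: "\<forall>l t. sample_mean Z n \<omega> (\<lambda>z. \<phi> z t l) = 0 \<longleftrightarrow> t = theta_hat n \<omega> l"
            and lambda_\<omega>: "\<forall>l. (GDERIV (\<lambda>l. sample_mean Z n \<omega> (\<lambda>z. \<psi> z (theta_hat n \<omega> l))) l :> R n \<omega>) \<longleftrightarrow> l = lambda_hat n \<omega>"
          let ?E = "est (\<lambda>t l. sample_mean Z n \<omega> (\<lambda>z. \<phi> z t l)) (\<lambda>t. sample_mean Z n \<omega> (\<lambda>z. grad (\<psi> z) t))
            (\<lambda>t l. sample_mean Z n \<omega> (\<lambda>z. ?Pz z t l)) (\<lambda>t l. sample_mean Z n \<omega> (\<lambda>z. ?Qz z t l))"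
          have E: "?E \<alpha> = sample_mean Z n \<omega> (\<lambda>z. \<eta> z \<alpha>)" for \<alpha> unfolding \<eta>_est by (rule sample_mean_est[symmetric])
          have E': "?E = (\<lambda>\<alpha>. sample_mean Z n \<omega> (\<lambda>z. \<eta> z \<alpha>))" using E by (rule ext)
          have E0: "?E \<alpha>\<^sub>0 = sample_mean Z n \<omega> g" using E by (simp add: g_def[abs_def])
          define h0 where "h0 = ?E \<alpha>\<^sub>0 - mk 0 (R n \<omega>) 0"
          have Rm: "norm (mk 0 (R n \<omega>) 0 :: real ^ ('p + 'q + 'q \<times> 'p)) \<le> Cm * e' / sqrt (real n)"
            using order_trans[OF mk_r[of "R n \<omega>"] mult_left_mono[OF R_\<omega>, of Cm]] Cm(1) by simp
          have h0: "norm h0 \<le> H / sqrt (real n)"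
          proof -
            have "norm h0 \<le> norm (sample_mean Z n \<omega> g) + norm (mk 0 (R n \<omega>) 0 :: real ^ ('p + 'q + 'q \<times> 'p))"
              unfolding h0_def E0 by (rule norm_triangle_ineq4)
            also have "\<dots> \<le> K / sqrt (real n) + Cm * e' / sqrt (real n)" using g_\<omega> Rm g_mean by simp
            finally show ?thesis by (simp add: H_def add_divide_distrib)
          qed
          have "\<exists>\<alpha>. theta_part \<alpha> = theta_hat n \<omega> (lambda_hat n \<omega>) \<and>
            norm (\<alpha> - \<alpha>\<^sub>0 + matrix_inv V *v (?E \<alpha>\<^sub>0 - mk 0 (R n \<omega>) 0)) \<le> 2 * \<kappa>\<^sup>2 * c * norm (?E \<alpha>\<^sub>0 - mk 0 (R n \<omega>) 0)"
          proof (rule sample_root[where \<theta>="theta_hat n \<omega>" and lh="lambda_hat n \<omega>" and r="R n \<omega>" and V=V and \<kappa>=\<kappa> and c=c and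
                L="\<lambda>t. sample_mean Z n \<omega> (\<lambda>z. \<psi> z t)" and B=B and \<delta>=\<delta>,
                OF _ _ _ _ _ _ S.V_inv \<kappa>(2,1) c \<delta> p0(2) less_imp_le[OF B(1)] _ c1 _ c2])
            show "((\<lambda>(t, l). sample_mean Z n \<omega> (\<lambda>z. \<phi> z t l)) has_derivative
              (\<lambda>(u, w). sample_mean Z n \<omega> (\<lambda>z. ?Pz z t l) *v u + sample_mean Z n \<omega> (\<lambda>z. ?Qz z t l) *v w)) (at (t, l))" for t l
              by (rule sample_mean_partials[where f=\<phi> and P="?Pz" and Q="?Qz", OF \<phi>_der])
            show "GDERIV (\<lambda>t. sample_mean Z n \<omega> (\<lambda>z. \<psi> z t)) t :> sample_mean Z n \<omega> (\<lambda>z. grad (\<psi> z) t)" for t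
              by (rule GDERIV_sample_mean[OF \<psi>_der])
            show "continuous_on UNIV ?E"
              unfolding E' by (intro continuous_at_imp_continuous_on ballI has_derivative_continuous[OF has_derivative_sample_mean[OF \<eta>_der]])
            show "sample_mean Z n \<omega> (\<lambda>z. \<phi> z t l) = 0 \<longleftrightarrow> t = theta_hat n \<omega> l" for l t using theta_\<omega> by blast
            show "(GDERIV (\<lambda>l. sample_mean Z n \<omega> (\<lambda>z. \<psi> z (theta_hat n \<omega> l))) l :> R n \<omega>) \<longleftrightarrow> l = lambda_hat n \<omega>" for l
              using lambda_\<omega> by blast
            show "norm (?E \<alpha> - ?E \<alpha>\<^sub>0 - V *v (\<alpha> - \<alpha>\<^sub>0)) \<le> c * norm (\<alpha> - \<alpha>\<^sub>0)" if "\<alpha> \<in> cball \<alpha>\<^sub>0 \<delta>" for \<alpha>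
              using near_\<omega> that unfolding E V_eq by blast
            show "norm (D_part x) \<le> B * norm x" for x :: "real ^ ('p + 'q + 'q \<times> 'p)" using B(2)[of x] by (simp add: mult.commute)
            have "\<kappa> * norm h0 \<le> \<kappa> * (H / sqrt (real n))" using h0 \<kappa>(1) by (intro mult_left_mono) auto
            also have "\<dots> \<le> \<delta> / 4" using less_imp_le[OF elim] by simp
            finally show "\<kappa> * norm (?E \<alpha>\<^sub>0 - mk 0 (R n \<omega>) 0) \<le> \<delta> / 4" unfolding h0_def .
          qed
          then obtain \<alpha> where \<alpha>: "theta_part \<alpha> = theta_hat n \<omega> (lambda_hat n \<omega>)"
            "norm (\<alpha> - \<alpha>\<^sub>0 + matrix_inv V *v h0) \<le> 2 * \<kappa>\<^sup>2 * c * norm h0" unfolding h0_def by blast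
          \<comment> \<open>Here the random root leaves the argument: its \<theta>-part is the
            measurable estimator, and \<open>influence\<close> replaces the inverse of
            \<open>V\<close> by \<open>Astar\<close>.\<close>
          have "theta_part (\<alpha> - \<alpha>\<^sub>0 + matrix_inv V *v h0) = T n \<omega> - Astar *v h0"
            using parts_mk(1)[of \<theta>\<^sub>0 lambda0 D] by (simp add: parts_linear influence T_def \<alpha>(1) \<alpha>0)
          then have "T n \<omega> - Astar *v sample_mean Z n \<omega> g = theta_part (\<alpha> - \<alpha>\<^sub>0 + matrix_inv V *v h0) - Astar *v mk 0 (R n \<omega>) 0"
            by (simp add: h0_def E0 matrix_vector_mult_diff_distrib)
          then have "norm (T n \<omega> - Astar *v sample_mean Z n \<omega> g) \<le>
              norm (theta_part (\<alpha> - \<alpha>\<^sub>0 + matrix_inv V *v h0)) + norm (Astar *v mk 0 (R n \<omega>) 0)"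
            by (metis norm_triangle_ineq4)
          also have "\<dots> \<le> Bt * (2 * \<kappa>\<^sup>2 * c * H) / sqrt (real n) + Ca * (Cm * e') / sqrt (real n)"
          proof (rule add_mono)
            have "norm (theta_part (\<alpha> - \<alpha>\<^sub>0 + matrix_inv V *v h0)) \<le> (2 * \<kappa>\<^sup>2 * c * norm h0) * Bt"
              using order_trans[OF Bt(2) mult_right_mono[OF \<alpha>(2)]] Bt(1) by simp
            also have "\<dots> \<le> (2 * \<kappa>\<^sup>2 * c * (H / sqrt (real n))) * Bt"
              using h0 c \<kappa>(1) Bt(1) by (intro mult_right_mono mult_left_mono) auto
            finally show "norm (theta_part (\<alpha> - \<alpha>\<^sub>0 + matrix_inv V *v h0)) \<le> Bt * (2 * \<kappa>\<^sup>2 * c * H) / sqrt (real n)"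
              by (simp add: ac_simps)
            show "norm (Astar *v mk 0 (R n \<omega>) 0) \<le> Ca * (Cm * e') / sqrt (real n)"
              using order_trans[OF Ca(2) mult_left_mono[OF Rm, of Ca]] Ca(1) by simp
          qed
          also have "\<dots> \<le> (e / 2) / sqrt (real n) + (e / 2) / sqrt (real n)"
            using c3 e'(2) by (intro add_mono divide_right_mono) auto
          also have "\<dots> = e / sqrt (real n)" by (simp flip: add_divide_distrib)
          finally show "norm (T n \<omega> - Astar *v sample_mean Z n \<omega> g) \<le> e / sqrt (real n)" .
        qed
      qed
    qed simp
  qed

  \<comment> \<open>Expansion in the stated form, consistency and limit law\<close>
  have Tg: "theta_hat n \<omega> (lambda_hat n \<omega>) -
             (\<theta>\<^sub>0 + A1 *v sample_mean Z n \<omega> (\<lambda>z. \<phi> z \<theta>\<^sub>0 lambda0)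
                 + A2 *v sample_mean Z n \<omega> (\<lambda>z. grad (\<psi> z) \<theta>\<^sub>0)
                 + A3 *v vec_cols (sample_mean Z n \<omega> (\<lambda>z.
                     ?Pz z \<theta>\<^sub>0 lambda0 ** D + ?Qz z \<theta>\<^sub>0 lambda0)))
      = T n \<omega> - Astar *v sample_mean Z n \<omega> g" for n \<omega>
  proof -
    \<comment> \<open>The middle block already carries the factor \<open>transpose D\<close>, so the
      middle block of \<open>Astar\<close> acts on the mean gradient as \<open>A2\<close>.\<close>
    have "sample_mean Z n \<omega> g = mk (sample_mean Z n \<omega> (\<lambda>z. \<phi> z \<theta>\<^sub>0 lambda0))
        (transpose D *v sample_mean Z n \<omega> (\<lambda>z. grad (\<psi> z) \<theta>\<^sub>0))
        (sample_mean Z n \<omega> (\<lambda>z. ?Pz z \<theta>\<^sub>0 lambda0 ** D + ?Qz z \<theta>\<^sub>0 lambda0))"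
      unfolding g_def[abs_def] \<eta>_est sample_mean_est unfolding \<alpha>0 est_mk sample_mean_add
      by (simp only: sample_mean_bounded_linear[OF bounded_linear_matrix_left(2)])
    then show ?thesis
      by (simp add: Astar_def hcat3_mult T_def A2_def uminus_matrix_vector matrix_vector_mul_assoc[symmetric])
  qed
  have A_bl: "bounded_linear ((*v) Astar)" by (rule matrix_vector_mul_bounded_linear)
  have res_meas: "(\<lambda>\<omega>. T n \<omega> - Astar *v sample_mean Z n \<omega> g) \<in> borel_measurable M" for n
    by (intro borel_measurable_diff T_meas
        borel_measurable_continuous_on[OF linear_continuous_on[OF A_bl] sample_mean_measurable[OF g_meas]])
  have "small_op M (\<lambda>n \<omega>. T n \<omega> - Astar *v sample_mean Z n \<omega> g) (\<lambda>n. 1 / sqrt (real n))"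
    using expansion unfolding small_op_iff_likely[OF res_meas] by simp
  moreover have "consistent_for M (\<lambda>n \<omega>. theta_hat n \<omega> (lambda_hat n \<omega>)) \<theta>\<^sub>0"
    unfolding consistent_for_def T_def[symmetric] small_op_iff_likely[OF T_meas]
  proof (intro allI impI)
    fix e \<epsilon> :: real assume e: "e > 0" "\<epsilon> > 0"
    obtain Ca where Ca: "Ca > 0" "\<And>x. norm (Astar *v x) \<le> Ca * norm x"
      using linear_bounded_pos[OF matrix_vector_mul_linear[of Astar]] by blast
    \<comment> \<open>Consistency follows from the expansion: the linear term is within
      \<open>e / 2\<close> of 0 by the law of large numbers, and the remainder is at most
      \<open>e / 2\<close> as soon as \<open>n\<close> is at least 1.\<close>
    have "likely M (\<epsilon> / 2 + \<epsilon> / 2) (\<lambda>n \<omega>. norm (T n \<omega> - Astar *v sample_mean Z n \<omega> g) \<le> (e / 2) / sqrt (real n) \<and>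
        norm (sample_mean Z n \<omega> g - (\<integral>z. g z \<partial>F)) \<le> e / (2 * Ca))"
      using e Ca(1) by (intro likely_conj expansion sample_mean_likely_near[OF g_meas g_sq]) auto
    then show "likely M \<epsilon> (\<lambda>n \<omega>. norm (T n \<omega>) \<le> e * 1)"
    proof (rule likely_mono)
      show "\<forall>\<^sub>F n in sequentially. \<forall>\<omega>\<in>space M. norm (T n \<omega> - Astar *v sample_mean Z n \<omega> g) \<le> (e / 2) / sqrt (real n) \<and>
        norm (sample_mean Z n \<omega> g - (\<integral>z. g z \<partial>F)) \<le> e / (2 * Ca) \<longrightarrow> norm (T n \<omega>) \<le> e * 1"
        using eventually_ge_at_top[of 1]
      proof eventually_elim
        case (elim n)
        have n: "(e / 2) / sqrt (real n) \<le> (e / 2) / 1" using elim e(1) by (intro divide_left_mono) auto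
        have A: "norm (Astar *v y) \<le> e / 2" if "norm y \<le> e / (2 * Ca)" for y
          using order_trans[OF Ca(2)[of y] mult_left_mono[OF that, of Ca]] Ca(1) by simp
        show ?case
        proof (intro ballI impI, elim conjE)
          fix \<omega> assume "norm (T n \<omega> - Astar *v sample_mean Z n \<omega> g) \<le> (e / 2) / sqrt (real n)"
            and "norm (sample_mean Z n \<omega> g - (\<integral>z. g z \<partial>F)) \<le> e / (2 * Ca)"
          then show "norm (T n \<omega>) \<le> e * 1"
            using norm_triangle_sub[of "T n \<omega>" "Astar *v sample_mean Z n \<omega> g"] A[of "sample_mean Z n \<omega> g"] n g_mean by simp
        qed
      qed
    qed simp
  qed
  moreover have "\<exists>N. is_multivariate_normal N 0 (Astar ** Kstar ** transpose Astar) \<and>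
      converges_in_law M (\<lambda>n \<omega>. sqrt (real n) *\<^sub>R T n \<omega>) N"
    using asymptotically_linear_imp_normal[OF g_meas g_sq g_mean T_meas expansion]
    by (simp add: Kstar_def \<alpha>0[symmetric] g_def[abs_def] \<eta>_def)
  ultimately show ?thesis using J_inv Z1_inv unfolding Tg by (simp add: T_def)
qed

end
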